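(* Let $T:(X_0,X_1)\to(Y_0,Y_1)$ be an operator between couples of complex Banach spaces. If $T:[X_0,X_1]_{\theta_*}\to[Y_0,Y_1]_{\theta_*}$ is invertible for some $\theta_*\in(0,1)$, then $T:(X_0,X_1)_{\theta_*,q}\to(Y_0,Y_1)_{\theta_*,q}$ is invertible for every $q\in[1,\infty]$.
   Context: An operator $T:\vec X\to\vec Y$ is a linear map $X_0+X_1\to Y_0+Y_1$ bounded $X_j\to Y_j$. $[\vec X]_\theta$ is Calderón's (lower) complex interpolation space: $\{f(\theta):f\in\mathcal F(\vec X)\}$ with the quotient norm, where $\mathcal F(\vec X)$ consists of bounded continuous $f:\{0\le\mathrm{Re}\,z\le1\}\to X_0+X_1$ analytic in the open strip with $t\mapsto f(j+it)$ bounded continuous into $X_j$, normed by $\max_j\sup_t\|f(j+it)\|_{X_j}$. $(X_0,X_1)_{\theta,q}$ is the real interpolation space with norm $\big(\int_0^\infty(t^{-\theta}K(t,x;\vec X))^q\,dt/t\big)^{1/q}$ (sup for $q=\infty$), $K(t,x;\vec X)=\inf\{\|x_0\|_{X_0}+t\|x_1\|_{X_1}:x=x_0+x_1\}$. *)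

theory Defs
  imports "HOL-Analysis.Analysis"
begin

text \<open>A couple of complex Banach spaces is modelled as two subspaces X0, X1 of an ambient
  complex vector space (ambient type 'v with complex scalar multiplication sc), each carrying
  its own norm N0, N1 under which it is complete, and such that the sum X0 + X1 carries the
  (Hausdorff) norm K(1,.).\<close>

record 'v bcouple =
  sc :: "complex \<Rightarrow> 'v \<Rightarrow> 'v"
  sp0 :: "'v set"
  nm0 :: "'v \<Rightarrow> real"
  sp1 :: "'v set"
  nm1 :: "'v \<Rightarrow> real"

definition sumsp :: "('v::ab_group_add) bcouple \<Rightarrow> 'v set" where
  "sumsp X = {a + b | a b. a \<in> sp0 X \<and> b \<in> sp1 X}"

definition Kfun :: "('v::ab_group_add) bcouple \<Rightarrow> real \<Rightarrow> 'v \<Rightarrow> real" where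
  "Kfun X t x = Inf {nm0 X a + t * nm1 X b | a b. a \<in> sp0 X \<and> b \<in> sp1 X \<and> x = a + b}"

definition normed_subspace :: "(complex \<Rightarrow> 'v::ab_group_add \<Rightarrow> 'v) \<Rightarrow> 'v set \<Rightarrow> ('v \<Rightarrow> real) \<Rightarrow> bool" where
  "normed_subspace s X N \<longleftrightarrow> module.subspace s X \<and>
     (\<forall>x\<in>X. 0 \<le> N x \<and> (N x = 0 \<longleftrightarrow> x = 0)) \<and>
     (\<forall>x\<in>X. \<forall>y\<in>X. N (x + y) \<le> N x + N y) \<and>
     (\<forall>c. \<forall>x\<in>X. N (s c x) = cmod c * N x)"

definition complete_wrt :: "'v::ab_group_add set \<Rightarrow> ('v \<Rightarrow> real) \<Rightarrow> bool" where
  "complete_wrt X N \<longleftrightarrow> (\<forall>u::nat \<Rightarrow> 'v. (\<forall>n. u n \<in> X) \<and>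
       (\<forall>e>0. \<exists>M. \<forall>m\<ge>M. \<forall>n\<ge>M. N (u m - u n) < e) \<longrightarrow>
       (\<exists>x\<in>X. \<forall>e>0. \<exists>M. \<forall>n\<ge>M. N (u n - x) < e))"

definition banach_couple :: "('v::ab_group_add) bcouple \<Rightarrow> bool" where
  "banach_couple X \<longleftrightarrow> vector_space (sc X) \<and>
     normed_subspace (sc X) (sp0 X) (nm0 X) \<and> complete_wrt (sp0 X) (nm0 X) \<and>
     normed_subspace (sc X) (sp1 X) (nm1 X) \<and> complete_wrt (sp1 X) (nm1 X) \<and>
     (\<forall>x\<in>sumsp X. Kfun X 1 x = 0 \<longrightarrow> x = 0)"

definition couple_operator :: "('v::ab_group_add) bcouple \<Rightarrow> ('w::ab_group_add) bcouple \<Rightarrow> ('v \<Rightarrow> 'w) \<Rightarrow> bool" where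
  "couple_operator X Y T \<longleftrightarrow>
     (\<forall>x\<in>sumsp X. \<forall>y\<in>sumsp X. T (x + y) = T x + T y) \<and>
     (\<forall>c. \<forall>x\<in>sumsp X. T (sc X c x) = sc Y c (T x)) \<and>
     (\<forall>x\<in>sp0 X. T x \<in> sp0 Y) \<and> (\<forall>x\<in>sp1 X. T x \<in> sp1 Y) \<and>
     (\<exists>C. \<forall>x\<in>sp0 X. nm0 Y (T x) \<le> C * nm0 X x) \<and>
     (\<exists>C. \<forall>x\<in>sp1 X. nm1 Y (T x) \<le> C * nm1 X x)"

definition strip :: "complex set" where
  "strip = {z. 0 \<le> Re z \<and> Re z \<le> 1}"

text \<open>Calderon's space F(X): bounded continuous X0+X1-valued functions on the closed strip,
  analytic in the open strip, with boundary values bounded continuous into X0 resp. X1.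
  Topology/differentiability on X0+X1 refers to the norm K(1,.).\<close>
definition calF :: "('v::ab_group_add) bcouple \<Rightarrow> (complex \<Rightarrow> 'v) set" where
  "calF X = {f.
     (\<forall>z\<in>strip. f z \<in> sumsp X) \<and>
     (\<exists>B. \<forall>z\<in>strip. Kfun X 1 (f z) \<le> B) \<and>
     (\<forall>z\<in>strip. \<forall>e>0. \<exists>d>0. \<forall>w\<in>strip. cmod (w - z) < d \<longrightarrow> Kfun X 1 (f w - f z) < e) \<and>
     (\<forall>z. 0 < Re z \<and> Re z < 1 \<longrightarrow> (\<exists>D\<in>sumsp X. \<forall>e>0. \<exists>d>0. \<forall>h. 0 < cmod h \<and> cmod h < d
         \<and> 0 < Re (z + h) \<and> Re (z + h) < 1 \<longrightarrow>
           Kfun X 1 (sc X (inverse h) (f (z + h) - f z) - D) < e)) \<and>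
     (\<forall>t. f (Complex 0 t) \<in> sp0 X) \<and> (\<forall>t. f (Complex 1 t) \<in> sp1 X) \<and>
     (\<exists>B. \<forall>t. nm0 X (f (Complex 0 t)) \<le> B) \<and> (\<exists>B. \<forall>t. nm1 X (f (Complex 1 t)) \<le> B) \<and>
     (\<forall>t. \<forall>e>0. \<exists>d>0. \<forall>s. \<bar>s - t\<bar> < d \<longrightarrow> nm0 X (f (Complex 0 s) - f (Complex 0 t)) < e) \<and>
     (\<forall>t. \<forall>e>0. \<exists>d>0. \<forall>s. \<bar>s - t\<bar> < d \<longrightarrow> nm1 X (f (Complex 1 s) - f (Complex 1 t)) < e)}"

definition Fnorm :: "('v::ab_group_add) bcouple \<Rightarrow> (complex \<Rightarrow> 'v) \<Rightarrow> real" where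
  "Fnorm X f = max (SUP t. nm0 X (f (Complex 0 t))) (SUP t. nm1 X (f (Complex 1 t)))"

definition cinterp_space :: "('v::ab_group_add) bcouple \<Rightarrow> real \<Rightarrow> 'v set" where
  "cinterp_space X \<theta> = {f (complex_of_real \<theta>) | f. f \<in> calF X}"

definition cinterp_norm :: "('v::ab_group_add) bcouple \<Rightarrow> real \<Rightarrow> 'v \<Rightarrow> real" where
  "cinterp_norm X \<theta> x = Inf {Fnorm X f | f. f \<in> calF X \<and> f (complex_of_real \<theta>) = x}"

definition rinterp_fun :: "('v::ab_group_add) bcouple \<Rightarrow> real \<Rightarrow> ennreal \<Rightarrow> 'v \<Rightarrow> ennreal" where
  "rinterp_fun X \<theta> q x =
     (if q = \<infinity> then (SUP t\<in>{0<..}. ennreal (t powr (-\<theta>) * Kfun X t x))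
      else (\<integral>\<^sup>+ t. indicator {0<..} t * ennreal ((t powr (-\<theta>) * Kfun X t x) powr (enn2real q) / t) \<partial>lborel))"

definition rinterp_space :: "('v::ab_group_add) bcouple \<Rightarrow> real \<Rightarrow> ennreal \<Rightarrow> 'v set" where
  "rinterp_space X \<theta> q = {x \<in> sumsp X. rinterp_fun X \<theta> q x < \<infinity>}"

definition rinterp_norm :: "('v::ab_group_add) bcouple \<Rightarrow> real \<Rightarrow> ennreal \<Rightarrow> 'v \<Rightarrow> real" where
  "rinterp_norm X \<theta> q x =
     (if q = \<infinity> then enn2real (rinterp_fun X \<theta> q x)
      else enn2real (rinterp_fun X \<theta> q x) powr (1 / enn2real q))"

definition invertible_between :: "'v set \<Rightarrow> ('v \<Rightarrow> real) \<Rightarrow> 'w set \<Rightarrow> ('w \<Rightarrow> real) \<Rightarrow> ('v \<Rightarrow> 'w) \<Rightarrow> bool" where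
  "invertible_between A nA B nB T \<longleftrightarrow> bij_betw T A B \<and>
     (\<exists>C>0. \<forall>x\<in>A. nB (T x) \<le> C * nA x \<and> nA x \<le> C * nB (T x))"

end

theory Submission
  imports Defs "HOL-Complex_Analysis.Complex_Analysis"
begin

text \<open>
  Let \<open>y\<close> lie in \<open>Y\<^sub>0 \<inter> Y\<^sub>1\<close> and let \<open>x\<close> be its preimage in the complex space at \<open>\<theta>\<close>.  Starting from
  \<open>g\<^sub>0(z) = s\<^bsup>z - \<theta>\<^esup> y\<close>, choose \<open>f\<^sub>n\<close> in the Calderon space of \<open>X\<close> with \<open>T f\<^sub>n(\<theta>) = g\<^sub>n(\<theta>)\<close> and put
  \<open>g\<^sub>n\<^sub>+\<^sub>1(z) = (g\<^sub>n(z) - T f\<^sub>n(z)) / (z - \<theta>)\<close>; the norms grow at most geometrically, so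
  \<open>F(z) = \<Sum>n. (z - \<theta>)\<^sup>n f\<^sub>n(z)\<close> converges near \<open>\<theta>\<close> and \<open>T F(z) = s\<^bsup>z - \<theta>\<^esup> y\<close>.  For \<open>Re z = \<theta>\<close> injectivity of \<open>T\<close>
  on the complex space at \<open>\<theta>\<close> forces \<open>F(z) = s\<^bsup>z - \<theta>\<^esup> x\<close>, and by the identity theorem this persists at
  all nearby real parameters \<open>\<theta>'\<close>.  Together with the three lines theorem this gives
  \<open>K(t, x) \<le> c (t / s)\<^bsup>\<theta>'\<^esup> max (\<parallel>y\<parallel>\<^sub>0) (s \<parallel>y\<parallel>\<^sub>1)\<close> for \<open>\<theta>'\<close> on both sides of \<open>\<theta>\<close>.  Applied to the pieces of a dyadic
  decomposition \<open>y = a(s) + b(s)\<close>, the estimate sums up to a preimage of an arbitrary element of the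
  real interpolation space, and a limiting argument with the same estimate shows injectivity.
\<close>

section \<open>Complex normed spaces with explicit carrier\<close>

text \<open>F is not an element of the Calderon space: its series is controlled only near \<theta>,
  and nothing is claimed about \<open>T\<close> on the complex spaces at other parameters. What
  survives at \<theta>' is the bound K(t, f(\<theta>')) <= t^\<theta>' M for each term, and the real
  method asks for no more. Information about x enters along the vertical line because translation by
  ir preserves the Calderon space and its norm: partial sums at \<theta> + ir, with the scalar
  coefficients frozen, are values at \<theta> of Calderon functions, so the one available inverse
  applies to them. All function theory is scalar: functionals contractive for K(t, .) carry the
  three lines bound, the division by z - \<theta> and the identity theorem over to the sum space.
  Two values \<theta>' = \<theta> + \<epsilon> and \<theta> - \<epsilon> are needed since (t /
  s)^\<theta>' must beat s^\<theta> both for large and for small s; the preimage is always taken in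
  the complex space at \<theta>, so both bounds concern the same element.\<close>

locale cnspace = vector_space s
  for s :: "complex \<Rightarrow> 'v::ab_group_add \<Rightarrow> 'v" +
  fixes V :: "'v set" and N :: "'v \<Rightarrow> real"
  assumes normed: "normed_subspace s V N"
begin

lemma subsp: "subspace V"
  using normed by (simp add: normed_subspace_def)

lemmas mem_zero = subspace_0[OF subsp]
  and mem_add = subspace_add[OF subsp]
  and mem_diff = subspace_diff[OF subsp]
  and mem_neg = subspace_neg[OF subsp]
  and mem_scale = subspace_scale[OF subsp]

lemma N_nonneg: "x \<in> V \<Longrightarrow> 0 \<le> N x"
  and N_eq_0: "x \<in> V \<Longrightarrow> N x = 0 \<longleftrightarrow> x = 0"
  and N_triangle: "x \<in> V \<Longrightarrow> y \<in> V \<Longrightarrow> N (x + y) \<le> N x + N y"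
  and N_scale: "x \<in> V \<Longrightarrow> N (s c x) = cmod c * N x"
  using normed by (auto simp: normed_subspace_def)

lemma N_zero [simp]: "N 0 = 0"
  using N_eq_0 mem_zero by blast

lemma N_minus: "x \<in> V \<Longrightarrow> N (- x) = N x"
  using N_scale[of x "-1"] by simp

lemma N_diff: "x \<in> V \<Longrightarrow> y \<in> V \<Longrightarrow> N (x - y) \<le> N x + N y"
  using N_triangle[of x "- y"] N_minus mem_neg by simp

lemma N_commute: "x \<in> V \<Longrightarrow> y \<in> V \<Longrightarrow> N (x - y) = N (y - x)"
  using N_minus[of "x - y"] mem_diff by simp

lemma N_triangle3:
  "x \<in> V \<Longrightarrow> y \<in> V \<Longrightarrow> z \<in> V \<Longrightarrow> N (x - z) \<le> N (x - y) + N (y - z)"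
  using N_triangle[of "x - y" "y - z"] mem_diff by simp

lemma mem_sum: "(\<And>i. i \<in> I \<Longrightarrow> f i \<in> V) \<Longrightarrow> sum f I \<in> V"
  using subspace_sum[OF subsp] by blast

lemma N_sum: "(\<And>i. i \<in> I \<Longrightarrow> f i \<in> V) \<Longrightarrow> N (sum f I) \<le> (\<Sum>i\<in>I. N (f i))"
proof (induction I rule: infinite_finite_induct)
  case (insert i I)
  then show ?case
    using N_triangle[of "f i" "sum f I"] mem_sum[of I f] by force
qed auto

text \<open>Limits are taken along an arbitrary filter, so that sequences, continuity on the strip
  and difference quotients share one calculus. Nothing is known about \<open>N\<close> outside
  \<open>V\<close>, hence the eventual membership conditions in the rules below.\<close>

definition vlim :: "('b \<Rightarrow> 'v) \<Rightarrow> 'v \<Rightarrow> 'b filter \<Rightarrow> bool" where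
  "vlim f l F \<longleftrightarrow> ((\<lambda>w. N (f w - l)) \<longlongrightarrow> 0) F"

lemma vlimI:
  assumes "\<forall>\<^sub>F w in F. f w \<in> V" "l \<in> V" "\<forall>\<^sub>F w in F. N (f w - l) \<le> g w" "(g \<longlongrightarrow> 0) F"
  shows "vlim f l F"
  unfolding vlim_def
proof (rule tendsto_sandwich[OF _ assms(3) tendsto_const assms(4)])
  show "\<forall>\<^sub>F w in F. 0 \<le> N (f w - l)"
    using assms(1) by eventually_elim (use assms(2) N_nonneg mem_diff in blast)
qed

lemma vlim_const: "vlim (\<lambda>_. l) l F"
  by (simp add: vlim_def)

lemma vlim_cong:
  assumes "\<forall>\<^sub>F w in F. f w = g w" "vlim f l F"
  shows "vlim g l F"
  using assms unfolding vlim_def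
  by (rule_tac tendsto_cong[THEN iffD1, rotated]) (auto elim: eventually_mono)

lemma vlim_add:
  assumes "\<forall>\<^sub>F w in F. f w \<in> V" "l \<in> V" "vlim f l F"
    and "\<forall>\<^sub>F w in F. g w \<in> V" "m \<in> V" "vlim g m F"
  shows "vlim (\<lambda>w. f w + g w) (l + m) F"
proof (rule vlimI)
  show "\<forall>\<^sub>F w in F. f w + g w \<in> V"
    using assms(1,4) by eventually_elim (rule mem_add)
  show "\<forall>\<^sub>F w in F. N (f w + g w - (l + m)) \<le> N (f w - l) + N (g w - m)"
    using assms(1,4)
  proof eventually_elim
    case (elim w)
    then show ?case
      using N_triangle[of "f w - l" "g w - m"] assms(2,5) mem_diff
      by (simp add: algebra_simps)
  qed
  show "((\<lambda>w. N (f w - l) + N (g w - m)) \<longlongrightarrow> 0) F"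
    using tendsto_add[OF assms(3)[unfolded vlim_def] assms(6)[unfolded vlim_def]] by simp
qed (use assms mem_add in auto)

lemma vlim_scale:
  assumes a: "(a \<longlongrightarrow> \<alpha>) F" and f: "\<forall>\<^sub>F w in F. f w \<in> V" and l: "l \<in> V" and lim: "vlim f l F"
  shows "vlim (\<lambda>w. s (a w) (f w)) (s \<alpha> l) F"
proof (rule vlimI)
  show "\<forall>\<^sub>F w in F. s (a w) (f w) \<in> V"
    using f by eventually_elim (rule mem_scale)
  show "\<forall>\<^sub>F w in F. N (s (a w) (f w) - s \<alpha> l)
      \<le> cmod (a w) * N (f w - l) + cmod (a w - \<alpha>) * N l"
    using f
  proof eventually_elim
    case (elim w)
    have "s (a w) (f w) - s \<alpha> l = s (a w) (f w - l) + s (a w - \<alpha>) l"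
      by (simp add: scale_right_diff_distrib scale_left_diff_distrib)
    then show ?case
      using N_triangle[of "s (a w) (f w - l)" "s (a w - \<alpha>) l"] elim l
      by (simp add: N_scale mem_scale mem_diff)
  qed
  have "((\<lambda>w. cmod (a w) * N (f w - l) + cmod (a w - \<alpha>) * N l) \<longlongrightarrow> cmod \<alpha> * 0 + 0 * N l) F"
    using lim a unfolding vlim_def
    by (intro tendsto_intros) (auto intro: tendsto_norm_zero LIM_zero)
  then show "((\<lambda>w. cmod (a w) * N (f w - l) + cmod (a w - \<alpha>) * N l) \<longlongrightarrow> 0) F"
    by simp
qed (use l mem_scale in auto)

lemma vlim_imp_norm:
  assumes "vlim f l F" "\<forall>\<^sub>F w in F. f w \<in> V" "l \<in> V"
  shows "((\<lambda>w. N (f w)) \<longlongrightarrow> N l) F"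
proof -
  have "((\<lambda>w. N (f w) - N l) \<longlongrightarrow> 0) F"
  proof (rule tendsto_0_le[OF assms(1)[unfolded vlim_def], of _ 1])
    show "\<forall>\<^sub>F w in F. norm (N (f w) - N l) \<le> norm (N (f w - l)) * 1"
      using assms(2)
    proof eventually_elim
      case (elim w)
      show ?case
        using N_triangle[of "f w - l" l] N_triangle[of "l - f w" "f w"] elim assms(3)
          N_commute[of "f w" l] by (auto simp: mem_diff)
    qed
  qed
  then show ?thesis by (simp add: LIM_zero_iff)
qed

subsection \<open>Hahn--Banach\<close>

text \<open>The value 0 off \<open>V\<close> makes two functionals that agree on \<open>V\<close>
  equal as functions, which lets minimality be expressed by an equation. Homogeneity is asked for as
  an inequality; applying it with the scalar 1/r gives the converse.\<close>

definition sublin :: "('v \<Rightarrow> real) \<Rightarrow> bool" where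
  "sublin p \<longleftrightarrow> (\<forall>x\<in>V. \<forall>y\<in>V. p (x + y) \<le> p x + p y) \<and>
     (\<forall>r>0. \<forall>x\<in>V. p (s (complex_of_real r) x) \<le> r * p x) \<and> (\<forall>x. x \<notin> V \<longrightarrow> p x = 0)"

lemma sublin_add: "sublin p \<Longrightarrow> x \<in> V \<Longrightarrow> y \<in> V \<Longrightarrow> p (x + y) \<le> p x + p y"
  by (simp add: sublin_def)

lemma sublin_scale:
  assumes "sublin p" "r > 0" "x \<in> V"
  shows "p (s (complex_of_real r) x) = r * p x"
proof (rule antisym)
  show "p (s (complex_of_real r) x) \<le> r * p x"
    using assms by (simp add: sublin_def)
  have "p (s (complex_of_real (1/r)) (s (complex_of_real r) x)) \<le> 1/r * p (s (complex_of_real r) x)"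
    using assms mem_scale unfolding sublin_def by (meson divide_pos_pos zero_less_one)
  moreover have "s (complex_of_real (1/r)) (s (complex_of_real r) x) = x"
    using assms(2) by (simp flip: of_real_mult)
  ultimately show "r * p x \<le> p (s (complex_of_real r) x)"
    using assms(2) by (simp add: field_simps)
qed

lemma sublin_zero: "sublin p \<Longrightarrow> p 0 = 0"
  using sublin_scale[of p 2 0] mem_zero by simp

lemma sublin_lower: "sublin p \<Longrightarrow> x \<in> V \<Longrightarrow> - p (- x) \<le> p x"
  using sublin_add[of p x "- x"] mem_neg[of x] sublin_zero[of p] by simp

text \<open>Applied to a sublinear functional that is minimal below \<open>q\<close>, the shift shows that it is odd, hence linear.\<close>

lemma sublin_shift:
  assumes q: "sublin q" and v: "v \<in> V"
  obtains p where "sublin p" "\<And>x. p x \<le> q x" "p (- v) \<le> - q v"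
proof -
  \<comment> \<open>The parameter l = 0 yields p <= q, and l = 1 at - v yields q 0 - q v = - q v.
    Subadditivity bounds each set below by - q (- x), so the infimum is finite.\<close>
  define S where "S x = (\<lambda>l::real. q (x + s (complex_of_real l) v) - l * q v) ` {0..}" for x
  define p where "p x = (if x \<in> V then Inf (S x) else 0)" for x
  have mem: "x + s (complex_of_real l) v \<in> V" if "x \<in> V" for x l
    using that v mem_add mem_scale by auto
  have lower: "- q (- x) \<le> z" if "x \<in> V" "z \<in> S x" for x z
  proof -
    from that obtain l where l: "l \<ge> 0" "z = q (x + s (complex_of_real l) v) - l * q v"
      by (auto simp: S_def)
    have "l * q v = q (s (complex_of_real l) v)"
      using sublin_scale[OF q, of l v] v l sublin_zero[OF q] by (cases "l = 0") auto
    also have "\<dots> = q (x + s (complex_of_real l) v + - x)" by simp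
    also have "\<dots> \<le> q (x + s (complex_of_real l) v) + q (- x)"
      by (rule sublin_add[OF q]) (use that v mem mem_neg in auto)
    finally show ?thesis using l by simp
  qed
  have bdd: "bdd_below (S x)" if "x \<in> V" for x
    using lower[OF that] by (auto simp: bdd_below_def)
  have ne: "S x \<noteq> {}" for x by (auto simp: S_def)
  have le: "p x \<le> q (x + s (complex_of_real l) v) - l * q v" if "x \<in> V" "l \<ge> 0" for x l
    using that bdd[OF that(1)] by (auto simp: p_def S_def intro!: cInf_lower)
  show ?thesis
  proof
    show "sublin p"
      unfolding sublin_def
    proof (intro conjI ballI allI impI)
      fix x y assume xy: "x \<in> V" "y \<in> V"
      have *: "p (x + y) \<le> z + w" if "z \<in> S x" "w \<in> S y" for z w
      proof -
        from that obtain l m where l: "l \<ge> 0" "z = q (x + s (complex_of_real l) v) - l * q v"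
          and m: "m \<ge> 0" "w = q (y + s (complex_of_real m) v) - m * q v"
          by (auto simp: S_def)
        have "p (x + y) \<le> q (x + y + s (complex_of_real (l + m)) v) - (l + m) * q v"
          using xy l m mem_add by (intro le) auto
        also have "x + y + s (complex_of_real (l + m)) v
            = (x + s (complex_of_real l) v) + (y + s (complex_of_real m) v)"
          by (simp add: scale_left_distrib)
        also have "q \<dots> \<le> q (x + s (complex_of_real l) v) + q (y + s (complex_of_real m) v)"
          by (rule sublin_add[OF q]) (use xy mem in auto)
        finally show ?thesis using l m by (simp add: algebra_simps)
      qed
      have "p (x + y) - w \<le> Inf (S x)" if "w \<in> S y" for w
        using *[OF _ that] by (intro cInf_greatest ne) (simp add: le_diff_eq diff_le_eq)
      then have "p (x + y) - Inf (S x) \<le> Inf (S y)"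
        by (intro cInf_greatest ne) (simp add: algebra_simps)
      then show "p (x + y) \<le> p x + p y"
        using xy by (simp add: p_def)
    next
      fix r :: real and x assume r: "0 < r" and x: "x \<in> V"
      have "p (s (complex_of_real r) x) / r \<le> z" if "z \<in> S x" for z
      proof -
        from that obtain l where l: "l \<ge> 0" "z = q (x + s (complex_of_real l) v) - l * q v"
          by (auto simp: S_def)
        have "p (s (complex_of_real r) x)
            \<le> q (s (complex_of_real r) x + s (complex_of_real (r * l)) v) - (r * l) * q v"
          using x l r mem_scale by (intro le) auto
        also have "s (complex_of_real r) x + s (complex_of_real (r * l)) v
            = s (complex_of_real r) (x + s (complex_of_real l) v)"
          by (simp add: scale_right_distrib)
        also have "q \<dots> = r * q (x + s (complex_of_real l) v)"
          by (rule sublin_scale[OF q r mem[OF x]])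
        finally have "p (s (complex_of_real r) x) \<le> r * z"
          unfolding l(2) by (simp add: algebra_simps)
        then show ?thesis using r by (simp add: field_simps)
      qed
      then have "p (s (complex_of_real r) x) / r \<le> Inf (S x)"
        by (intro cInf_greatest ne)
      then show "p (s (complex_of_real r) x) \<le> r * p x"
        using x r by (simp add: p_def field_simps)
    qed (simp add: p_def)
    show "p x \<le> q x" for x
      using le[of x 0] q by (cases "x \<in> V") (auto simp: p_def sublin_def)
    show "p (- v) \<le> - q v"
      using le[of "- v" 1] v mem_neg sublin_zero[OF q] by simp
  qed
qed

text \<open>Zorn's lemma for the reversed pointwise order. The infimum over a chain is finite
  because every member p below q satisfies p x >= - p (- x) >= - q (- x).\<close>

lemma minimal_sublin_exists:
  assumes q: "sublin q"
  obtains p where "sublin p" "\<And>x. p x \<le> q x" "\<And>p'. sublin p' \<Longrightarrow> (\<And>x. p' x \<le> p x) \<Longrightarrow> p' = p"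
proof -
  define A where "A = {p. sublin p \<and> p \<le> q}"
  have "\<exists>m\<in>A. \<forall>a\<in>A. a \<le> m \<longrightarrow> a = m"
  proof (rule predicate_Zorn)
    show "partial_order_on A (relation_of (\<lambda>p p'. p' \<le> p) A)"
      by (auto simp: partial_order_on_def preorder_on_def refl_on_def trans_def antisym_def
          relation_of_def)
  next
    fix C assume "C \<in> Chains (relation_of (\<lambda>p p'. p' \<le> p) A)"
    then have CA: "C \<subseteq> A" and ch: "\<And>p p'. p \<in> C \<Longrightarrow> p' \<in> C \<Longrightarrow> p \<le> p' \<or> p' \<le> p"
      by (auto simp: Chains_def relation_of_def)
    show "\<exists>u\<in>A. \<forall>a\<in>C. u \<le> a"
    proof (cases "C = {}")
      case True
      then show ?thesis using q by (auto simp: A_def)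
    next
      case False
      have sub: "sublin p" "\<And>x. p x \<le> q x" if "p \<in> C" for p
        using CA that by (auto simp: A_def le_fun_def)
      define u where "u x = (if x \<in> V then (INF p\<in>C. p x) else 0)" for x
      have bdd: "bdd_below ((\<lambda>p. p x) ` C)" if "x \<in> V" for x
      proof (rule bdd_belowI[of _ "- q (- x)"])
        fix z assume "z \<in> (\<lambda>p. p x) ` C"
        then obtain p where p: "p \<in> C" "z = p x" by auto
        show "- q (- x) \<le> z"
          using sublin_lower[OF sub(1)[OF p(1)] that] sub(2)[OF p(1), of "- x"] p(2) by simp
      qed
      have le: "u x \<le> p x" if "p \<in> C" for p x
        using bdd[of x] that sub(1)[OF that] cINF_lower by (auto simp: u_def sublin_def)
      have "sublin u"
        unfolding sublin_def
      proof (intro conjI ballI allI impI)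
        fix x y assume xy: "x \<in> V" "y \<in> V"
        \<comment> \<open>Of two members of a chain one lies below the other, and subadditivity of
          the smaller bounds the mixed sum; after that the two infima can be taken
          independently.\<close>
        have *: "u (x + y) \<le> p x + p' y" if pC: "p \<in> C" "p' \<in> C" for p p'
        proof -
          obtain m where m: "m \<in> C" "m \<le> p" "m \<le> p'"
            using ch[OF pC] pC by blast
          have "u (x + y) \<le> m (x + y)" by (rule le[OF m(1)])
          also have "\<dots> \<le> m x + m y" using sublin_add[OF sub(1)[OF m(1)]] xy by blast
          also have "\<dots> \<le> p x + p' y" using m by (simp add: le_fun_def add_mono)
          finally show ?thesis .
        qed
        have "u (x + y) - u x \<le> p' y" if "p' \<in> C" for p'
        proof -
          have "u (x + y) - p' y \<le> (INF p\<in>C. p x)"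
            using *[OF _ that] by (intro cINF_greatest[OF False]) (simp add: diff_le_eq)
          then show ?thesis using xy by (simp add: u_def)
        qed
        then have "u (x + y) - u x \<le> (INF p'\<in>C. p' y)"
          by (rule cINF_greatest[OF False])
        then show "u (x + y) \<le> u x + u y" using xy by (simp add: u_def)
      next
        fix r :: real and x assume r: "0 < r" and x: "x \<in> V"
        have "u (s (complex_of_real r) x) / r \<le> p x" if "p \<in> C" for p
          using le[OF that, of "s (complex_of_real r) x"] sublin_scale[OF sub(1)[OF that] r x] r
          by (simp add: field_simps)
        then have "u (s (complex_of_real r) x) / r \<le> (INF p\<in>C. p x)"
          by (rule cINF_greatest[OF False])
        then show "u (s (complex_of_real r) x) \<le> r * u x"
          using x r by (simp add: u_def field_simps)
      qed (simp add: u_def)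
      moreover have "u \<le> q"
        using False le sub(2) by (meson all_not_in_conv le_funI order_trans)
      ultimately show ?thesis using le by (auto simp: A_def le_fun_def)
    qed
  qed
  then obtain m where m: "m \<in> A" "\<And>a. a \<in> A \<Longrightarrow> a \<le> m \<Longrightarrow> a = m" by blast
  have mq: "m x \<le> q x" for x using m(1) by (simp add: A_def le_fun_def)
  show ?thesis
  proof
    show "p' = m" if "sublin p'" "\<And>x. p' x \<le> m x" for p'
      using that by (intro m(2)) (auto simp: A_def le_fun_def intro: order_trans[OF _ mq])
  qed (use m(1) mq in \<open>auto simp: A_def\<close>)
qed

lemma real_functional_exists:
  assumes q: "sublin q"
  obtains p where "\<And>x y. x \<in> V \<Longrightarrow> y \<in> V \<Longrightarrow> p (x + y) = p x + p y"
    "\<And>r x. x \<in> V \<Longrightarrow> p (s (complex_of_real r) x) = r * p x"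
    "\<And>x. p x \<le> q x"
proof -
  obtain p where p: "sublin p" "\<And>x. p x \<le> q x"
    and min: "\<And>p'. sublin p' \<Longrightarrow> (\<And>x. p' x \<le> p x) \<Longrightarrow> p' = p"
    using minimal_sublin_exists[OF q] by metis
  have odd: "p (- v) = - p v" if v: "v \<in> V" for v
  proof -
    obtain p' where "sublin p'" "\<And>x. p' x \<le> p x" "p' (- v) \<le> - p v"
      using sublin_shift[OF p(1) v] by metis
    then have "p (- v) \<le> - p v" using min by metis
    then show ?thesis using sublin_lower[OF p(1) v] by simp
  qed
  show ?thesis
  proof
    show "p (x + y) = p x + p y" if "x \<in> V" "y \<in> V" for x y
      using sublin_add[OF p(1) that] sublin_add[OF p(1), of "x + y" "- y"] that
        mem_add mem_neg odd[of y] by force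
    show "p (s (complex_of_real r) x) = r * p x" if x: "x \<in> V" for r x
    proof (cases r "0::real" rule: linorder_cases)
      case less
      then have "p (s (complex_of_real (- r)) x) = - r * p x"
        using sublin_scale[OF p(1) _ x, of "- r"] by auto
      moreover have "s (complex_of_real (- r)) x = - s (complex_of_real r) x"
        by simp
      ultimately show ?thesis using odd[OF mem_scale[OF x], of "complex_of_real r"] by simp
    qed (use sublin_scale[OF p(1) _ x, of r] sublin_zero[OF p(1)] in auto)
  qed (rule p(2))
qed

text \<open>These functionals form the unit ball of the dual, so that norms are estimated through
  them without further constants.\<close>

definition cfunctional :: "('v \<Rightarrow> complex) \<Rightarrow> bool" where
  "cfunctional l \<longleftrightarrow> (\<forall>x\<in>V. \<forall>y\<in>V. l (x + y) = l x + l y) \<and>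
     (\<forall>c. \<forall>x\<in>V. l (s c x) = c * l x) \<and> (\<forall>x\<in>V. cmod (l x) \<le> N x)"

lemma cfunctionalD:
  assumes "cfunctional l"
  shows cf_add: "x \<in> V \<Longrightarrow> y \<in> V \<Longrightarrow> l (x + y) = l x + l y"
    and cf_scale: "x \<in> V \<Longrightarrow> l (s c x) = c * l x"
    and cf_bound: "x \<in> V \<Longrightarrow> cmod (l x) \<le> N x"
    and cf_diff: "x \<in> V \<Longrightarrow> y \<in> V \<Longrightarrow> l (x - y) = l x - l y"
proof -
  show 1: "x \<in> V \<Longrightarrow> y \<in> V \<Longrightarrow> l (x + y) = l x + l y" for x y
    using assms by (simp add: cfunctional_def)
  show "x \<in> V \<Longrightarrow> l (s c x) = c * l x" "x \<in> V \<Longrightarrow> cmod (l x) \<le> N x"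
    using assms by (simp_all add: cfunctional_def)
  show "l (x - y) = l x - l y" if "x \<in> V" "y \<in> V"
    using 1[of "x - y" y] that mem_diff by simp
qed

lemma cf_sum:
  assumes "cfunctional l" "\<And>i. i \<in> I \<Longrightarrow> f i \<in> V"
  shows "l (sum f I) = (\<Sum>i\<in>I. l (f i))"
proof -
  have "l 0 = 0" using cf_scale[OF assms(1) mem_zero, of 0] by simp
  then show ?thesis
    using assms(2)
    by (induction I rule: infinite_finite_induct) (auto simp: cf_add[OF assms(1)] mem_sum)
qed

text \<open>The real functional is found below the norm shifted in direction v: any linear p below
  \<open>q'\<close> satisfies p (- v) <= - N v, that is p v >= N v, so no extension from the line
  through v is involved. It is then complexified as l x = p x - i p (i x).\<close>

theorem Hahn_Banach_norming:
  assumes v: "v \<in> V"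
  obtains l where "cfunctional l" "N v \<le> cmod (l v)"
proof -
  define q where "q x = (if x \<in> V then N x else 0)" for x
  have "sublin q"
    using mem_add mem_scale N_triangle by (auto simp: sublin_def q_def N_scale)
  from sublin_shift[OF this v] obtain q' where
    q': "sublin q'" "\<And>x. q' x \<le> q x" "q' (- v) \<le> - q v" by metis
  from real_functional_exists[OF q'(1)] obtain p where
    padd: "\<And>x y. x \<in> V \<Longrightarrow> y \<in> V \<Longrightarrow> p (x + y) = p x + p y"
    and psc: "\<And>r x. x \<in> V \<Longrightarrow> p (s (complex_of_real r) x) = r * p x"
    and ple: "\<And>x. p x \<le> q' x" by metis
  have pN: "p x \<le> N x" if "x \<in> V" for x
    using ple[of x] q'(2)[of x] that by (simp add: q_def)
  have pv: "N v \<le> p v"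
    using ple[of "- v"] q'(3) psc[OF v, of "-1"] v by (simp add: q_def)
  define l where "l x = Complex (p x) (- p (s \<i> x))" for x
  have ladd: "l (x + y) = l x + l y" if "x \<in> V" "y \<in> V" for x y
    using that by (simp add: l_def complex_eq_iff padd scale_right_distrib mem_scale)
  have lsc: "l (s c x) = c * l x" if x: "x \<in> V" for c x
  proof -
    have 1: "s c x = s (complex_of_real (Re c)) x + s (complex_of_real (Im c)) (s \<i> x)"
      by (simp flip: scale_left_distrib add: complex_eq_iff) 
    have "\<i> * c = complex_of_real (Re c) * \<i> + complex_of_real (- Im c)"
      by (simp add: complex_eq_iff)
    then have 2: "s \<i> (s c x) = s (complex_of_real (Re c)) (s \<i> x) + s (complex_of_real (- Im c)) x"
      by (metis scale_left_distrib scale_scale)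
    show ?thesis
      unfolding l_def 2 by (subst 1) (simp add: complex_eq_iff padd psc x mem_scale del: of_real_minus scale_scale)
  qed
  have lN: "cmod (l x) \<le> N x" if x: "x \<in> V" for x
  proof (cases "l x = 0")
    case False
    \<comment> \<open>Rotating x by c makes the value of l real and nonnegative, where it coincides
      with p and the real bound applies.\<close>
    define c where "c = cnj (l x) / of_real (cmod (l x))"
    have c1: "cmod c = 1" using False by (simp add: c_def norm_divide)
    have "l (s c x) = complex_of_real (cmod (l x))"
      using False complex_norm_square[of "l x"]
      by (simp add: lsc x c_def power2_eq_square field_simps)
    then have "cmod (l x) = p (s c x)"
      by (simp add: l_def complex_eq_iff)
    also have "\<dots> \<le> N x" using pN[OF mem_scale[OF x]] c1 by (metis N_scale mult_1 x)
    finally show ?thesis .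
  qed (use N_nonneg x in auto)
  show ?thesis
  proof
    show "cfunctional l" using ladd lsc lN by (auto simp: cfunctional_def)
    show "N v \<le> cmod (l v)" using pv complex_Re_le_cmod[of "l v"] by (simp add: l_def)
  qed
qed

text \<open>The gateway from scalar function theory to vector-valued functions: a bound for l (f z)
  that is uniform over the dual unit ball bounds the norm of f z.\<close>

lemma norm_le_of_functionals:
  assumes "v \<in> V" "\<And>l. cfunctional l \<Longrightarrow> cmod (l v) \<le> M"
  shows "N v \<le> M"
  using Hahn_Banach_norming[OF assms(1)] assms(2) order_trans by metis

lemma cf_tendsto:
  assumes "cfunctional l" "vlim f v F" "\<forall>\<^sub>F w in F. f w \<in> V" "v \<in> V"
  shows "((\<lambda>w. l (f w)) \<longlongrightarrow> l v) F"
proof -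
  have "((\<lambda>w. l (f w) - l v) \<longlongrightarrow> 0) F"
  proof (rule tendsto_0_le[OF assms(2)[unfolded vlim_def], of _ 1])
    show "\<forall>\<^sub>F w in F. norm (l (f w) - l v) \<le> norm (N (f w - v)) * 1"
      using assms(3)
    proof eventually_elim
      case (elim w)
      then show ?case
        using cf_bound[OF assms(1), of "f w - v"] cf_diff[OF assms(1), of "f w" v] assms(4)
          mem_diff by force
    qed
  qed
  then show ?thesis by (simp add: LIM_zero_iff)
qed

end

section \<open>Two facts on scalar holomorphic functions\<close>

text \<open>The factor exp (e (z^2 - 1)) has modulus at most exp (- e (Im z)^2) on the strip, so on
  a sufficiently tall rectangle the maximum principle sees only the vertical edges; then e tends to
  0. The bound B merely determines the height of the rectangle.\<close>

lemma three_lines: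
  fixes f :: "complex \<Rightarrow> complex"
  assumes cont: "continuous_on strip f" and hol: "f holomorphic_on {z. 0 < Re z \<and> Re z < 1}"
    and bdd: "\<And>z. z \<in> strip \<Longrightarrow> cmod (f z) \<le> B"
    and M0: "\<And>t. cmod (f (Complex 0 t)) \<le> M" and M1: "\<And>t. cmod (f (Complex 1 t)) \<le> M"
    and z: "z \<in> strip"
  shows "cmod (f z) \<le> M"
proof -
  have M: "0 \<le> M" using M0[of 0] norm_ge_zero order_trans by blast
  have B: "0 \<le> B" using bdd[OF z] norm_ge_zero order_trans by blast
  \<comment> \<open>Since M may be 0, the slack e on the right gives the decaying bound on the
    horizontal edges something positive to fall below.\<close>
  have main: "cmod (f z) * exp (e * ((Re z)\<^sup>2 - (Im z)\<^sup>2 - 1)) \<le> M + e" if e: "e > 0" for e :: real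
  proof -
    define g where "g w = f w * exp (complex_of_real e * (w\<^sup>2 - 1))" for w
    have nexp: "cmod (exp (complex_of_real e * (w\<^sup>2 - 1))) = exp (e * ((Re w)\<^sup>2 - (Im w)\<^sup>2 - 1))" for w
      by (simp add: norm_exp_eq_Re power2_eq_square)
    have "filterlim (\<lambda>R::real. R\<^sup>2) at_top at_top"
      by (rule filterlim_pow_at_top) (auto simp: filterlim_ident)
    from filterlim_tendsto_pos_mult_at_top[OF tendsto_const e this]
    have "filterlim (\<lambda>R::real. - (e * R\<^sup>2)) at_bot at_top"
      by (simp add: filterlim_uminus_at_bot)
    from filterlim_compose[OF exp_at_bot this]
    have "((\<lambda>R::real. B * exp (- (e * R\<^sup>2))) \<longlongrightarrow> B * 0) at_top"
      by (rule tendsto_mult_left)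
    then have "\<forall>\<^sub>F R::real in at_top. B * exp (- (e * R\<^sup>2)) < M + e"
      using M e by (intro order_tendstoD(2)) auto
    then have "\<forall>\<^sub>F R::real in at_top. B * exp (- (e * R\<^sup>2)) < M + e \<and> R > \<bar>Im z\<bar>"
      using eventually_gt_at_top by (rule eventually_conj)
    then obtain R where R: "B * exp (- (e * R\<^sup>2)) < M + e" "R > \<bar>Im z\<bar>"
      by (metis (mono_tags, lifting) eventually_happens trivial_limit_at_top_linorder)
    define S where "S = cbox (Complex 0 (- R)) (Complex 1 R)"
    have Ss: "S \<subseteq> strip" by (auto simp: S_def strip_def in_cbox_complex_iff)
    have g_le: "cmod (g w) \<le> cmod (f w) * exp (- (e * (Im w)\<^sup>2))" if "w \<in> strip" for w
    proof -
      have "(Re w)\<^sup>2 \<le> 1" using that by (auto simp: strip_def power_le_one)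
      then have "e * ((Re w)\<^sup>2 - (Im w)\<^sup>2 - 1) \<le> - (e * (Im w)\<^sup>2)"
        using mult_left_mono[of "(Re w)\<^sup>2" 1 e] e by (simp add: algebra_simps)
      then show ?thesis
        unfolding g_def norm_mult nexp by (intro mult_left_mono) auto
    qed
    have "cmod (g z) \<le> M + e"
    proof (rule maximum_modulus_frontier[where f = g and S = S])
      have "interior S \<subseteq> {z. 0 < Re z \<and> Re z < 1}"
        by (auto simp: S_def interior_cbox in_box_complex_iff)
      then show "g holomorphic_on interior S"
        unfolding g_def by (intro holomorphic_intros holomorphic_on_subset[OF hol])
      show "continuous_on (closure S) g"
        unfolding g_def using Ss
        by (intro continuous_intros continuous_on_subset[OF cont]) (auto simp: S_def)
      show "bounded S" by (simp add: S_def)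
      show "z \<in> S" using z R by (auto simp: S_def strip_def in_cbox_complex_iff)
      fix w assume "w \<in> frontier S"
      then have w: "w \<in> S" "w \<notin> box (Complex 0 (- R)) (Complex 1 R)"
        by (auto simp: S_def frontier_cbox)
      then have ws: "w \<in> strip" using Ss by auto
      from w have "Re w = 0 \<or> Re w = 1 \<or> \<bar>Im w\<bar> = R"
        by (auto simp: S_def in_cbox_complex_iff in_box_complex_iff)
      then consider "Re w = 0 \<or> Re w = 1" | "\<bar>Im w\<bar> = R" by blast
      then show "cmod (g w) \<le> M + e"
      proof cases
        case 1
        then have "w = Complex 0 (Im w) \<or> w = Complex 1 (Im w)" by (auto simp: complex_eq_iff)
        then have "cmod (f w) \<le> M" using M0 M1 by metis
        moreover have "cmod (g w) \<le> cmod (f w) * 1"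
          using g_le[OF ws] e by (elim order_trans, intro mult_left_mono) auto
        ultimately show ?thesis using e by simp
      next
        case 2
        have "cmod (g w) \<le> cmod (f w) * exp (- (e * R\<^sup>2))"
          using g_le[OF ws] 2 by (metis power2_abs)
        also have "\<dots> \<le> B * exp (- (e * R\<^sup>2))"
          using bdd[OF ws] by (intro mult_right_mono) auto
        finally show ?thesis using R by simp
      qed
    qed
    then show ?thesis unfolding g_def norm_mult nexp .
  qed
  have "((\<lambda>e. cmod (f z) * exp (e * ((Re z)\<^sup>2 - (Im z)\<^sup>2 - 1))) \<longlongrightarrow> cmod (f z) * exp (0 * ((Re z)\<^sup>2 - (Im z)\<^sup>2 - 1))) (at_right 0)"
    by (intro tendsto_intros)
  then have 1: "((\<lambda>e. cmod (f z) * exp (e * ((Re z)\<^sup>2 - (Im z)\<^sup>2 - 1))) \<longlongrightarrow> cmod (f z)) (at_right 0)"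
    by simp
  have "((\<lambda>e. M + e) \<longlongrightarrow> M + 0) (at_right 0)"
    by (intro tendsto_intros)
  then have 2: "((\<lambda>e. M + e) \<longlongrightarrow> M) (at_right 0)" by simp
  show ?thesis
    by (rule tendsto_le[OF _ 2 1])
      (auto intro: eventually_mono[OF eventually_at_right_less[of 0]] simp: main)
qed

text \<open>With its singularity removed the difference quotient Q is holomorphic. On the circle of
  radius r/2 it is at most 2B / (r/2) = 4B/r, the Cauchy estimate on discs of radius r/4 bounds its
  derivative by 16 B / r^2, and the mean value inequality concludes. The constant depends on f
  through B alone, so it is uniform over contractive functionals.\<close>

lemma difference_quotient_lipschitz:
  fixes f :: "complex \<Rightarrow> complex"
  assumes hol: "f holomorphic_on ball c r" and r: "0 < r"
    and B: "\<And>z. z \<in> ball c r \<Longrightarrow> cmod (f z) \<le> B"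
    and h: "h \<noteq> 0" "cmod h < r / 4" and k: "k \<noteq> 0" "cmod k < r / 4"
  shows "cmod ((f (c + h) - f c) / h - (f (c + k) - f c) / k) \<le> 16 * B / r\<^sup>2 * cmod (h - k)"
proof -
  define Q where "Q z = (if z = c then deriv f c else (f z - f c) / (z - c))" for z
  have holQ: "Q holomorphic_on ball c r"
    unfolding Q_def using pole_lemma[OF hol, of c] r by simp
  have QB: "cmod (Q z) \<le> 4 * B / r" if "z \<in> cball c (r / 2)" for z
  proof (rule maximum_modulus_frontier[where f = Q and S = "cball c (r / 2)"])
    show "Q holomorphic_on interior (cball c (r / 2))"
      using r by (intro holomorphic_on_subset[OF holQ]) auto
    show "continuous_on (closure (cball c (r / 2))) Q"
      using r by (intro continuous_on_subset[OF holomorphic_on_imp_continuous_on[OF holQ]]) auto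
    fix w assume "w \<in> frontier (cball c (r / 2))"
    then have w: "dist c w = r / 2" using r by (auto simp: frontier_cball)
    then have "w \<noteq> c" "cmod (w - c) = r / 2" using r by (auto simp: dist_norm norm_minus_commute)
    moreover have "cmod (f w - f c) \<le> B + B"
      using B[of w] B[of c] w r norm_triangle_ineq4[of "f w" "f c"] by auto
    ultimately have "cmod (Q w) \<le> (B + B) / (r / 2)"
      unfolding Q_def using r by (auto simp: norm_divide intro!: divide_right_mono)
    then show "cmod (Q w) \<le> 4 * B / r" by simp
  qed (use that in auto)
  have dQ: "cmod (deriv Q z) \<le> 16 * B / r\<^sup>2" if z: "z \<in> ball c (r / 4)" for z
  proof -
    have sub: "cball z (r / 4) \<subseteq> cball c (r / 2)"
    proof
      fix w assume "w \<in> cball z (r / 4)"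
      then show "w \<in> cball c (r / 2)"
        using z dist_triangle[of c w z] by auto
    qed
    have sub': "cball c (r / 2) \<subseteq> ball c r" using r by auto
    have "cmod ((deriv ^^ 1) Q z) \<le> fact 1 * (4 * B / r) / (r / 4) ^ 1"
    proof (rule Cauchy_inequality)
      show "Q holomorphic_on ball z (r / 4)"
        using sub sub' ball_subset_cball by (blast intro: holomorphic_on_subset[OF holQ])
      show "continuous_on (cball z (r / 4)) Q"
        using sub sub' by (intro continuous_on_subset[OF holomorphic_on_imp_continuous_on[OF holQ]]) auto
      show "cmod (Q x) \<le> 4 * B / r" if "cmod (z - x) = r / 4" for x
        using that sub by (intro QB) (auto simp: dist_norm)
    qed (use r in auto)
    then show ?thesis using r by (simp add: power2_eq_square)
  qed
  have "cmod (Q (c + h) - Q (c + k)) \<le> 16 * B / r\<^sup>2 * cmod (c + h - (c + k))"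
  proof (rule field_differentiable_bound[of "ball c (r / 4)" Q "deriv Q"])
    fix z assume z: "z \<in> ball c (r / 4)"
    have "z \<in> ball c r" using z r by auto
    then have "Q field_differentiable at z"
      using holomorphic_on_imp_differentiable_at[OF holQ] by auto
    then show "(Q has_field_derivative deriv Q z) (at z within ball c (r / 4))"
      by (simp add: field_differentiable_derivI has_field_derivative_at_within)
  qed (use dQ h k in \<open>auto simp: dist_norm\<close>)
  then show ?thesis using h k by (simp add: Q_def)
qed

section \<open>Absolutely convergent series in a complete carrier\<close>

context cnspace
begin

lemma summable_converges:
  assumes compl: "complete_wrt V N" and a: "\<And>n::nat. a n \<in> V" and sm: "summable (\<lambda>n. N (a n))"
  obtains l where "l \<in> V" "vlim (\<lambda>n. \<Sum>i<n. a i) l sequentially"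
proof -
  have *: "N ((\<Sum>i<m. a i) - (\<Sum>i<n. a i)) \<le> (\<Sum>i=n..<m. N (a i))" if "n \<le> m" for m n
  proof -
    have "(\<Sum>i<m. a i) - (\<Sum>i<n. a i) = (\<Sum>i=n..<m. a i)"
      using sum_diff_nat_ivl[of 0 n m a] that by (simp add: atLeast0LessThan)
    then show ?thesis using N_sum[of "{n..<m}" a] a by simp
  qed
  have mem: "(\<Sum>i<n. a i) \<in> V" for n
    by (rule mem_sum) (rule a)
  have cau: "\<exists>M. \<forall>m\<ge>M. \<forall>n\<ge>M. N ((\<Sum>i<m. a i) - (\<Sum>i<n. a i)) < e" if e: "e > 0" for e
  proof -
    obtain M where M: "\<And>m n. m \<ge> M \<Longrightarrow> norm (\<Sum>i=m..<n. N (a i)) < e"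
      using sm[unfolded summable_Cauchy, rule_format, OF e] by blast
    have "N ((\<Sum>i<m. a i) - (\<Sum>i<n. a i)) < e" if "m \<ge> M" "n \<ge> M" for m n
    proof (cases "n \<le> m")
      case True
      then show ?thesis using *[OF True] M[OF that(2), of m] by (simp add: abs_less_iff)
    next
      case False
      then show ?thesis
        using *[of m n] M[OF that(1), of n] N_commute[OF mem mem, of m n] by (simp add: abs_less_iff)
    qed
    then show ?thesis by blast
  qed
  have "(\<forall>n. (\<Sum>i<n. a i) \<in> V) \<and>
      (\<forall>e>0. \<exists>M. \<forall>m\<ge>M. \<forall>n\<ge>M. N ((\<Sum>i<m. a i) - (\<Sum>i<n. a i)) < e)"
    by (intro conjI allI impI cau mem)
  from compl[unfolded complete_wrt_def, THEN spec, THEN mp, OF this]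
  obtain l where l: "l \<in> V" "\<forall>e>0. \<exists>M. \<forall>n\<ge>M. N ((\<Sum>i<n. a i) - l) < e"
    by (elim bexE)
  have "0 \<le> N ((\<Sum>i<n. a i) - l)" for n
    by (intro N_nonneg mem_diff mem l)
  with l(2) have "vlim (\<lambda>n. \<Sum>i<n. a i) l sequentially"
    unfolding vlim_def LIMSEQ_def by (simp add: dist_norm)
  then show ?thesis using that l by blast
qed

end

section \<open>The K-functional\<close>

locale bcpl = vector_space "sc X" for X :: "'v::ab_group_add bcouple" +
  assumes bc: "banach_couple X"
begin

abbreviation "K \<equiv> Kfun X"

sublocale Z0: cnspace "sc X" "sp0 X" "nm0 X"
  by unfold_locales (use bc in \<open>simp add: banach_couple_def\<close>)

sublocale Z1: cnspace "sc X" "sp1 X" "nm1 X"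
  by unfold_locales (use bc in \<open>simp add: banach_couple_def\<close>)

lemma sumspI: "a \<in> sp0 X \<Longrightarrow> b \<in> sp1 X \<Longrightarrow> a + b \<in> sumsp X"
  by (auto simp: sumsp_def)

lemma sumsp0: "a \<in> sp0 X \<Longrightarrow> a \<in> sumsp X"
  using sumspI[of a 0] Z1.mem_zero by simp

lemma sumsp1: "a \<in> sp1 X \<Longrightarrow> a \<in> sumsp X"
  using sumspI[of 0 a] Z0.mem_zero by simp

lemma K_le:
  assumes "a \<in> sp0 X" "b \<in> sp1 X" "0 \<le> t"
  shows "K t (a + b) \<le> nm0 X a + t * nm1 X b"
  unfolding Kfun_def
proof (rule cInf_lower)
  show "bdd_below {nm0 X a' + t * nm1 X b' |a' b'. a' \<in> sp0 X \<and> b' \<in> sp1 X \<and> a + b = a' + b'}"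
    using assms(3) Z0.N_nonneg Z1.N_nonneg by (intro bdd_belowI[of _ 0]) auto
qed (use assms in blast)

lemma K_le0: "a \<in> sp0 X \<Longrightarrow> 0 \<le> t \<Longrightarrow> K t a \<le> nm0 X a"
  using K_le[of a 0 t] Z1.mem_zero by simp

lemma K_le1: "b \<in> sp1 X \<Longrightarrow> 0 \<le> t \<Longrightarrow> K t b \<le> t * nm1 X b"
  using K_le[of 0 b t] Z0.mem_zero by simp

lemma K_decomp:
  assumes "x \<in> sumsp X" "K t x < M"
  obtains a b where "a \<in> sp0 X" "b \<in> sp1 X" "x = a + b" "nm0 X a + t * nm1 X b < M"
proof -
  have "{nm0 X a + t * nm1 X b | a b. a \<in> sp0 X \<and> b \<in> sp1 X \<and> x = a + b} \<noteq> {}"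
    using assms(1) by (auto simp: sumsp_def)
  from cInf_lessD[OF this assms(2)[unfolded Kfun_def]] show ?thesis using that by blast
qed

lemma K_nonneg:
  assumes "x \<in> sumsp X" "0 \<le> t"
  shows "0 \<le> K t x"
proof (rule ccontr)
  assume "\<not> 0 \<le> K t x"
  then obtain a b where "a \<in> sp0 X" "b \<in> sp1 X" "nm0 X a + t * nm1 X b < 0"
    using K_decomp[OF assms(1), of t 0] by (metis not_le)
  then show False
    using Z0.N_nonneg[of a] Z1.N_nonneg[of b] assms(2) by (smt (verit) mult_nonneg_nonneg)
qed

text \<open>In a nearly optimal decomposition for s, writing t = (t / s) s costs at most the factor
  max 1 (t / s) on either term. Hence all K(t, .) are equivalent norms, and the topology given by
  K(1, .) serves for every t.\<close>

lemma K_dilate: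
  assumes x: "x \<in> sumsp X" and st: "0 < s" "0 < t"
  shows "K t x \<le> max 1 (t / s) * K s x"
proof -
  have "K t x \<le> max 1 (t / s) * K s x + e" if e: "e > 0" for e
  proof -
    have m: "max 1 (t / s) \<ge> 1" by simp
    have "K s x < K s x + e / max 1 (t / s)" using e m by simp
    from K_decomp[OF x this] obtain a b where
      ab: "a \<in> sp0 X" "b \<in> sp1 X" "x = a + b" "nm0 X a + s * nm1 X b < K s x + e / max 1 (t / s)"
      by metis
    have "K t x \<le> nm0 X a + t * nm1 X b" using K_le ab st by simp
    also have "\<dots> \<le> max 1 (t / s) * nm0 X a + max 1 (t / s) * (s * nm1 X b)"
    proof (intro add_mono)
      show "nm0 X a \<le> max 1 (t / s) * nm0 X a"
        using mult_right_mono[OF m Z0.N_nonneg[OF ab(1)]] by simp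
      have "t / s * (s * nm1 X b) \<le> max 1 (t / s) * (s * nm1 X b)"
        using st Z1.N_nonneg[OF ab(2)] by (intro mult_right_mono) auto
      then show "t * nm1 X b \<le> max 1 (t / s) * (s * nm1 X b)" using st by simp
    qed
    also have "\<dots> \<le> max 1 (t / s) * (K s x + e / max 1 (t / s))"
      unfolding distrib_left[symmetric] using ab(4) m by (intro mult_left_mono) auto
    also have "\<dots> = max 1 (t / s) * K s x + e" using m by (simp add: distrib_left)
    finally show ?thesis .
  qed
  then show ?thesis by (rule field_le_epsilon)
qed

lemma K_mono:
  assumes "x \<in> sumsp X" "0 < s" "s \<le> t"
  shows "K s x \<le> K t x"
  using K_dilate[OF assms(1), of t s] assms by (simp add: max_def split: if_splits)

lemma K_normed:
  assumes t: "0 < t"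
  shows "normed_subspace (sc X) (sumsp X) (K t)"
  unfolding normed_subspace_def
proof (intro conjI ballI allI)
  show "subspace (sumsp X)"
    unfolding sumsp_def using subspace_sums[OF Z0.subsp Z1.subsp] .
  then have scl: "sc X c x \<in> sumsp X" if "x \<in> sumsp X" for c x
    using that by (simp add: subspace_scale)
  fix x assume x: "x \<in> sumsp X"
  show "0 \<le> K t x" using K_nonneg x t by simp
  show "K t x = 0 \<longleftrightarrow> x = 0"
  proof
    assume "K t x = 0"
    \<comment> \<open>Definiteness is postulated at t = 1 and reaches the other t by
      dilation.\<close>
    then have "K 1 x \<le> 0" using K_dilate[OF x t, of 1] by simp
    then have "K 1 x = 0" using K_nonneg[OF x, of 1] by simp
    then show "x = 0" using bc x by (auto simp: banach_couple_def)
  next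
    assume "x = 0"
    then have "K t x \<le> 0" using K_le0[OF Z0.mem_zero, of t] t by simp
    then show "K t x = 0" using K_nonneg[OF x, of t] t by simp
  qed
  have sc_le: "K t (sc X c x) \<le> cmod c * K t x" if x: "x \<in> sumsp X" for c x
  proof (cases "c = 0")
    case True
    then show ?thesis using K_le0[OF Z0.mem_zero, of t] t by simp
  next
    case False
    show ?thesis
    proof (rule field_le_epsilon)
      fix e :: real assume e: "e > 0"
      have "K t x < K t x + e / cmod c" using e False by simp
      from K_decomp[OF x this] obtain a b where
        ab: "a \<in> sp0 X" "b \<in> sp1 X" "x = a + b" "nm0 X a + t * nm1 X b < K t x + e / cmod c"
        by metis
      have "K t (sc X c x) \<le> nm0 X (sc X c a) + t * nm1 X (sc X c b)"
        unfolding ab(3) scale_right_distrib using ab t by (intro K_le Z0.mem_scale Z1.mem_scale) auto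
      also have "\<dots> = cmod c * (nm0 X a + t * nm1 X b)"
        using ab by (simp add: Z0.N_scale Z1.N_scale algebra_simps)
      also have "\<dots> \<le> cmod c * (K t x + e / cmod c)"
        using ab(4) by (intro mult_left_mono) auto
      also have "\<dots> = cmod c * K t x + e" using False by (simp add: algebra_simps)
      finally show "K t (sc X c x) \<le> cmod c * K t x + e" .
    qed
  qed
  show "K t (sc X c x) = cmod c * K t x" for c
  proof (cases "c = 0")
    case True
    then show ?thesis
      using sc_le[OF x, of c] K_nonneg[OF scl[OF x], of t c] t by simp
  next
    case False
    have "K t (sc X (inverse c) (sc X c x)) \<le> cmod (inverse c) * K t (sc X c x)"
      by (rule sc_le[OF scl[OF x]])
    then have "K t x \<le> inverse (cmod c) * K t (sc X c x)"
      using False by (simp add: norm_inverse)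
    moreover have "cmod c * inverse (cmod c) = 1" using False by simp
    ultimately have "cmod c * K t x \<le> K t (sc X c x)"
      using mult_left_mono[OF _ norm_ge_zero[of c]] by (metis mult.assoc mult_1)
    then show ?thesis using sc_le[OF x, of c] by simp
  qed
  fix y assume y: "y \<in> sumsp X"
  show "K t (x + y) \<le> K t x + K t y"
  proof (rule field_le_epsilon)
    fix e :: real assume e: "e > 0"
    obtain a b where
      ab: "a \<in> sp0 X" "b \<in> sp1 X" "x = a + b" "nm0 X a + t * nm1 X b < K t x + e / 2"
      using K_decomp[OF x, of t "K t x + e / 2"] e by (metis half_gt_zero less_add_same_cancel1)
    obtain c d where
      cd: "c \<in> sp0 X" "d \<in> sp1 X" "y = c + d" "nm0 X c + t * nm1 X d < K t y + e / 2"
      using K_decomp[OF y, of t "K t y + e / 2"] e by (metis half_gt_zero less_add_same_cancel1)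
    have "K t (x + y) = K t ((a + c) + (b + d))" using ab cd by (simp add: algebra_simps)
    also have "\<dots> \<le> nm0 X (a + c) + t * nm1 X (b + d)"
      using ab cd t by (intro K_le Z0.mem_add Z1.mem_add) auto
    also have "\<dots> \<le> (nm0 X a + nm0 X c) + t * (nm1 X b + nm1 X d)"
      using ab cd t by (intro add_mono mult_left_mono Z0.N_triangle Z1.N_triangle) auto
    finally show "K t (x + y) \<le> K t x + K t y + e" using ab cd by (simp add: algebra_simps)
  qed
qed

lemma K_cnspace: "0 < t \<Longrightarrow> cnspace (sc X) (sumsp X) (K t)"
  by unfold_locales (rule K_normed)

sublocale S: cnspace "sc X" "sumsp X" "K 1"
  by (rule K_cnspace) simp

lemma K_triangle: "0 < t \<Longrightarrow> x \<in> sumsp X \<Longrightarrow> y \<in> sumsp X \<Longrightarrow> K t (x + y) \<le> K t x + K t y"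
  using cnspace.N_triangle[OF K_cnspace] .

text \<open>The infimum need not be attained, but 2 K(t, x) > K(t, x) unless x = 0, and 0 has the
  trivial decomposition.\<close>

lemma near_optimal_decomp:
  assumes x: "x \<in> sumsp X" and t: "0 < t"
  obtains a b where "a \<in> sp0 X" "b \<in> sp1 X" "x = a + b" "nm0 X a \<le> 2 * K t x" "t * nm1 X b \<le> 2 * K t x"
proof (cases "x = 0")
  case True
  then show ?thesis
    using that[of 0 0] Z0.mem_zero Z1.mem_zero cnspace.N_zero[OF K_cnspace[OF t]] by simp
next
  case False
  then have "0 < K t x"
    using K_nonneg[OF x, of t] t cnspace.N_eq_0[OF K_cnspace[OF t] x] by simp
  then have "K t x < 2 * K t x" by simp
  from K_decomp[OF x this] obtain a b where
    ab: "a \<in> sp0 X" "b \<in> sp1 X" "x = a + b" "nm0 X a + t * nm1 X b < 2 * K t x" by metis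
  then show ?thesis
    using that[of a b] Z0.N_nonneg[of a] Z1.N_nonneg[of b] t
    by (smt (verit) mult_nonneg_nonneg)
qed

text \<open>Completeness of the sum space: each term is split nearly optimally at t = 1, the pieces
  are summed separately in the two complete spaces, and the limits are added.\<close>

lemma sumsp_summable_converges:
  assumes v: "\<And>n::nat. v n \<in> sumsp X" and sm: "summable (\<lambda>n. K 1 (v n))"
  obtains x where "x \<in> sumsp X" "S.vlim (\<lambda>n. \<Sum>i<n. v i) x sequentially"
proof -
  have "\<forall>n. \<exists>a b. a \<in> sp0 X \<and> b \<in> sp1 X \<and> v n = a + b \<and> nm0 X a \<le> 2 * K 1 (v n) \<and> nm1 X b \<le> 2 * K 1 (v n)"
  proof
    fix n
    from near_optimal_decomp[OF v[of n], of 1] show "\<exists>a b. a \<in> sp0 X \<and> b \<in> sp1 X \<and> v n = a + b \<and> nm0 X a \<le> 2 * K 1 (v n) \<and> nm1 X b \<le> 2 * K 1 (v n)"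
      by (metis mult_1 zero_less_one)
  qed
  then obtain a b where a: "\<And>n. a n \<in> sp0 X" and b: "\<And>n. b n \<in> sp1 X"
    and ab: "\<And>n. v n = a n + b n" "\<And>n. nm0 X (a n) \<le> 2 * K 1 (v n)" "\<And>n. nm1 X (b n) \<le> 2 * K 1 (v n)"
    by metis
  have sm2: "summable (\<lambda>n. 2 * K 1 (v n))" using sm by (rule summable_mult)
  have "summable (\<lambda>n. nm0 X (a n))" "summable (\<lambda>n. nm1 X (b n))"
    using ab a b Z0.N_nonneg Z1.N_nonneg by (auto intro!: summable_comparison_test'[OF sm2, of 0])
  then obtain l m where l: "l \<in> sp0 X" "Z0.vlim (\<lambda>n. \<Sum>i<n. a i) l sequentially"
    and m: "m \<in> sp1 X" "Z1.vlim (\<lambda>n. \<Sum>i<n. b i) m sequentially"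
    using Z0.summable_converges[of a] Z1.summable_converges[of b] a b bc
    unfolding banach_couple_def by metis
  have ma: "(\<Sum>i<n. a i) \<in> sp0 X" and mb: "(\<Sum>i<n. b i) \<in> sp1 X" for n
    by (rule Z0.mem_sum Z1.mem_sum, rule a b)+
  have "S.vlim (\<lambda>n. \<Sum>i<n. a i) l sequentially"
    using l(2) unfolding Z0.vlim_def
    by (intro S.vlimI[where g = "\<lambda>n. nm0 X ((\<Sum>i<n. a i) - l)"] always_eventually allI K_le0)
      (auto intro: sumsp0 l ma Z0.mem_diff)
  moreover have "S.vlim (\<lambda>n. \<Sum>i<n. b i) m sequentially"
    using m(2) unfolding Z1.vlim_def
    by (intro S.vlimI[where g = "\<lambda>n. nm1 X ((\<Sum>i<n. b i) - m)"] always_eventually allI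
        K_le1[where t=1, simplified]) (auto intro: sumsp1 m mb Z1.mem_diff)
  ultimately have "S.vlim (\<lambda>n. (\<Sum>i<n. a i) + (\<Sum>i<n. b i)) (l + m) sequentially"
    using l m ma mb by (intro S.vlim_add always_eventually allI) (auto intro: sumsp0 sumsp1)
  then show ?thesis
    using that[of "l + m"] sumspI[OF l(1) m(1)] by (simp add: ab(1) sum.distrib)
qed

end

section \<open>Calderon's space of analytic functions\<close>

lemma eps_delta_within:
  fixes g :: "'b::metric_space \<Rightarrow> real"
  assumes "\<And>w. w \<in> S \<Longrightarrow> w \<noteq> z \<Longrightarrow> 0 \<le> g w"
  shows "(\<forall>e>0. \<exists>d>0. \<forall>w. 0 < dist w z \<and> dist w z < d \<and> w \<in> S \<longrightarrow> g w < e)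
      \<longleftrightarrow> (g \<longlongrightarrow> 0) (at z within S)"
proof -
  have "(0 < dist w z \<and> dist w z < d \<and> w \<in> S \<longrightarrow> g w < e)
      \<longleftrightarrow> (w \<in> S \<longrightarrow> w \<noteq> z \<and> dist w z < d \<longrightarrow> dist (g w) 0 < e)" for w d e
    using assms[of w] by (cases "w \<in> S"; cases "w = z"; simp)
  then show ?thesis
    unfolding tendsto_iff eventually_at Ball_def by simp
qed

lemma eps_delta_at_point:
  fixes g :: "'b::metric_space \<Rightarrow> real"
  assumes "\<And>w. w \<in> S \<Longrightarrow> 0 \<le> g w" "g z = 0"
  shows "(\<forall>e>0. \<exists>d>0. \<forall>w\<in>S. dist w z < d \<longrightarrow> g w < e) \<longleftrightarrow> (g \<longlongrightarrow> 0) (at z within S)"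
proof -
  have *: "(\<forall>w\<in>S. dist w z < d \<longrightarrow> g w < e)
      \<longleftrightarrow> (\<forall>w. 0 < dist w z \<and> dist w z < d \<and> w \<in> S \<longrightarrow> g w < e)" if "e > 0" for d e
  proof -
    have "(w \<in> S \<longrightarrow> dist w z < d \<longrightarrow> g w < e)
        \<longleftrightarrow> (0 < dist w z \<and> dist w z < d \<and> w \<in> S \<longrightarrow> g w < e)" for w
      using that assms(2) by (cases "w = z") auto
    then show ?thesis unfolding Ball_def by simp
  qed
  have "(\<forall>e>0. \<exists>d>0. \<forall>w\<in>S. dist w z < d \<longrightarrow> g w < e)
      \<longleftrightarrow> (\<forall>e>0. \<exists>d>0. \<forall>w. 0 < dist w z \<and> dist w z < d \<and> w \<in> S \<longrightarrow> g w < e)"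
    by (intro all_cong ex_cong conj_cong refl *)
  also have "\<dots> \<longleftrightarrow> (g \<longlongrightarrow> 0) (at z within S)"
    by (rule eps_delta_within) (rule assms(1))
  finally show ?thesis .
qed

definition ostrip :: "complex set" where
  "ostrip = {z. 0 < Re z \<and> Re z < 1}"

lemma open_ostrip: "open ostrip"
proof -
  have "ostrip = {z. 0 < Re z} \<inter> {z. Re z < 1}" by (auto simp: ostrip_def)
  then show ?thesis using open_Int[OF open_halfspace_Re_gt open_halfspace_Re_lt] by metis
qed

lemma ostrip_subset: "ostrip \<subseteq> strip"
  by (auto simp: ostrip_def strip_def)

lemma strip_simps [simp]: "Complex 0 t \<in> strip" "Complex 1 t \<in> strip"
  by (auto simp: strip_def)

context bcpl
begin

abbreviation dquot :: "(complex \<Rightarrow> 'v) \<Rightarrow> complex \<Rightarrow> complex \<Rightarrow> 'v" where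
  "dquot f z h \<equiv> sc X (inverse h) (f (z + h) - f z)"

text \<open>Restates the \<epsilon>-\<delta> clauses of \<open>calF\<close> as limits. The condition
  on z + h confines h to a neighbourhood of 0, the open strip being open, so it defines the same
  limit as \<open>at 0\<close>. The case distinction is on membership, since the norms are known to
  be nonnegative on their carriers only.\<close>

lemma calF_iff:
  "f \<in> calF X \<longleftrightarrow>
     (\<forall>z\<in>strip. f z \<in> sumsp X) \<and>
     (\<exists>B. \<forall>z\<in>strip. K 1 (f z) \<le> B) \<and>
     (\<forall>z\<in>strip. S.vlim f (f z) (at z within strip)) \<and>
     (\<forall>z\<in>ostrip. \<exists>D\<in>sumsp X. S.vlim (dquot f z) D (at 0)) \<and>
     (\<forall>t. f (Complex 0 t) \<in> sp0 X) \<and> (\<forall>t. f (Complex 1 t) \<in> sp1 X) \<and>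
     (\<exists>B. \<forall>t. nm0 X (f (Complex 0 t)) \<le> B) \<and> (\<exists>B. \<forall>t. nm1 X (f (Complex 1 t)) \<le> B) \<and>
     (\<forall>t. Z0.vlim (\<lambda>s. f (Complex 0 s)) (f (Complex 0 t)) (at t)) \<and>
     (\<forall>t. Z1.vlim (\<lambda>s. f (Complex 1 s)) (f (Complex 1 t)) (at t))"
proof (cases "(\<forall>z\<in>strip. f z \<in> sumsp X) \<and> (\<forall>t. f (Complex 0 t) \<in> sp0 X) \<and> (\<forall>t. f (Complex 1 t) \<in> sp1 X)")
  case True
  then have m: "\<And>z. z \<in> strip \<Longrightarrow> f z \<in> sumsp X"
    and m0: "\<And>t. f (Complex 0 t) \<in> sp0 X" and m1: "\<And>t. f (Complex 1 t) \<in> sp1 X" by auto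
  have "(\<forall>e>0. \<exists>d>0. \<forall>w\<in>strip. dist w z < d \<longrightarrow> K 1 (f w - f z) < e)
      \<longleftrightarrow> S.vlim f (f z) (at z within strip)" if "z \<in> strip" for z
    unfolding S.vlim_def using that m by (intro eps_delta_at_point) (auto intro: S.N_nonneg S.mem_diff)
  moreover have "(\<forall>e>0. \<exists>d>0. \<forall>s\<in>UNIV. dist s t < d \<longrightarrow> nm0 X (f (Complex 0 s) - f (Complex 0 t)) < e)
      \<longleftrightarrow> Z0.vlim (\<lambda>s. f (Complex 0 s)) (f (Complex 0 t)) (at t)" for t
    unfolding Z0.vlim_def using m0 by (intro eps_delta_at_point) (auto intro: Z0.N_nonneg Z0.mem_diff)
  moreover have "(\<forall>e>0. \<exists>d>0. \<forall>s\<in>UNIV. dist s t < d \<longrightarrow> nm1 X (f (Complex 1 s) - f (Complex 1 t)) < e)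
      \<longleftrightarrow> Z1.vlim (\<lambda>s. f (Complex 1 s)) (f (Complex 1 t)) (at t)" for t
    unfolding Z1.vlim_def using m1 by (intro eps_delta_at_point) (auto intro: Z1.N_nonneg Z1.mem_diff)
  moreover have "(\<forall>e>0. \<exists>d>0. \<forall>h. 0 < cmod h \<and> cmod h < d \<and> 0 < Re (z + h) \<and> Re (z + h) < 1 \<longrightarrow>
        K 1 (dquot f z h - D) < e)
      \<longleftrightarrow> S.vlim (dquot f z) D (at 0)" if z: "z \<in> ostrip" and D: "D \<in> sumsp X" for z D
  proof -
    define A where "A = (\<lambda>h. z + h) -` ostrip"
    have "open A" unfolding A_def by (rule open_vimage[OF open_ostrip]) (intro continuous_intros)
    moreover have "0 \<in> A" using z by (simp add: A_def)
    ultimately have at: "at 0 within A = at 0" by (rule at_within_open[rotated])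
    have zh: "f (z + h) \<in> sumsp X" if "h \<in> A" for h
      using that ostrip_subset m by (auto simp: A_def)
    have fz: "f z \<in> sumsp X" using z ostrip_subset m by auto
    have "(\<forall>e>0. \<exists>d>0. \<forall>h. 0 < dist h 0 \<and> dist h 0 < d \<and> h \<in> A \<longrightarrow> K 1 (dquot f z h - D) < e)
      \<longleftrightarrow> ((\<lambda>h. K 1 (dquot f z h - D)) \<longlongrightarrow> 0) (at 0 within A)"
      by (rule eps_delta_within) (intro S.N_nonneg S.mem_diff S.mem_scale D zh fz)
    then show ?thesis unfolding at S.vlim_def by (simp add: A_def ostrip_def)
  qed
  ultimately show ?thesis
    unfolding calF_def ostrip_def using True by (simp add: dist_norm)
next
  case False
  then show ?thesis unfolding calF_def by blast
qed

lemma calFD: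
  assumes "f \<in> calF X"
  shows calF_mem: "z \<in> strip \<Longrightarrow> f z \<in> sumsp X"
    and calF_bdd: "\<exists>B. \<forall>z\<in>strip. K 1 (f z) \<le> B"
    and calF_cont: "z \<in> strip \<Longrightarrow> S.vlim f (f z) (at z within strip)"
    and calF_deriv: "z \<in> ostrip \<Longrightarrow> \<exists>D\<in>sumsp X. S.vlim (dquot f z) D (at 0)"
    and calF_mem0: "f (Complex 0 t) \<in> sp0 X" and calF_mem1: "f (Complex 1 t) \<in> sp1 X"
    and calF_bdd0: "\<exists>B. \<forall>t. nm0 X (f (Complex 0 t)) \<le> B"
    and calF_bdd1: "\<exists>B. \<forall>t. nm1 X (f (Complex 1 t)) \<le> B"
    and calF_cont0: "Z0.vlim (\<lambda>s. f (Complex 0 s)) (f (Complex 0 t)) (at t)"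
    and calF_cont1: "Z1.vlim (\<lambda>s. f (Complex 1 s)) (f (Complex 1 t)) (at t)"
  using assms unfolding calF_iff by blast+

lemma calF_mems: "f \<in> calF X \<Longrightarrow> \<forall>z\<in>strip. f z \<in> sumsp X"
  by (simp add: calF_mem)

lemma eventually_ostrip: "z \<in> ostrip \<Longrightarrow> \<forall>\<^sub>F h in at 0. z + h \<in> ostrip"
proof -
  assume z: "z \<in> ostrip"
  have "((\<lambda>h. z + h) \<longlongrightarrow> z + 0) (at 0)" by (intro tendsto_intros)
  then show ?thesis using topological_tendstoD[OF _ open_ostrip] z by auto
qed

lemma eventually_dquot_mem:
  assumes "\<forall>z\<in>strip. f z \<in> sumsp X" "z \<in> ostrip"
  shows "\<forall>\<^sub>F h in at 0. dquot f z h \<in> sumsp X"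
  using eventually_ostrip[OF assms(2)]
proof eventually_elim
  case (elim h)
  then show ?case
    using assms ostrip_subset by (intro S.mem_scale S.mem_diff) auto
qed

lemma calF_add:
  assumes f: "f \<in> calF X" and g: "g \<in> calF X"
  shows "(\<lambda>z. f z + g z) \<in> calF X"
  unfolding calF_iff
proof (intro conjI ballI allI)
  obtain A B where A: "\<And>z. z \<in> strip \<Longrightarrow> K 1 (f z) \<le> A" and B: "\<And>z. z \<in> strip \<Longrightarrow> K 1 (g z) \<le> B"
    using calF_bdd[OF f] calF_bdd[OF g] by blast
  have "K 1 (f z + g z) \<le> A + B" if "z \<in> strip" for z
    using S.N_triangle[of "f z" "g z"] calF_mem[OF f that] calF_mem[OF g that] A[OF that] B[OF that]
    by linarith
  then show "\<exists>B. \<forall>z\<in>strip. K 1 (f z + g z) \<le> B" by blast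
  obtain A B where A: "\<And>t. nm0 X (f (Complex 0 t)) \<le> A" and B: "\<And>t. nm0 X (g (Complex 0 t)) \<le> B"
    using calF_bdd0[OF f] calF_bdd0[OF g] by blast
  have "nm0 X (f (Complex 0 t) + g (Complex 0 t)) \<le> A + B" for t
    using Z0.N_triangle[OF calF_mem0[OF f] calF_mem0[OF g], of t t] A[of t] B[of t] by linarith
  then show "\<exists>B. \<forall>t. nm0 X (f (Complex 0 t) + g (Complex 0 t)) \<le> B" by blast
  obtain A B where A: "\<And>t. nm1 X (f (Complex 1 t)) \<le> A" and B: "\<And>t. nm1 X (g (Complex 1 t)) \<le> B"
    using calF_bdd1[OF f] calF_bdd1[OF g] by blast
  have "nm1 X (f (Complex 1 t) + g (Complex 1 t)) \<le> A + B" for t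
    using Z1.N_triangle[OF calF_mem1[OF f] calF_mem1[OF g], of t t] A[of t] B[of t] by linarith
  then show "\<exists>B. \<forall>t. nm1 X (f (Complex 1 t) + g (Complex 1 t)) \<le> B" by blast
next
  fix z assume z: "z \<in> strip"
  show "f z + g z \<in> sumsp X" using S.mem_add calF_mem f g z by blast
  have *: "\<forall>\<^sub>F w in at z within strip. w \<in> strip" by (simp add: eventually_at_filter)
  show "S.vlim (\<lambda>z. f z + g z) (f z + g z) (at z within strip)"
    by (intro S.vlim_add calF_cont f g z calF_mem eventually_mono[OF *])
next
  fix z assume z: "z \<in> ostrip"
  obtain D E where D: "D \<in> sumsp X" "S.vlim (dquot f z) D (at 0)"
    and E: "E \<in> sumsp X" "S.vlim (dquot g z) E (at 0)"
    using calF_deriv[OF f z] calF_deriv[OF g z] by blast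
  have "S.vlim (\<lambda>h. dquot f z h + dquot g z h) (D + E) (at 0)"
    by (intro S.vlim_add eventually_dquot_mem D E calF_mems f g z)
  moreover have "dquot f z h + dquot g z h = dquot (\<lambda>z. f z + g z) z h" for h
    by (simp add: scale_right_distrib[symmetric])
  ultimately show "\<exists>D\<in>sumsp X. S.vlim (dquot (\<lambda>z. f z + g z) z) D (at 0)"
    using S.mem_add[OF D(1) E(1)] by auto
next
  fix t
  show "f (Complex 0 t) + g (Complex 0 t) \<in> sp0 X" by (intro Z0.mem_add calF_mem0 f g)
  show "f (Complex 1 t) + g (Complex 1 t) \<in> sp1 X" by (intro Z1.mem_add calF_mem1 f g)
  show "Z0.vlim (\<lambda>s. f (Complex 0 s) + g (Complex 0 s)) (f (Complex 0 t) + g (Complex 0 t)) (at t)"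
    by (intro Z0.vlim_add calF_cont0 f g calF_mem0 always_eventually allI)
  show "Z1.vlim (\<lambda>s. f (Complex 1 s) + g (Complex 1 s)) (f (Complex 1 t) + g (Complex 1 t)) (at t)"
    by (intro Z1.vlim_add calF_cont1 f g calF_mem1 always_eventually allI)
qed

text \<open>The product rule, from splitting the quotient into a (z + h) times the quotient of f
  plus the quotient of a times f z. It is local at z, so it serves bounded multipliers as well as
  the factor 1 / (z - c), which is unbounded on the strip.\<close>

lemma dquot_scale:
  assumes f: "\<forall>z\<in>strip. f z \<in> sumsp X" and z: "z \<in> ostrip"
    and a: "(a has_field_derivative a') (at z)"
    and D: "D \<in> sumsp X" "S.vlim (dquot f z) D (at 0)"
  shows "S.vlim (dquot (\<lambda>z. sc X (a z) (f z)) z) (sc X (a z) D + sc X a' (f z)) (at 0)"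
proof -
  have fz: "f z \<in> sumsp X" using f z ostrip_subset by auto
  have "isCont a z" using a by (rule DERIV_isCont)
  then have "((\<lambda>h. a (z + h)) \<longlongrightarrow> a z) (at 0)" by (simp add: isCont_iff)
  then have 1: "S.vlim (\<lambda>h. sc X (a (z + h)) (dquot f z h)) (sc X (a z) D) (at 0)"
    by (rule S.vlim_scale[OF _ eventually_dquot_mem[OF f z] D])
  have "((\<lambda>h. (a (z + h) - a z) / h) \<longlongrightarrow> a') (at 0)" using a by (simp add: DERIV_def)
  then have 2: "S.vlim (\<lambda>h. sc X ((a (z + h) - a z) / h) (f z)) (sc X a' (f z)) (at 0)"
    by (rule S.vlim_scale) (auto simp: fz S.vlim_const)
  have "S.vlim (\<lambda>h. sc X (a (z + h)) (dquot f z h) + sc X ((a (z + h) - a z) / h) (f z))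
      (sc X (a z) D + sc X a' (f z)) (at 0)"
  proof (intro S.vlim_add 1 2 S.mem_scale D fz)
    show "\<forall>\<^sub>F h in at 0. sc X (a (z + h)) (dquot f z h) \<in> sumsp X"
      using eventually_dquot_mem[OF f z] by eventually_elim (rule S.mem_scale)
  qed (intro always_eventually allI S.mem_scale fz)
  moreover have "sc X (a (z + h)) (dquot f z h) + sc X ((a (z + h) - a z) / h) (f z)
      = dquot (\<lambda>z. sc X (a z) (f z)) z h" for h
    by (simp add: scale_right_diff_distrib scale_left_diff_distrib divide_inverse algebra_simps)
  ultimately show ?thesis by simp
qed

lemma calF_scale:
  assumes f: "f \<in> calF X" and cont: "continuous_on strip a" and hol: "a holomorphic_on ostrip"
    and bdd: "\<And>z. z \<in> strip \<Longrightarrow> cmod (a z) \<le> A"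
  shows "(\<lambda>z. sc X (a z) (f z)) \<in> calF X"
  unfolding calF_iff
proof (intro conjI ballI allI)
  obtain B where B: "\<And>z. z \<in> strip \<Longrightarrow> K 1 (f z) \<le> B" using calF_bdd[OF f] by blast
  have "K 1 (sc X (a z) (f z)) \<le> A * B" if "z \<in> strip" for z
    unfolding S.N_scale[OF calF_mem[OF f that]] using that B bdd[OF that]
    by (intro mult_mono) (auto intro: S.N_nonneg calF_mem f order_trans[OF norm_ge_zero bdd[OF that]])
  then show "\<exists>B. \<forall>z\<in>strip. K 1 (sc X (a z) (f z)) \<le> B" by blast
  obtain B where B: "\<And>t. nm0 X (f (Complex 0 t)) \<le> B" using calF_bdd0[OF f] by blast
  have "nm0 X (sc X (a (Complex 0 t)) (f (Complex 0 t))) \<le> A * B" for t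
    unfolding Z0.N_scale[OF calF_mem0[OF f]] using B bdd
    by (intro mult_mono) (auto intro: Z0.N_nonneg calF_mem0 f order_trans[OF norm_ge_zero bdd[of "Complex 0 t"]])
  then show "\<exists>B. \<forall>t. nm0 X (sc X (a (Complex 0 t)) (f (Complex 0 t))) \<le> B" by blast
  obtain B where B: "\<And>t. nm1 X (f (Complex 1 t)) \<le> B" using calF_bdd1[OF f] by blast
  have "nm1 X (sc X (a (Complex 1 t)) (f (Complex 1 t))) \<le> A * B" for t
    unfolding Z1.N_scale[OF calF_mem1[OF f]] using B bdd
    by (intro mult_mono) (auto intro: Z1.N_nonneg calF_mem1 f order_trans[OF norm_ge_zero bdd[of "Complex 1 t"]])
  then show "\<exists>B. \<forall>t. nm1 X (sc X (a (Complex 1 t)) (f (Complex 1 t))) \<le> B" by blast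
next
  fix z assume z: "z \<in> strip"
  show "sc X (a z) (f z) \<in> sumsp X" using S.mem_scale calF_mem f z by blast
  have *: "\<forall>\<^sub>F w in at z within strip. w \<in> strip" by (simp add: eventually_at_filter)
  have "(a \<longlongrightarrow> a z) (at z within strip)" using cont z by (simp add: continuous_on)
  moreover have "\<forall>\<^sub>F w in at z within strip. f w \<in> sumsp X"
    using * by (rule eventually_mono) (rule calF_mem[OF f])
  ultimately show "S.vlim (\<lambda>z. sc X (a z) (f z)) (sc X (a z) (f z)) (at z within strip)"
    by (rule S.vlim_scale[OF _ _ calF_mem[OF f z] calF_cont[OF f z]])
next
  fix z assume z: "z \<in> ostrip"
  obtain D where D: "D \<in> sumsp X" "S.vlim (dquot f z) D (at 0)"
    using calF_deriv[OF f z] by blast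
  obtain a' where a': "(a has_field_derivative a') (at z)"
    using holomorphic_on_imp_differentiable_at[OF hol open_ostrip z] by (auto simp: field_differentiable_def)
  have "sc X (a z) D + sc X a' (f z) \<in> sumsp X"
    using z ostrip_subset by (intro S.mem_add S.mem_scale D calF_mem f) auto
  with dquot_scale[OF calF_mems[OF f] z a' D]
  show "\<exists>D\<in>sumsp X. S.vlim (dquot (\<lambda>z. sc X (a z) (f z)) z) D (at 0)" by blast
next
  fix t
  show "sc X (a (Complex 0 t)) (f (Complex 0 t)) \<in> sp0 X" by (intro Z0.mem_scale calF_mem0 f)
  show "sc X (a (Complex 1 t)) (f (Complex 1 t)) \<in> sp1 X" by (intro Z1.mem_scale calF_mem1 f)
  have lim: "((\<lambda>s. a (Complex c s)) \<longlongrightarrow> a (Complex c t)) (at t)" if "c = 0 \<or> c = 1" for c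
  proof -
    have "continuous_on UNIV (\<lambda>s. Complex c s)"
      unfolding Complex_eq by (intro continuous_intros)
    then have "continuous_on UNIV (\<lambda>s. a (Complex c s))"
      by (rule continuous_on_compose2[OF cont]) (use that in auto)
    then show ?thesis by (simp add: continuous_on)
  qed
  show "Z0.vlim (\<lambda>s. sc X (a (Complex 0 s)) (f (Complex 0 s))) (sc X (a (Complex 0 t)) (f (Complex 0 t))) (at t)"
    by (intro Z0.vlim_scale lim calF_cont0 f calF_mem0 always_eventually allI) simp
  show "Z1.vlim (\<lambda>s. sc X (a (Complex 1 s)) (f (Complex 1 s))) (sc X (a (Complex 1 t)) (f (Complex 1 t))) (at t)"
    by (intro Z1.vlim_scale lim calF_cont1 f calF_mem1 always_eventually allI) simp
qed

lemma calF_const: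
  assumes "y \<in> sp0 X" "y \<in> sp1 X"
  shows "(\<lambda>_. y) \<in> calF X"
  unfolding calF_iff
  using assms sumsp0[of y] S.mem_zero
  by (auto simp: S.vlim_const Z0.vlim_const Z1.vlim_const intro!: bexI[of _ 0])

text \<open>Vertical translation maps the strip and each of its edges onto itself. It turns a value
  at c + ir into a value at c, which is how points off the real axis are reached by a single complex
  interpolation space.\<close>

lemma calF_translate:
  assumes f: "f \<in> calF X"
  shows "(\<lambda>z. f (z + Complex 0 r)) \<in> calF X"
  unfolding calF_iff
proof (intro conjI ballI allI)
  have st: "z + Complex 0 r \<in> strip \<longleftrightarrow> z \<in> strip" for z by (simp add: strip_def)
  have tr: "Complex c t + Complex 0 r = Complex c (t + r)" for c t by (simp add: complex_eq_iff)
  show "\<exists>B. \<forall>z\<in>strip. K 1 (f (z + Complex 0 r)) \<le> B" using calF_bdd[OF f] st by blast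
  show "\<exists>B. \<forall>t. nm0 X (f (Complex 0 t + Complex 0 r)) \<le> B"
    unfolding tr using calF_bdd0[OF f] by blast
  show "\<exists>B. \<forall>t. nm1 X (f (Complex 1 t + Complex 0 r)) \<le> B"
    unfolding tr using calF_bdd1[OF f] by blast
  show "f (z + Complex 0 r) \<in> sumsp X" if "z \<in> strip" for z using calF_mem[OF f] st that by blast
  show "f (Complex 0 t + Complex 0 r) \<in> sp0 X" "f (Complex 1 t + Complex 0 r) \<in> sp1 X" for t
    unfolding tr by (rule calF_mem0[OF f] calF_mem1[OF f])+
  show "S.vlim (\<lambda>z. f (z + Complex 0 r)) (f (z + Complex 0 r)) (at z within strip)" if z: "z \<in> strip" for z
    unfolding S.vlim_def
  proof (rule filterlim_compose[OF calF_cont[OF f, unfolded S.vlim_def]])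
    show "z + Complex 0 r \<in> strip" using st z by blast
    show "filterlim (\<lambda>w. w + Complex 0 r) (at (z + Complex 0 r) within strip) (at z within strip)"
      unfolding filterlim_at
    proof (intro conjI)
      show "\<forall>\<^sub>F w in at z within strip. w + Complex 0 r \<in> strip \<and> w + Complex 0 r \<noteq> z + Complex 0 r"
        by (auto simp: eventually_at_filter st)
    qed (intro tendsto_intros)
  qed
  show "\<exists>D\<in>sumsp X. S.vlim (dquot (\<lambda>z. f (z + Complex 0 r)) z) D (at 0)" if z: "z \<in> ostrip" for z
  proof -
    have "z + Complex 0 r \<in> ostrip" using z by (simp add: ostrip_def)
    from calF_deriv[OF f this] show ?thesis by (simp add: add.assoc add.commute[of "Complex 0 r"])
  qed
  have shift: "filterlim (\<lambda>s. s + r) (at (t + r)) (at t)" for t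
    unfolding filterlim_at by (auto simp: eventually_at_filter intro!: tendsto_intros)
  show "Z0.vlim (\<lambda>s. f (Complex 0 s + Complex 0 r)) (f (Complex 0 t + Complex 0 r)) (at t)" for t
    unfolding tr using filterlim_compose[OF calF_cont0[OF f, unfolded Z0.vlim_def] shift]
    by (simp add: Z0.vlim_def)
  show "Z1.vlim (\<lambda>s. f (Complex 1 s + Complex 0 r)) (f (Complex 1 t + Complex 0 r)) (at t)" for t
    unfolding tr using filterlim_compose[OF calF_cont1[OF f, unfolded Z1.vlim_def] shift]
    by (simp add: Z1.vlim_def)
qed

lemma functional_continuous:
  assumes l: "S.cfunctional l" and f: "f \<in> calF X"
  shows "continuous_on strip (\<lambda>z. l (f z))"
  unfolding continuous_on
proof
  fix z assume z: "z \<in> strip"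
  have *: "\<forall>\<^sub>F w in at z within strip. w \<in> strip" by (simp add: eventually_at_filter)
  show "((\<lambda>z. l (f z)) \<longlongrightarrow> l (f z)) (at z within strip)"
    by (rule S.cf_tendsto[OF l calF_cont[OF f z] eventually_mono[OF * calF_mem[OF f]] calF_mem[OF f z]])
qed

lemma functional_has_derivative:
  assumes l: "S.cfunctional l" and f: "\<forall>z\<in>strip. f z \<in> sumsp X" and z: "z \<in> ostrip"
    and D: "D \<in> sumsp X" "S.vlim (dquot f z) D (at 0)"
  shows "((\<lambda>z. l (f z)) has_field_derivative l D) (at z)"
proof -
  have fz: "f z \<in> sumsp X" using f z ostrip_subset by auto
  have "((\<lambda>h. l (dquot f z h)) \<longlongrightarrow> l D) (at 0)"
    by (rule S.cf_tendsto[OF l D(2) eventually_dquot_mem[OF f z] D(1)])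
  then have "((\<lambda>h. (l (f (z + h)) - l (f z)) / h) \<longlongrightarrow> l D) (at 0)"
  proof (rule tendsto_cong[THEN iffD1, rotated])
    show "\<forall>\<^sub>F h in at 0. l (dquot f z h) = (l (f (z + h)) - l (f z)) / h"
      using eventually_ostrip[OF z]
    proof eventually_elim
      case (elim h)
      then have "f (z + h) \<in> sumsp X" using f ostrip_subset by auto
      then show ?case
        using fz by (simp add: S.cf_scale[OF l] S.cf_diff[OF l] S.mem_diff divide_inverse mult.commute)
    qed
  qed
  then show ?thesis by (simp add: DERIV_def)
qed

lemma functional_holomorphic:
  assumes l: "S.cfunctional l" and f: "f \<in> calF X"
  shows "(\<lambda>z. l (f z)) holomorphic_on ostrip"
proof -
  have "\<exists>d. ((\<lambda>z. l (f z)) has_field_derivative d) (at z)" if "z \<in> ostrip" for z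
    using functional_has_derivative[OF l calF_mems[OF f] that] calF_deriv[OF f that] by blast
  then show ?thesis
    by (auto simp: holomorphic_on_def field_differentiable_def
        intro: has_field_derivative_at_within)
qed

text \<open>Continuity and differentiability in \<open>calF\<close> refer to K(1, .), so a
  functional contractive for K(t, .) is rescaled before it is composed with such functions.\<close>

lemma functional_rescale:
  assumes t: "0 < t" and l: "cnspace.cfunctional (sc X) (sumsp X) (K t) l"
  shows "S.cfunctional (\<lambda>x. l x / max 1 t)"
proof -
  interpret Kt: cnspace "sc X" "sumsp X" "K t" by (rule K_cnspace[OF t])
  show ?thesis
    unfolding S.cfunctional_def
  proof (intro conjI ballI allI)
    fix x assume x: "x \<in> sumsp X"
    have "cmod (l x) \<le> max 1 t * K 1 x"
      using Kt.cf_bound[OF l x] K_dilate[OF x, of 1 t] t by simp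
    then show "cmod (l x / max 1 t) \<le> K 1 x"
      using t by (simp add: norm_divide divide_le_eq mult.commute max_def split: if_splits)
  qed (auto simp: Kt.cf_add[OF l] Kt.cf_scale[OF l] add_divide_distrib)
qed

text \<open>An upper bound M in place of the supremum \<open>Fnorm\<close>, so that sums, scalings
  and translates carry explicit bounds; suprema are confined to the passage to
  \<open>cinterp_norm\<close>.\<close>

definition FB :: "(complex \<Rightarrow> 'v) \<Rightarrow> real \<Rightarrow> bool" where
  "FB f M \<longleftrightarrow> f \<in> calF X \<and> (\<forall>t. nm0 X (f (Complex 0 t)) \<le> M) \<and> (\<forall>t. nm1 X (f (Complex 1 t)) \<le> M)"

lemma FB_calF: "FB f M \<Longrightarrow> f \<in> calF X"
  and FB_0: "FB f M \<Longrightarrow> nm0 X (f (Complex 0 t)) \<le> M"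
  and FB_1: "FB f M \<Longrightarrow> nm1 X (f (Complex 1 t)) \<le> M"
  by (auto simp: FB_def)

lemma FB_nonneg: "FB f M \<Longrightarrow> 0 \<le> M"
  using Z0.N_nonneg[OF calF_mem0[OF FB_calF], of f M 0] FB_0[of f M 0] by linarith

lemma FB_add:
  assumes "FB f A" "FB g B"
  shows "FB (\<lambda>z. f z + g z) (A + B)"
  unfolding FB_def
proof (intro conjI allI)
  note c = assms[THEN FB_calF]
  show "(\<lambda>z. f z + g z) \<in> calF X" using c by (rule calF_add)
  show "nm0 X (f (Complex 0 t) + g (Complex 0 t)) \<le> A + B" for t
    using Z0.N_triangle[OF c[THEN calF_mem0], of t t] FB_0[OF assms(1), of t] FB_0[OF assms(2), of t]
    by linarith
  show "nm1 X (f (Complex 1 t) + g (Complex 1 t)) \<le> A + B" for t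
    using Z1.N_triangle[OF c[THEN calF_mem1], of t t] FB_1[OF assms(1), of t] FB_1[OF assms(2), of t]
    by linarith
qed

lemma FB_scale_const:
  assumes "FB f A"
  shows "FB (\<lambda>z. sc X c (f z)) (cmod c * A)"
  unfolding FB_def
proof (intro conjI allI)
  show "(\<lambda>z. sc X c (f z)) \<in> calF X"
    by (rule calF_scale[OF FB_calF[OF assms], of _ "cmod c"]) auto
qed (auto simp: Z0.N_scale[OF calF_mem0[OF FB_calF[OF assms]]]
    Z1.N_scale[OF calF_mem1[OF FB_calF[OF assms]]] FB_0[OF assms] FB_1[OF assms] mult_left_mono)

lemma FB_translate:
  assumes "FB f A"
  shows "FB (\<lambda>z. f (z + Complex 0 r)) A"
proof -
  have tr: "Complex c t + Complex 0 r = Complex c (t + r)" for c t by (simp add: complex_eq_iff)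
  show ?thesis unfolding FB_def tr using assms calF_translate by (simp add: FB_def)
qed

text \<open>Three lines for t^(-w) l (f w), where l is contractive for K(t, .): on Re w = 0 the
  bound is K(t, .) <= \<open>nm0\<close>, and on Re w = 1 the factor t^(-w) cancels the t in K(t, .)
  <= t \<open>nm1\<close>. Hence M bounds both edges.\<close>

theorem K_calF_le:
  assumes f: "FB f M" and z: "z \<in> strip" and t: "0 < t"
  shows "K t (f z) \<le> t powr Re z * M"
proof -
  interpret Kt: cnspace "sc X" "sumsp X" "K t" by (rule K_cnspace[OF t])
  note fc = FB_calF[OF f]
  have M: "0 \<le> M" using FB_nonneg[OF f] .
  show ?thesis
  proof (rule Kt.norm_le_of_functionals[OF calF_mem[OF fc z]])
    fix l assume l: "Kt.cfunctional l"
    define c where "c = max 1 t"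
    have c: "c > 0" by (simp add: c_def)
    define l' where "l' x = l x / c" for x
    have l': "S.cfunctional l'"
      using functional_rescale[OF t l] by (simp add: l'_def[abs_def] c_def)
    have ll': "l x = c * l' x" for x using c by (simp add: l'_def)
    define g where "g w = l (f w) * exp (- (w * of_real (ln t)))" for w
    have nexp: "cmod (exp (- (w * of_real (ln t)))) = t powr (- Re w)" for w
      using t by (simp add: norm_exp_eq_Re powr_def mult.commute)
    obtain B where B: "\<And>z. z \<in> strip \<Longrightarrow> K 1 (f z) \<le> B" using calF_bdd[OF fc] by blast
    have "cmod (g z) \<le> M"
    proof (rule three_lines[where f = g, OF _ _ _ _ _ z])
      show "continuous_on strip g"
        unfolding g_def ll' by (intro continuous_intros functional_continuous l' fc)
      show "g holomorphic_on {z. 0 < Re z \<and> Re z < 1}"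
        unfolding g_def ll' ostrip_def[symmetric]
        by (intro holomorphic_intros functional_holomorphic l' fc)
      show "cmod (g w) \<le> c * B * exp \<bar>ln t\<bar>" if w: "w \<in> strip" for w
        unfolding g_def norm_mult nexp
      proof (rule mult_mono)
        have "cmod (l' (f w)) \<le> B"
          using S.cf_bound[OF l' calF_mem[OF fc w]] B[OF w] by linarith
        then show "cmod (l (f w)) \<le> c * B" using c by (simp add: ll' norm_mult)
        then show "0 \<le> c * B" using norm_ge_zero order_trans by blast
        have "- Re w * ln t \<le> \<bar>- Re w * ln t\<bar>" by simp
        also have "\<dots> \<le> 1 * \<bar>ln t\<bar>"
          unfolding abs_mult using w by (intro mult_right_mono) (auto simp: strip_def)
        finally show "t powr - Re w \<le> exp \<bar>ln t\<bar>" using t by (simp add: powr_def)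
      qed auto
      show "cmod (g (Complex 0 r)) \<le> M" for r
        using Kt.cf_bound[OF l calF_mem[OF fc], of "Complex 0 r"] K_le0[OF calF_mem0[OF fc], of t r] t
          FB_0[OF f, of r] by (simp add: g_def norm_mult nexp)
      show "cmod (g (Complex 1 r)) \<le> M" for r
      proof -
        have "cmod (l (f (Complex 1 r))) \<le> t * nm1 X (f (Complex 1 r))"
          using Kt.cf_bound[OF l calF_mem[OF fc], of "Complex 1 r"] K_le1[OF calF_mem1[OF fc], of t r] t
          by simp
        also have "\<dots> \<le> t * M" using FB_1[OF f, of r] t by (intro mult_left_mono) auto
        finally show ?thesis
          using t unfolding g_def norm_mult nexp by (simp add: powr_minus_divide pos_divide_le_eq mult.commute)
      qed
    qed
    then show "cmod (l (f z)) \<le> t powr Re z * M"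
      using t unfolding g_def norm_mult nexp
      by (simp add: powr_minus_divide pos_divide_le_eq mult.commute)
  qed
qed

end

section \<open>Division by a zero in the strip, and the norm of the complex method\<close>

context bcpl
begin

text \<open>The difference quotients of a bounded function that is holomorphic under every functional
  are Lipschitz, with a constant independent of the functional, so they converge in the norm.\<close>

lemma weakly_holomorphic_differentiable:
  assumes r: "0 < r" "ball c r \<subseteq> ostrip" and g: "\<forall>z\<in>strip. g z \<in> sumsp X"
    and B: "\<And>z. z \<in> strip \<Longrightarrow> K 1 (g z) \<le> B"
    and hol: "\<And>l. S.cfunctional l \<Longrightarrow> (\<lambda>z. l (g z)) holomorphic_on ball c r"
  shows "\<exists>D\<in>sumsp X. S.vlim (dquot g c) D (at 0)"
proof -
  define L where "L = 16 * B / r\<^sup>2"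
  have bs: "g z \<in> sumsp X" if "z \<in> ball c r" for z
    using that r(2) g ostrip_subset by blast
  have cmem: "g c \<in> sumsp X" using bs r by simp
  have qmem: "dquot g c h \<in> sumsp X" if "cmod h < r" for h
    using that by (intro S.mem_scale S.mem_diff bs cmem) (simp add: dist_norm)
  have B0: "0 \<le> B"
    using B[of c] S.N_nonneg[OF cmem] r ostrip_subset by (meson centre_in_ball order_trans subsetD)
  then have L0: "0 \<le> L" by (simp add: L_def)
  have lip: "K 1 (dquot g c h - dquot g c k) \<le> L * cmod (h - k)"
    if h: "h \<noteq> 0" "cmod h < r / 4" and k: "k \<noteq> 0" "cmod k < r / 4" for h k
  proof (rule S.norm_le_of_functionals)
    have hr: "cmod h < r" "cmod k < r" using h k r by auto
    then show "dquot g c h - dquot g c k \<in> sumsp X"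
      by (intro S.mem_diff qmem)
    fix l assume l: "S.cfunctional l"
    have e: "l (dquot g c h) = (l (g (c + h)) - l (g c)) / h" if "cmod h < r" for h
      using that bs[of "c + h"] cmem
      by (simp add: S.cf_scale[OF l] S.cf_diff[OF l] S.mem_diff dist_norm divide_inverse mult.commute)
    have "cmod (l (g z)) \<le> B" if "z \<in> ball c r" for z
      using S.cf_bound[OF l bs[OF that]] B[of z] that r(2) ostrip_subset by (meson order_trans subsetD)
    from difference_quotient_lipschitz[OF hol[OF l] r(1) this h k]
    show "cmod (l (dquot g c h - dquot g c k)) \<le> L * cmod (h - k)"
      using hr by (simp add: S.cf_diff[OF l] qmem e L_def)
  qed
  \<comment> \<open>Starting at r/8 keeps all increments inside the radius r/4 of the Lipschitz
    estimate; halving makes consecutive quotients differ by a geometric sequence, so they converge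
    by completeness.\<close>
  define h where "h n = complex_of_real (r / 8 * (1/2) ^ n)" for n :: nat
  have hn: "cmod (h n) = r / 8 * (1/2) ^ n" for n
    using r by (simp add: h_def norm_mult norm_power)
  have h1: "h n \<noteq> 0" "cmod (h n) < r / 4" "cmod (h n) < r" for n
  proof -
    show "h n \<noteq> 0" using r by (simp add: h_def)
    have "(1/2::real) ^ n \<le> 1" by (simp add: power_le_one)
    then have "cmod (h n) \<le> r / 8 * 1" unfolding hn using r by (intro mult_left_mono) auto
    then show "cmod (h n) < r / 4" "cmod (h n) < r" using r by auto
  qed
  define v where "v n = dquot g c (h (Suc n)) - dquot g c (h n)" for n
  have vm: "v n \<in> sumsp X" for n unfolding v_def by (intro S.mem_diff qmem h1)
  have vle: "K 1 (v n) \<le> L * r / 8 * (1/2) ^ n" for n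
  proof -
    have "K 1 (v n) \<le> L * cmod (h (Suc n) - h n)"
      unfolding v_def by (intro lip h1)
    also have "\<dots> \<le> L * (r / 8 * (1/2) ^ n)"
    proof (rule mult_left_mono[OF _ L0])
      have "h (Suc n) - h n = - (complex_of_real (r / 8 * (1/2) ^ n / 2))"
        by (simp add: h_def field_simps)
      then have "cmod (h (Suc n) - h n) = \<bar>r / 8 * (1/2) ^ n / 2\<bar>"
        by (metis norm_minus_cancel norm_of_real)
      also have "\<dots> \<le> r / 8 * (1/2) ^ n" using r by simp
      finally show "cmod (h (Suc n) - h n) \<le> r / 8 * (1/2) ^ n" .
    qed
    finally show ?thesis by simp
  qed
  have "summable (\<lambda>n. K 1 (v n))"
  proof (rule summable_comparison_test'[of "\<lambda>n. L * r / 8 * (1/2) ^ n" 0])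
    show "summable (\<lambda>n. L * r / 8 * (1/2) ^ n)" by (intro summable_mult summable_geometric) simp
    show "norm (K 1 (v n)) \<le> L * r / 8 * (1/2) ^ n" for n
      using vle[of n] S.N_nonneg[OF vm[of n]] by simp
  qed
  from sumsp_summable_converges[of v, OF vm this] obtain x where
    x: "x \<in> sumsp X" "S.vlim (\<lambda>n. \<Sum>i<n. v i) x sequentially" by metis
  have sum: "(\<Sum>i<n. v i) = dquot g c (h n) - dquot g c (h 0)" for n
    unfolding v_def by (rule sum_lessThan_telescope)
  define D where "D = x + dquot g c (h 0)"
  have Dm: "D \<in> sumsp X" unfolding D_def by (intro S.mem_add x qmem h1)
  have lim: "((\<lambda>n. K 1 (dquot g c (h n) - D)) \<longlongrightarrow> 0) sequentially"
    using x(2) unfolding S.vlim_def sum D_def by (simp add: algebra_simps)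
  have h0: "h \<longlonglongrightarrow> 0"
  proof -
    have "(\<lambda>n. complex_of_real (r / 8 * (1/2) ^ n)) \<longlonglongrightarrow> complex_of_real (r / 8 * 0)"
      by (intro tendsto_intros LIMSEQ_power_zero) simp
    then show ?thesis by (simp add: h_def[abs_def])
  qed
  \<comment> \<open>Letting n tend to infinity in the Lipschitz bound passes from the chosen
    sequence to arbitrary increments k.\<close>
  have bound: "K 1 (dquot g c k - D) \<le> L * cmod k" if k: "k \<noteq> 0" "cmod k < r / 4" for k
  proof -
    have km: "dquot g c k \<in> sumsp X" using k r by (intro qmem) simp
    have "K 1 (dquot g c k - D) \<le> L * cmod (k - h n) + K 1 (dquot g c (h n) - D)" for n
      using S.N_triangle3[OF km qmem[OF h1(3)] Dm, of n] lip[OF k h1(1,2), of n] by linarith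
    moreover have "(\<lambda>n. L * cmod (k - h n) + K 1 (dquot g c (h n) - D)) \<longlonglongrightarrow> L * cmod (k - 0) + 0"
      by (intro tendsto_intros lim h0)
    ultimately show ?thesis
      by (intro LIMSEQ_le_const[of "\<lambda>n. L * cmod (k - h n) + K 1 (dquot g c (h n) - D)"]) auto
  qed
  have ev: "\<forall>\<^sub>F k in at 0. k \<noteq> 0 \<and> cmod k < r / 4"
    using r unfolding eventually_at by (intro exI[of _ "r / 4"]) (auto simp: dist_norm)
  have "S.vlim (dquot g c) D (at 0)"
  proof (rule S.vlimI[OF _ Dm])
    show "\<forall>\<^sub>F k in at 0. dquot g c k \<in> sumsp X"
      using ev by (rule eventually_mono) (rule qmem, use r in auto)
    show "\<forall>\<^sub>F k in at 0. K 1 (dquot g c k - D) \<le> L * cmod k"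
      using ev by (rule eventually_mono) (simp add: bound)
    have "((\<lambda>k. L * cmod k) \<longlongrightarrow> L * cmod 0) (at 0)" by (intro tendsto_intros)
    then show "((\<lambda>k. L * cmod k) \<longlongrightarrow> 0) (at 0)" by simp
  qed
  then show ?thesis using Dm by blast
qed

text \<open>The Calderon norm sees only the two edges, where the distance to c is at least min c (1
  - c); this is the whole cost of dividing. Inside the strip the quotient is extended by the
  derivative of f at c, and the work lies in showing that it stays bounded and becomes complex
  differentiable there.\<close>

theorem calF_divide:
  assumes f: "FB f M" and c: "0 < c" "c < 1" and f0: "f (complex_of_real c) = 0"
  obtains g where "FB g (M / min c (1 - c))" "\<And>z. z \<in> strip \<Longrightarrow> f z = sc X (z - of_real c) (g z)"
proof -
  note fc = FB_calF[OF f]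
  let ?c = "complex_of_real c"
  define d where "d = min c (1 - c)"
  have d: "0 < d" using c by (simp add: d_def)
  have co: "?c \<in> ostrip" using c by (simp add: ostrip_def)
  have cs: "?c \<in> strip" using co ostrip_subset by auto
  obtain D where D: "D \<in> sumsp X" "S.vlim (dquot f ?c) D (at 0)" using calF_deriv[OF fc co] by blast
  define a where "a z = inverse (z - ?c)" for z
  define g where "g z = (if z = ?c then D else sc X (a z) (f z))" for z
  have gmem: "g z \<in> sumsp X" if "z \<in> strip" for z
    using that D by (auto simp: g_def intro: S.mem_scale calF_mem fc)
  have evs: "\<forall>\<^sub>F w in at z within strip. w \<in> strip" for z by (simp add: eventually_at_filter)
  have gcont_c: "S.vlim g (g ?c) (at ?c within strip)"
  proof -
    have "((\<lambda>z. K 1 (dquot f ?c (z - ?c) - D)) \<longlongrightarrow> 0) (at ?c)"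
      using D(2) LIM_offset[of "\<lambda>h. K 1 (dquot f ?c h - D)" 0 0 "- ?c"]
      unfolding S.vlim_def by simp
    then have "((\<lambda>z. K 1 (dquot f ?c (z - ?c) - D)) \<longlongrightarrow> 0) (at ?c within strip)"
      by (rule tendsto_within_subset) simp
    then have "S.vlim (\<lambda>z. dquot f ?c (z - ?c)) D (at ?c within strip)" by (simp add: S.vlim_def)
    moreover have "\<forall>\<^sub>F z in at ?c within strip. dquot f ?c (z - ?c) = g z"
      by (simp add: eventually_at_filter g_def a_def f0)
    ultimately have "S.vlim g D (at ?c within strip)" by (rule S.vlim_cong[rotated])
    then show ?thesis by (simp add: g_def)
  qed
  have ne_c: "\<forall>\<^sub>F w in at z within A. w \<noteq> ?c" if "z \<noteq> ?c" for z A
    using that by (metis eventually_at_topological eventually_neq_at_within)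
  have gcont: "S.vlim g (g z) (at z within strip)" if z: "z \<in> strip" for z
  proof (cases "z = ?c")
    case False
    have "(a \<longlongrightarrow> a z) (at z within strip)"
      unfolding a_def using False by (intro tendsto_intros) auto
    then have "S.vlim (\<lambda>w. sc X (a w) (f w)) (sc X (a z) (f z)) (at z within strip)"
      by (rule S.vlim_scale[OF _ eventually_mono[OF evs calF_mem[OF fc]] calF_mem[OF fc z] calF_cont[OF fc z]])
    moreover have "\<forall>\<^sub>F w in at z within strip. sc X (a w) (f w) = g w"
      using ne_c[OF False] by (rule eventually_mono) (simp add: g_def)
    ultimately have "S.vlim g (sc X (a z) (f z)) (at z within strip)" by (rule S.vlim_cong[rotated])
    then show ?thesis using False by (simp add: g_def)
  qed (use gcont_c in simp)
  obtain B where B: "\<And>z. z \<in> strip \<Longrightarrow> K 1 (f z) \<le> B" using calF_bdd[OF fc] by blast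
  have B0: "0 \<le> B" using B[OF cs] S.N_nonneg[OF calF_mem[OF fc cs]] by linarith
  \<comment> \<open>Near c the bound comes from continuity, elsewhere from |z - c| >= e.\<close>
  obtain B' where B': "\<And>z. z \<in> strip \<Longrightarrow> K 1 (g z) \<le> B'"
  proof -
    from gcont_c have "\<forall>\<^sub>F w in at ?c within strip. K 1 (g w - g ?c) < 1"
      unfolding S.vlim_def by (rule order_tendstoD) simp
    then obtain e where e: "e > 0" "\<And>w. w \<in> strip \<Longrightarrow> w \<noteq> ?c \<Longrightarrow> dist w ?c < e \<Longrightarrow> K 1 (g w - g ?c) < 1"
      unfolding eventually_at by blast
    have "K 1 (g z) \<le> max (K 1 (g ?c) + 1) (B / e)" if z: "z \<in> strip" for z
    proof (cases "z = ?c \<or> dist z ?c < e")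
      case True
      then have "K 1 (g z - g ?c) < 1" using e(2)[OF z] by (cases "z = ?c") auto
      then have "K 1 (g z) \<le> K 1 (g ?c) + 1"
        using S.N_triangle[of "g z - g ?c" "g ?c"] gmem[OF z] gmem[OF cs] S.mem_diff by fastforce
      then show ?thesis by simp
    next
      case False
      then have "cmod (z - ?c) \<ge> e" "z \<noteq> ?c" by (auto simp: dist_norm)
      then have "K 1 (g z) = K 1 (f z) / cmod (z - ?c)"
        by (simp add: g_def a_def S.N_scale[OF calF_mem[OF fc z]] norm_inverse divide_inverse mult.commute)
      also have "\<dots> \<le> B / e"
        using B[OF z] B0 \<open>cmod (z - ?c) \<ge> e\<close> e by (intro frac_le) auto
      finally show ?thesis by simp
    qed
    then show thesis using that by blast
  qed
  have hol_a: "a holomorphic_on - {?c}"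
    unfolding a_def by (intro holomorphic_intros) auto
  have gderiv: "\<exists>D\<in>sumsp X. S.vlim (dquot g z) D (at 0)" if z: "z \<in> ostrip" for z
  proof (cases "z = ?c")
    case False
    obtain E where E: "E \<in> sumsp X" "S.vlim (dquot f z) E (at 0)" using calF_deriv[OF fc z] by blast
    obtain a' where a': "(a has_field_derivative a') (at z)"
      using holomorphic_on_imp_differentiable_at[OF hol_a] False by (auto simp: field_differentiable_def)
    let ?E = "sc X (a z) E + sc X a' (f z)"
    have "?E \<in> sumsp X"
      using z ostrip_subset by (intro S.mem_add S.mem_scale E calF_mem fc) auto
    moreover have "S.vlim (dquot g z) ?E (at 0)"
    proof (rule S.vlim_cong[OF _ dquot_scale[OF calF_mems[OF fc] z a' E]])
      have "\<forall>\<^sub>F h in at 0. z + h \<noteq> ?c"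
      proof -
        have "((\<lambda>h. z + h) \<longlongrightarrow> z + 0) (at 0)" by (intro tendsto_intros)
        then show ?thesis
          using topological_tendstoD[of "\<lambda>h. z + h" "z + 0" "at 0" "- {?c}"] False by auto
      qed
      then show "\<forall>\<^sub>F h in at 0. dquot (\<lambda>z. sc X (a z) (f z)) z h = dquot g z h"
        by (rule eventually_mono) (simp add: g_def False)
    qed
    ultimately show ?thesis by blast
  next
    case True
    have sub: "ball ?c d \<subseteq> ostrip"
    proof
      fix w assume "w \<in> ball ?c d"
      then have "\<bar>Re w - c\<bar> < d"
        using abs_Re_le_cmod[of "w - ?c"] by (auto simp: dist_norm norm_minus_commute)
      then show "w \<in> ostrip" by (auto simp: ostrip_def d_def)
    qed
    \<comment> \<open>Composed with l the quotient is the classical removable extension, since l D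
      is the derivative of l (f z) at c.\<close>
    have hol: "(\<lambda>z. l (g z)) holomorphic_on ball ?c d" if l: "S.cfunctional l" for l
    proof -
      have l0: "l 0 = 0" using S.cf_scale[OF l S.mem_zero, of 0] by simp
      have "(\<lambda>z. l (f z)) holomorphic_on ball ?c d"
        by (rule holomorphic_on_subset[OF functional_holomorphic[OF l fc] sub])
      from pole_lemma[OF this, of ?c] d
      have "(\<lambda>z. if z = ?c then deriv (\<lambda>z. l (f z)) ?c else (l (f z) - l (f ?c)) / (z - ?c))
        holomorphic_on ball ?c d" by simp
      moreover have "deriv (\<lambda>z. l (f z)) ?c = l D"
        by (rule DERIV_imp_deriv[OF functional_has_derivative[OF l calF_mems[OF fc] co D]])
      ultimately have 1: "(\<lambda>z. if z = ?c then l D else (l (f z) - l (f ?c)) / (z - ?c))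
        holomorphic_on ball ?c d" by (simp cong: if_cong)
      have 2: "l (g z) = (if z = ?c then l D else (l (f z) - l (f ?c)) / (z - ?c))"
        if "z \<in> ball ?c d" for z
      proof -
        have "z \<in> strip" using that sub ostrip_subset by auto
        then show ?thesis
          using f0 l0 by (simp add: g_def a_def S.cf_scale[OF l] calF_mem fc divide_inverse mult.commute)
      qed
      show ?thesis by (rule holomorphic_transform[OF 1 2[symmetric]])
    qed
    show ?thesis
      unfolding True by (rule weakly_holomorphic_differentiable[OF d sub]) (auto intro: gmem B' hol)
  qed
  have bd: "f (Complex b t) = sc X (Complex b t - ?c) (g (Complex b t))"
    "g (Complex b t) = sc X (a (Complex b t)) (f (Complex b t))"
    "cmod (a (Complex b t)) \<le> 1 / d" if "b = 0 \<or> b = 1" for b t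
  proof -
    have ge: "d \<le> cmod (Complex b t - ?c)"
      using abs_Re_le_cmod[of "Complex b t - ?c"] that c by (auto simp: d_def)
    then have "Complex b t \<noteq> ?c" using d by auto
    then show "f (Complex b t) = sc X (Complex b t - ?c) (g (Complex b t))"
      "g (Complex b t) = sc X (a (Complex b t)) (f (Complex b t))"
      by (auto simp: g_def a_def)
    show "cmod (a (Complex b t)) \<le> 1 / d"
      using ge d by (simp add: a_def inverse_eq_divide norm_divide frac_le)
  qed
  have M: "0 \<le> M" using FB_nonneg[OF f] .
  have b0: "nm0 X (g (Complex 0 t)) \<le> M / d" for t
  proof -
    have "nm0 X (g (Complex 0 t)) = cmod (a (Complex 0 t)) * nm0 X (f (Complex 0 t))"
      using bd(2)[of 0 t] Z0.N_scale[OF calF_mem0[OF fc]] by simp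
    also have "\<dots> \<le> 1 / d * M"
      using bd(3)[of 0 t] FB_0[OF f, of t] d M by (intro mult_mono) (auto intro: Z0.N_nonneg calF_mem0 fc)
    finally show ?thesis by simp
  qed
  have b1: "nm1 X (g (Complex 1 t)) \<le> M / d" for t
  proof -
    have "nm1 X (g (Complex 1 t)) = cmod (a (Complex 1 t)) * nm1 X (f (Complex 1 t))"
      using bd(2)[of 1 t] Z1.N_scale[OF calF_mem1[OF fc]] by simp
    also have "\<dots> \<le> 1 / d * M"
      using bd(3)[of 1 t] FB_1[OF f, of t] d M by (intro mult_mono) (auto intro: Z1.N_nonneg calF_mem1 fc)
    finally show ?thesis by simp
  qed
  have lima: "((\<lambda>s. a (Complex b s)) \<longlongrightarrow> a (Complex b t)) (at t)" if "b = 0 \<or> b = 1" for b t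
  proof -
    have "Complex b t \<noteq> ?c" using that c by (auto simp: complex_eq_iff)
    moreover have "((\<lambda>s. Complex b s) \<longlongrightarrow> Complex b t) (at t)"
      unfolding Complex_eq by (intro tendsto_intros)
    ultimately show ?thesis unfolding a_def by (intro tendsto_intros) auto
  qed
  have "g \<in> calF X"
    unfolding calF_iff
  proof (intro conjI ballI allI)
    show "\<exists>B. \<forall>z\<in>strip. K 1 (g z) \<le> B" using B' by blast
    show "\<exists>B. \<forall>t. nm0 X (g (Complex 0 t)) \<le> B" "\<exists>B. \<forall>t. nm1 X (g (Complex 1 t)) \<le> B"
      using b0 b1 by blast+
    show "g (Complex 0 t) \<in> sp0 X" "g (Complex 1 t) \<in> sp1 X" for t
      using bd(2)[of 0 t] bd(2)[of 1 t] Z0.mem_scale[OF calF_mem0[OF fc]] Z1.mem_scale[OF calF_mem1[OF fc]]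
      by simp_all
    show "Z0.vlim (\<lambda>s. g (Complex 0 s)) (g (Complex 0 t)) (at t)" for t
      unfolding bd(2)[OF disjI1[OF refl]]
      by (intro Z0.vlim_scale lima calF_cont0 fc calF_mem0 always_eventually allI) simp
    show "Z1.vlim (\<lambda>s. g (Complex 1 s)) (g (Complex 1 t)) (at t)" for t
      unfolding bd(2)[OF disjI2[OF refl]]
      by (intro Z1.vlim_scale lima calF_cont1 fc calF_mem1 always_eventually allI) simp
  qed (use gmem gcont gderiv in auto)
  then have "FB g (M / min c (1 - c))" using b0 b1 by (simp add: FB_def d_def)
  moreover have "f z = sc X (z - ?c) (g z)" for z
    using f0 by (simp add: g_def a_def)
  ultimately show thesis using that by blast
qed

lemma cinterp_norm_le:
  assumes "FB f M"
  shows "f (complex_of_real c) \<in> cinterp_space X c" "cinterp_norm X c (f (complex_of_real c)) \<le> M"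
proof -
  show "f (complex_of_real c) \<in> cinterp_space X c"
    using FB_calF[OF assms] by (auto simp: cinterp_space_def)
  have F: "Fnorm X f \<le> M"
    unfolding Fnorm_def using FB_0[OF assms] FB_1[OF assms] by (auto intro!: cSUP_least)
  have "0 \<le> Fnorm X g" if g: "g \<in> calF X" for g
  proof -
    obtain B where "\<And>t. nm0 X (g (Complex 0 t)) \<le> B" using calF_bdd0[OF g] by blast
    then have "nm0 X (g (Complex 0 0)) \<le> (SUP t. nm0 X (g (Complex 0 t)))"
      by (intro cSUP_upper) (auto simp: bdd_above_def)
    then show ?thesis
      using Z0.N_nonneg[OF calF_mem0[OF g], of 0] by (simp add: Fnorm_def)
  qed
  then have "bdd_below {Fnorm X g |g. g \<in> calF X \<and> g (complex_of_real c) = f (complex_of_real c)}"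
    by (intro bdd_belowI[of _ 0]) auto
  then have "cinterp_norm X c (f (complex_of_real c)) \<le> Fnorm X f"
    unfolding cinterp_norm_def using FB_calF[OF assms] by (intro cInf_lower) auto
  then show "cinterp_norm X c (f (complex_of_real c)) \<le> M" using F by simp
qed

text \<open>The strict inequality provides a representative although the infimum need not be
  attained.\<close>

lemma cinterp_norm_less:
  assumes "x \<in> cinterp_space X c" "cinterp_norm X c x < M"
  obtains f where "FB f M" "f (complex_of_real c) = x"
proof -
  have "{Fnorm X g |g. g \<in> calF X \<and> g (complex_of_real c) = x} \<noteq> {}"
    using assms(1) by (auto simp: cinterp_space_def)
  from cInf_lessD[OF this assms(2)[unfolded cinterp_norm_def]]
  obtain f where f: "f \<in> calF X" "f (complex_of_real c) = x" "Fnorm X f < M" by blast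
  obtain A B where "\<And>t. nm0 X (f (Complex 0 t)) \<le> A" "\<And>t. nm1 X (f (Complex 1 t)) \<le> B"
    using calF_bdd0[OF f(1)] calF_bdd1[OF f(1)] by blast
  then have "bdd_above (range (\<lambda>t. nm0 X (f (Complex 0 t))))" "bdd_above (range (\<lambda>t. nm1 X (f (Complex 1 t))))"
    by (auto simp: bdd_above_def)
  then have "nm0 X (f (Complex 0 t)) \<le> Fnorm X f" "nm1 X (f (Complex 1 t)) \<le> Fnorm X f" for t
    unfolding Fnorm_def by (meson cSUP_upper max.coboundedI1 max.coboundedI2 UNIV_I)+
  then have "FB f M"
    unfolding FB_def using f by (meson less_imp_le order_trans)
  then show ?thesis using that f by blast
qed

end

context bcpl
begin

text \<open>The three lines bound at t = 1, where the power of t is 1. It converts smallness in the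
  complex space into smallness in the sum space, on which the functionals act.\<close>

lemma K_le_cinterp_norm:
  assumes x: "x \<in> cinterp_space X c" and c: "0 < c" "c < 1"
  shows "K 1 x \<le> cinterp_norm X c x"
proof (rule dense_ge)
  fix M assume "cinterp_norm X c x < M"
  from cinterp_norm_less[OF x this] obtain f where f: "FB f M" "f (complex_of_real c) = x" by metis
  show "K 1 x \<le> M"
    using K_calF_le[OF f(1), of "complex_of_real c" 1] c f(2) by (simp add: strip_def)
qed

end

section \<open>Operators between couples\<close>

locale bop = X: bcpl X + Y: bcpl Y
  for X :: "'v::ab_group_add bcouple" and Y :: "'w::ab_group_add bcouple" +
  fixes T :: "'v \<Rightarrow> 'w" and C :: real
  assumes op: "couple_operator X Y T" and C: "C > 0"
    and T0: "\<And>x. x \<in> sp0 X \<Longrightarrow> nm0 Y (T x) \<le> C * nm0 X x"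
    and T1: "\<And>x. x \<in> sp1 X \<Longrightarrow> nm1 Y (T x) \<le> C * nm1 X x"
begin

lemma T_add: "x \<in> sumsp X \<Longrightarrow> y \<in> sumsp X \<Longrightarrow> T (x + y) = T x + T y"
  and T_scale: "x \<in> sumsp X \<Longrightarrow> T (sc X c x) = sc Y c (T x)"
  and T_mem0: "x \<in> sp0 X \<Longrightarrow> T x \<in> sp0 Y" and T_mem1: "x \<in> sp1 X \<Longrightarrow> T x \<in> sp1 Y"
  using op by (auto simp: couple_operator_def)

lemma T_diff: "x \<in> sumsp X \<Longrightarrow> y \<in> sumsp X \<Longrightarrow> T (x - y) = T x - T y"
  using T_add[of "x - y" y] X.S.mem_diff by simp

lemma T_zero: "T 0 = 0"
  using T_diff[OF X.S.mem_zero X.S.mem_zero] by simp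

lemma T_mem: "x \<in> sumsp X \<Longrightarrow> T x \<in> sumsp Y"
  unfolding sumsp_def[of X] using T_add T_mem0 T_mem1 X.sumsp0 X.sumsp1 Y.sumspI by fastforce

lemma T_K:
  assumes x: "x \<in> sumsp X" and t: "0 < t"
  shows "Y.K t (T x) \<le> C * X.K t x"
proof (rule field_le_epsilon)
  fix e :: real assume e: "e > 0"
  have "X.K t x < X.K t x + e / C" using e C by simp
  from X.K_decomp[OF x this] obtain a b where
    ab: "a \<in> sp0 X" "b \<in> sp1 X" "x = a + b" "nm0 X a + t * nm1 X b < X.K t x + e / C" by metis
  have "Y.K t (T x) = Y.K t (T a + T b)"
    using ab T_add X.sumsp0 X.sumsp1 by simp
  also have "\<dots> \<le> nm0 Y (T a) + t * nm1 Y (T b)"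
    using ab t by (intro Y.K_le T_mem0 T_mem1) auto
  also have "\<dots> \<le> C * nm0 X a + t * (C * nm1 X b)"
    using ab t by (intro add_mono mult_left_mono T0 T1) auto
  also have "\<dots> = C * (nm0 X a + t * nm1 X b)" by (simp add: algebra_simps)
  also have "\<dots> \<le> C * (X.K t x + e / C)" using ab(4) C by (intro mult_left_mono) auto
  also have "\<dots> = C * X.K t x + e" using C by (simp add: algebra_simps)
  finally show "Y.K t (T x) \<le> C * X.K t x + e" .
qed

lemma T_vlim:
  assumes "X.S.vlim f l F" "\<forall>\<^sub>F w in F. f w \<in> sumsp X" "l \<in> sumsp X"
  shows "Y.S.vlim (\<lambda>w. T (f w)) (T l) F"
proof (rule Y.S.vlimI[where g = "\<lambda>w. C * X.K 1 (f w - l)"])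
  show "\<forall>\<^sub>F w in F. T (f w) \<in> sumsp Y" using assms(2) by (rule eventually_mono) (rule T_mem)
  show "\<forall>\<^sub>F w in F. Y.K 1 (T (f w) - T l) \<le> C * X.K 1 (f w - l)"
    using assms(2)
  proof (rule eventually_mono)
    fix w assume "f w \<in> sumsp X"
    then show "Y.K 1 (T (f w) - T l) \<le> C * X.K 1 (f w - l)"
      using T_K[of "f w - l" 1] T_diff[of "f w" l] assms(3) X.S.mem_diff by simp
  qed
  show "((\<lambda>w. C * X.K 1 (f w - l)) \<longlongrightarrow> 0) F"
    using tendsto_mult_left[OF assms(1)[unfolded X.S.vlim_def], of C] by simp
qed (use assms T_mem in auto)

lemma T_FB:
  assumes f: "X.FB f M"
  shows "Y.FB (\<lambda>z. T (f z)) (C * M)"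
proof -
  note fc = X.FB_calF[OF f]
  have b0: "nm0 Y (T (f (Complex 0 t))) \<le> C * M" for t
    using T0[OF X.calF_mem0[OF fc], of t] mult_left_mono[OF X.FB_0[OF f, of t], of C] C by linarith
  have b1: "nm1 Y (T (f (Complex 1 t))) \<le> C * M" for t
    using T1[OF X.calF_mem1[OF fc], of t] mult_left_mono[OF X.FB_1[OF f, of t], of C] C by linarith
  have evs: "\<forall>\<^sub>F w in at z within strip. w \<in> strip" for z by (simp add: eventually_at_filter)
  have "(\<lambda>z. T (f z)) \<in> calF Y"
    unfolding Y.calF_iff
  proof (intro conjI ballI allI)
    obtain B where B: "\<And>z. z \<in> strip \<Longrightarrow> X.K 1 (f z) \<le> B" using X.calF_bdd[OF fc] by blast
    have "Y.K 1 (T (f z)) \<le> C * B" if "z \<in> strip" for z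
      using T_K[OF X.calF_mem[OF fc that], of 1] mult_left_mono[OF B[OF that], of C] C by linarith
    then show "\<exists>B. \<forall>z\<in>strip. Y.K 1 (T (f z)) \<le> B" by blast
    show "\<exists>B. \<forall>t. nm0 Y (T (f (Complex 0 t))) \<le> B" "\<exists>B. \<forall>t. nm1 Y (T (f (Complex 1 t))) \<le> B"
      using b0 b1 by blast+
    show "T (f z) \<in> sumsp Y" if "z \<in> strip" for z
      by (rule T_mem[OF X.calF_mem[OF fc that]])
    show "T (f (Complex 0 t)) \<in> sp0 Y" "T (f (Complex 1 t)) \<in> sp1 Y" for t
      by (rule T_mem0[OF X.calF_mem0[OF fc]] T_mem1[OF X.calF_mem1[OF fc]])+
    show "Y.S.vlim (\<lambda>z. T (f z)) (T (f z)) (at z within strip)" if z: "z \<in> strip" for z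
      by (rule T_vlim[OF X.calF_cont[OF fc z] eventually_mono[OF evs X.calF_mem[OF fc]] X.calF_mem[OF fc z]])
    show "\<exists>D\<in>sumsp Y. Y.S.vlim (Y.dquot (\<lambda>z. T (f z)) z) D (at 0)" if z: "z \<in> ostrip" for z
    proof -
      obtain D where D: "D \<in> sumsp X" "X.S.vlim (X.dquot f z) D (at 0)"
        using X.calF_deriv[OF fc z] by blast
      have fz: "f z \<in> sumsp X" using X.calF_mem[OF fc] z ostrip_subset by auto
      have "Y.S.vlim (\<lambda>h. T (X.dquot f z h)) (T D) (at 0)"
        by (rule T_vlim[OF D(2) X.eventually_dquot_mem[OF X.calF_mems[OF fc] z] D(1)])
      moreover have "\<forall>\<^sub>F h in at 0. T (X.dquot f z h) = Y.dquot (\<lambda>z. T (f z)) z h"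
        using X.eventually_ostrip[OF z]
      proof (rule eventually_mono)
        fix h assume "z + h \<in> ostrip"
        then have "f (z + h) \<in> sumsp X" using X.calF_mem[OF fc] ostrip_subset by auto
        then show "T (X.dquot f z h) = Y.dquot (\<lambda>z. T (f z)) z h"
          using fz by (simp add: T_scale T_diff X.S.mem_diff)
      qed
      ultimately have "Y.S.vlim (Y.dquot (\<lambda>z. T (f z)) z) (T D) (at 0)"
        by (rule Y.S.vlim_cong[rotated])
      then show ?thesis using T_mem[OF D(1)] by blast
    qed
    show "Y.Z0.vlim (\<lambda>s. T (f (Complex 0 s))) (T (f (Complex 0 t))) (at t)" for t
    proof (rule Y.Z0.vlimI[where g = "\<lambda>s. C * nm0 X (f (Complex 0 s) - f (Complex 0 t))"])
      have "nm0 Y (T (f (Complex 0 s)) - T (f (Complex 0 t))) \<le> C * nm0 X (f (Complex 0 s) - f (Complex 0 t))" for s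
        using T0[OF X.Z0.mem_diff[OF X.calF_mem0[OF fc] X.calF_mem0[OF fc]], of s t]
          T_diff[of "f (Complex 0 s)" "f (Complex 0 t)"] X.calF_mem[OF fc] by simp
      then show "\<forall>\<^sub>F s in at t. nm0 Y (T (f (Complex 0 s)) - T (f (Complex 0 t))) \<le> C * nm0 X (f (Complex 0 s) - f (Complex 0 t))"
        by simp
      show "((\<lambda>s. C * nm0 X (f (Complex 0 s) - f (Complex 0 t))) \<longlongrightarrow> 0) (at t)"
        using tendsto_mult_left[OF X.calF_cont0[OF fc, unfolded X.Z0.vlim_def], of C t] by simp
    qed (auto intro!: always_eventually T_mem0 X.calF_mem0 fc)
    show "Y.Z1.vlim (\<lambda>s. T (f (Complex 1 s))) (T (f (Complex 1 t))) (at t)" for t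
    proof (rule Y.Z1.vlimI[where g = "\<lambda>s. C * nm1 X (f (Complex 1 s) - f (Complex 1 t))"])
      have "nm1 Y (T (f (Complex 1 s)) - T (f (Complex 1 t))) \<le> C * nm1 X (f (Complex 1 s) - f (Complex 1 t))" for s
        using T1[OF X.Z1.mem_diff[OF X.calF_mem1[OF fc] X.calF_mem1[OF fc]], of s t]
          T_diff[of "f (Complex 1 s)" "f (Complex 1 t)"] X.calF_mem[OF fc] by simp
      then show "\<forall>\<^sub>F s in at t. nm1 Y (T (f (Complex 1 s)) - T (f (Complex 1 t))) \<le> C * nm1 X (f (Complex 1 s) - f (Complex 1 t))"
        by simp
      show "((\<lambda>s. C * nm1 X (f (Complex 1 s) - f (Complex 1 t))) \<longlongrightarrow> 0) (at t)"
        using tendsto_mult_left[OF X.calF_cont1[OF fc, unfolded X.Z1.vlim_def], of C t] by simp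
    qed (auto intro!: always_eventually T_mem1 X.calF_mem1 fc)
  qed
  then show ?thesis using b0 b1 by (simp add: Y.FB_def)
qed

end

section \<open>Inverse estimates near the given parameter\<close>

locale binv = bop X Y T C
  for X :: "'v::ab_group_add bcouple" and Y :: "'w::ab_group_add bcouple" and T C +
  fixes \<theta> A :: real
  assumes th: "0 < \<theta>" "\<theta> < 1" and A: "A > 0"
    and bij: "bij_betw T (cinterp_space X \<theta>) (cinterp_space Y \<theta>)"
    and inv_bound: "\<And>x. x \<in> cinterp_space X \<theta> \<Longrightarrow> cinterp_norm X \<theta> x \<le> A * cinterp_norm Y \<theta> (T x)"
begin

abbreviation "\<theta>c \<equiv> complex_of_real \<theta>"

text \<open>The cost of one correction: g - T f has boundary norm at most M + C (A + 1) M, and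
  division by z - \<theta> costs 1 / min \<theta> (1 - \<theta>).\<close>

definition R :: real where "R = (1 + C * (A + 1)) / min \<theta> (1 - \<theta>)"

lemma R_pos: "0 < R"
  unfolding R_def using C A th by (intro divide_pos_pos add_pos_pos mult_pos_pos) auto

text \<open>A + 1 replaces A because the infimum in the complex norm need not be attained; M > 0
  provides the strict inequality.\<close>

lemma lift_calF:
  assumes g: "Y.FB g M" and M: "M > 0"
  obtains f where "X.FB f ((A + 1) * M)" "T (f \<theta>c) = g \<theta>c"
proof -
  have g1: "g \<theta>c \<in> cinterp_space Y \<theta>" "cinterp_norm Y \<theta> (g \<theta>c) \<le> M"
    by (rule Y.cinterp_norm_le[OF g])+
  then obtain x where x: "x \<in> cinterp_space X \<theta>" "T x = g \<theta>c"
    using bij unfolding bij_betw_def by (metis imageE)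
  have "cinterp_norm X \<theta> x \<le> A * M"
    using inv_bound[OF x(1)] mult_left_mono[OF g1(2), of A] A unfolding x(2) by linarith
  also have "\<dots> < (A + 1) * M" using M by (simp add: algebra_simps)
  finally show ?thesis using X.cinterp_norm_less[OF x(1)] x(2) that by metis
qed

lemma calF_step:
  assumes g: "Y.FB g M" and M: "M > 0"
  shows "\<exists>f g'. X.FB f ((A + 1) * M) \<and> Y.FB g' (R * M) \<and>
    (\<forall>z\<in>strip. g z = T (f z) + sc Y (z - \<theta>c) (g' z))"
proof -
  obtain f where f: "X.FB f ((A + 1) * M)" "T (f \<theta>c) = g \<theta>c" using lift_calF[OF g M] by metis
  have "Y.FB (\<lambda>z. sc Y (-1) (T (f z))) (cmod (-1) * (C * ((A + 1) * M)))"
    by (intro Y.FB_scale_const T_FB f)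
  then have "Y.FB (\<lambda>z. g z + sc Y (-1) (T (f z))) (M + cmod (-1) * (C * ((A + 1) * M)))"
    by (rule Y.FB_add[OF g])
  then have d: "Y.FB (\<lambda>z. g z - T (f z)) (M + C * ((A + 1) * M))" by simp
  have R: "(M + C * ((A + 1) * M)) / min \<theta> (1 - \<theta>) = R * M"
    by (simp add: R_def add_divide_distrib distrib_right)
  obtain g' where g': "Y.FB g' (R * M)" "\<And>z. z \<in> strip \<Longrightarrow> g z - T (f z) = sc Y (z - \<theta>c) (g' z)"
    using Y.calF_divide[OF d th] f(2) unfolding R by (metis diff_self)
  have "g z = T (f z) + sc Y (z - \<theta>c) (g' z)" if "z \<in> strip" for z
    using g'(2)[OF that] by (metis add.commute diff_add_cancel)
  then show ?thesis using f(1) g'(1) by blast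
qed

text \<open>The expansion is kept finite, with remainder (z - \<theta>)^N g_N(z): in this form it is
  an identity on the whole strip, free of any convergence. The growth R^n of the constants is paid
  for later by |z - \<theta>|^n.\<close>

lemma iterate_step:
  assumes g0: "Y.FB g0 M" and M: "M > 0"
  obtains f g where "\<And>n. X.FB (f n) ((A + 1) * R ^ n * M)" "\<And>n. Y.FB (g n) (R ^ n * M)"
    "\<And>N z. z \<in> strip \<Longrightarrow>
       g0 z = T (\<Sum>n<N. sc X ((z - \<theta>c) ^ n) (f n z)) + sc Y ((z - \<theta>c) ^ N) (g N z)"
proof -
  define Q where "Q n g g' f \<longleftrightarrow> X.FB f ((A + 1) * R ^ n * M) \<and>
    (\<forall>z\<in>strip. g z = T (f z) + sc Y (z - \<theta>c) (g' z))" for n :: nat and g g' f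
  \<comment> \<open>Dependent choice runs over the g alone; the clause for n = 0 pins the start, and
    the f are picked afterwards for consecutive pairs.\<close>
  have "\<exists>g. \<forall>n. (Y.FB (g n) (R ^ n * M) \<and> (n = 0 \<longrightarrow> g n = g0)) \<and> (\<exists>f. Q n (g n) (g (Suc n)) f)"
  proof (rule dependent_nat_choice)
    show "\<exists>x. Y.FB x (R ^ 0 * M) \<and> (0 = (0::nat) \<longrightarrow> x = g0)" using g0 by auto
    fix g and n :: nat assume "Y.FB g (R ^ n * M) \<and> (n = 0 \<longrightarrow> g = g0)"
    then have "Y.FB g (R ^ n * M)" "0 < R ^ n * M" using M R_pos by auto
    from calF_step[OF this] show "\<exists>g'. (Y.FB g' (R ^ Suc n * M) \<and> (Suc n = 0 \<longrightarrow> g' = g0)) \<and> (\<exists>f. Q n g g' f)"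
      by (auto simp: Q_def mult.assoc)
  qed
  then obtain g where g: "\<And>n. Y.FB (g n) (R ^ n * M)" "g 0 = g0"
    "\<And>n. \<exists>f. Q n (g n) (g (Suc n)) f" by auto
  from g(3) obtain f where f: "\<And>n. Q n (g n) (g (Suc n)) (f n)" by metis
  have fB: "X.FB (f n) ((A + 1) * R ^ n * M)" for n using f by (simp add: Q_def)
  have "g0 z = T (\<Sum>n<N. sc X ((z - \<theta>c) ^ n) (f n z)) + sc Y ((z - \<theta>c) ^ N) (g N z)"
    if z: "z \<in> strip" for N z
  proof (induction N)
    case 0
    then show ?case using g(2) by (simp add: T_zero)
  next
    case (Suc N)
    have fm: "f n z \<in> sumsp X" for n using X.calF_mem[OF X.FB_calF[OF fB] z] .
    have "g N z = T (f N z) + sc Y (z - \<theta>c) (g (Suc N) z)"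
      using f[of N] z by (simp add: Q_def)
    then have "sc Y ((z - \<theta>c) ^ N) (g N z)
        = T (sc X ((z - \<theta>c) ^ N) (f N z)) + sc Y ((z - \<theta>c) ^ Suc N) (g (Suc N) z)"
      by (simp add: Y.scale_right_distrib T_scale fm mult.commute)
    with Suc show ?case
      by (simp add: T_add X.S.mem_sum X.S.mem_scale fm add.assoc)
  qed
  then show ?thesis using that fB g(1) by blast
qed

text \<open>The first term keeps the disc inside the open strip; the second makes |z - \<theta>| R
  at most 1/2, so that the n-th term of the series decays like (1/2)^n.\<close>

definition \<rho> :: real where "\<rho> = min (min \<theta> (1 - \<theta>)) (1 / (2 * R))"

lemma rho_pos: "0 < \<rho>"
  using th R_pos by (simp add: \<rho>_def)

lemma ball_rho: "ball \<theta>c \<rho> \<subseteq> ostrip"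
proof
  fix w assume "w \<in> ball \<theta>c \<rho>"
  then have "\<bar>Re w - \<theta>\<bar> < \<rho>"
    using abs_Re_le_cmod[of "w - \<theta>c"] by (auto simp: dist_norm norm_minus_commute)
  then show "w \<in> ostrip" by (auto simp: ostrip_def \<rho>_def)
qed

lemma rho_R: "r < \<rho> \<Longrightarrow> 0 \<le> r \<Longrightarrow> r ^ n * R ^ n \<le> (1/2) ^ n"
proof -
  assume r: "r < \<rho>" "0 \<le> r"
  then have "r \<le> 1 / (2 * R)" by (simp add: \<rho>_def)
  then have "r * R \<le> 1/2" using R_pos by (simp add: field_simps)
  then show ?thesis
    unfolding power_mult_distrib[symmetric] using r R_pos by (intro power_mono) auto
qed

text \<open>On the vertical line through \<open>\<theta>\<close> the corrected function lies in the complex interpolation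
  space at \<open>\<theta>\<close>, where \<open>T\<close> is injective; hence the partial sums converge there to
  \<open>s\<^bsup>z - \<theta>\<^esup> x\<close>, and the identity theorem carries this to the neighbouring real parameters.\<close>

lemma line_estimate:
  assumes fB: "\<And>n. X.FB (f n) ((A + 1) * R ^ n * M)" and gB: "\<And>n. Y.FB (g n) (R ^ n * M)"
    and id: "\<And>N z. z \<in> strip \<Longrightarrow>
       sc Y (e z) y = T (\<Sum>n<N. sc X ((z - \<theta>c) ^ n) (f n z)) + sc Y ((z - \<theta>c) ^ N) (g N z)"
    and x: "x \<in> cinterp_space X \<theta>" "T x = y"
  shows "X.K 1 (sc X (e (\<theta>c + Complex 0 r)) x
      - (\<Sum>n<N. sc X (Complex 0 r ^ n) (f n (\<theta>c + Complex 0 r)))) \<le> A * (\<bar>r\<bar> ^ N * (R ^ N * M))"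
proof -
  let ?z = "\<theta>c + Complex 0 r"
  have zs: "?z \<in> strip" and ths: "\<theta>c \<in> strip" using th by (auto simp: strip_def)
  obtain fx where fx: "X.FB fx (cinterp_norm X \<theta> x + 1)" "fx \<theta>c = x"
    using X.cinterp_norm_less[OF x(1), of "cinterp_norm X \<theta> x + 1"] by auto
  define w where "w = sc X (e ?z) x - (\<Sum>n<N. sc X (Complex 0 r ^ n) (f n ?z))"
  have xm: "x \<in> sumsp X" using X.calF_mem[OF X.FB_calF[OF fx(1)] ths] fx(2) by simp
  have fm: "f n ?z \<in> sumsp X" for n using X.calF_mem[OF X.FB_calF[OF fB] zs] .
  \<comment> \<open>With z - \<theta> = ir frozen the coefficients are constants, and the translate
    of f n by ir is again a Calderon function; so w is the value at \<theta> of such a function,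
    with \<open>fx\<close> representing x.\<close>
  have "\<exists>B. X.FB (\<lambda>z. sc X (e ?z) (fx z) - (\<Sum>n<N. sc X (Complex 0 r ^ n) (f n (z + Complex 0 r)))) B"
  proof (induction N)
    case 0
    then show ?case using X.FB_scale_const[OF fx(1), of "e ?z"] by auto
  next
    case (Suc N)
    then obtain B where B: "X.FB (\<lambda>z. sc X (e ?z) (fx z) - (\<Sum>n<N. sc X (Complex 0 r ^ n) (f n (z + Complex 0 r)))) B"
      by blast
    from X.FB_add[OF B X.FB_scale_const[OF X.FB_translate[OF fB[of N]], of "- (Complex 0 r ^ N)"]]
    show ?case by (auto simp: algebra_simps)
  qed
  then have wc: "w \<in> cinterp_space X \<theta>"
    using X.cinterp_norm_le(1)[of "\<lambda>z. sc X (e ?z) (fx z) - (\<Sum>n<N. sc X (Complex 0 r ^ n) (f n (z + Complex 0 r)))" _ \<theta>]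
      fx(2) by (auto simp: w_def)
  \<comment> \<open>Applying T leaves exactly the remainder, which is likewise a value at \<theta>
    of a translated Calderon function, now for Y.\<close>
  have "T w = sc Y (e ?z) y - T (\<Sum>n<N. sc X (Complex 0 r ^ n) (f n ?z))"
    unfolding w_def using x(2) xm fm
    by (simp add: T_diff T_scale X.S.mem_scale X.S.mem_sum)
  also have "\<dots> = sc Y (Complex 0 r ^ N) (g N ?z)"
    using id[OF zs, of N] by simp
  finally have Tw: "T w = sc Y (Complex 0 r ^ N) (g N ?z)" .
  have "cmod (Complex 0 r) = \<bar>r\<bar>" by (simp add: cmod_def)
  then have "Y.FB (\<lambda>z. sc Y (Complex 0 r ^ N) (g N (z + Complex 0 r))) (\<bar>r\<bar> ^ N * (R ^ N * M))"
    using Y.FB_scale_const[OF Y.FB_translate[OF gB[of N]], of "Complex 0 r ^ N" r]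
    by (simp add: norm_power)
  from Y.cinterp_norm_le(2)[OF this, of \<theta>]
  have "cinterp_norm Y \<theta> (T w) \<le> \<bar>r\<bar> ^ N * (R ^ N * M)" by (simp add: Tw)
  then have "A * cinterp_norm Y \<theta> (T w) \<le> A * (\<bar>r\<bar> ^ N * (R ^ N * M))"
    using A by (intro mult_left_mono) auto
  then show ?thesis
    using X.K_le_cinterp_norm[OF wc th] inv_bound[OF wc] unfolding w_def by linarith
qed

text \<open>M bounds s^(z - \<theta>) y on both edges. The series at \<theta>' is evaluated in two
  ways: the identity theorem gives its value s^(\<theta>' - \<theta>) l x, and summing the terms
  gives its size. The factor 2 is the sum of the powers of 1/2, A + 1 stems from the lifting, and
  t^\<theta>' from \<open>K_calF_le\<close>.\<close>

theorem inverse_K_estimate: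
  assumes y: "y \<in> sp0 Y" "y \<in> sp1 Y" and s: "0 < s" and M: "0 < M"
    and y0: "s powr (- \<theta>) * nm0 Y y \<le> M" and y1: "s powr (1 - \<theta>) * nm1 Y y \<le> M"
    and x: "x \<in> cinterp_space X \<theta>" "T x = y" and th': "\<bar>\<theta>' - \<theta>\<bar> < \<rho>" and t: "0 < t"
  shows "X.K t x \<le> 2 * (A + 1) * M * t powr \<theta>' * s powr (\<theta> - \<theta>')"
proof -
  define e where "e z = exp ((z - \<theta>c) * of_real (ln s))" for z
  have ne: "cmod (e z) = s powr (Re z - \<theta>)" for z
    using s by (simp add: e_def norm_exp_eq_Re powr_def mult.commute)
  have "(\<lambda>z. sc Y (e z) y) \<in> calF Y"
  proof (rule Y.calF_scale[OF Y.calF_const[OF y]])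
    show "continuous_on strip e" "e holomorphic_on ostrip"
      unfolding e_def by (intro continuous_intros holomorphic_intros)+
    show "cmod (e z) \<le> exp \<bar>ln s\<bar>" if z: "z \<in> strip" for z
    proof -
      have "(Re z - \<theta>) * ln s \<le> \<bar>(Re z - \<theta>) * ln s\<bar>" by simp
      also have "\<dots> \<le> 1 * \<bar>ln s\<bar>"
        unfolding abs_mult using z th by (intro mult_right_mono) (auto simp: strip_def)
      finally show ?thesis using s by (simp add: ne powr_def)
    qed
  qed
  then have g0: "Y.FB (\<lambda>z. sc Y (e z) y) M"
    using y0 y1 by (simp add: Y.FB_def Y.Z0.N_scale[OF y(1)] Y.Z1.N_scale[OF y(2)] ne)
  obtain f g where fB: "\<And>n. X.FB (f n) ((A + 1) * R ^ n * M)" and gB: "\<And>n. Y.FB (g n) (R ^ n * M)"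
    and id: "\<And>N z. z \<in> strip \<Longrightarrow>
       sc Y (e z) y = T (\<Sum>n<N. sc X ((z - \<theta>c) ^ n) (f n z)) + sc Y ((z - \<theta>c) ^ N) (g N z)"
    using iterate_step[OF g0 M] by blast
  have ths: "\<theta>c \<in> strip" using th by (auto simp: strip_def)
  obtain fx where fx: "X.FB fx (cinterp_norm X \<theta> x + 1)" "fx \<theta>c = x"
    using X.cinterp_norm_less[OF x(1), of "cinterp_norm X \<theta> x + 1"] by auto
  have xm: "x \<in> sumsp X" using X.calF_mem[OF X.FB_calF[OF fx(1)] ths] fx(2) by simp
  have fm: "f n z \<in> sumsp X" if "z \<in> strip" for n z using X.calF_mem[OF X.FB_calF[OF fB] that] .
  interpret Kt: cnspace "sc X" "sumsp X" "X.K t" by (rule X.K_cnspace[OF t])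
  show ?thesis
  proof (rule Kt.norm_le_of_functionals[OF xm])
    fix l0 assume l0: "Kt.cfunctional l0"
    \<comment> \<open>Holomorphy and passage to the limit are argued with l, contractive for K(1,
      .); the final size is measured with \<open>l0\<close>, since K(t, .) yields t^\<theta>'
      without the factor max 1 t.\<close>
    define l where "l v = l0 v / max 1 t" for v
    have l: "X.S.cfunctional l"
      using X.functional_rescale[OF t l0] by (simp add: l_def[abs_def])
    have ll0: "l0 v = max 1 t * l v" for v using t by (simp add: l_def)
    define H where "H n z = (z - \<theta>c) ^ n * l (f n z)" for n z
    have Hb: "cmod (H n z) \<le> (A + 1) * M * (1/2) ^ n" if z: "z \<in> ball \<theta>c \<rho>" for n z
    proof -
      have zs: "z \<in> strip" using z ball_rho ostrip_subset by auto
      have "cmod (l (f n z)) \<le> (A + 1) * R ^ n * M"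
        using X.S.cf_bound[OF l fm[OF zs], of n] X.K_calF_le[OF fB[of n] zs, of 1] by simp
      then have "cmod (H n z) \<le> cmod (z - \<theta>c) ^ n * ((A + 1) * R ^ n * M)"
        unfolding H_def norm_mult norm_power by (intro mult_left_mono) auto
      also have "\<dots> = (A + 1) * M * (cmod (z - \<theta>c) ^ n * R ^ n)" by (simp add: algebra_simps)
      also have "\<dots> \<le> (A + 1) * M * (1/2) ^ n"
        using z A M by (intro mult_left_mono rho_R) (auto simp: dist_norm norm_minus_commute)
      finally show ?thesis .
    qed
    have sm: "summable (\<lambda>n. (A + 1) * M * (1/2::real) ^ n)"
      by (intro summable_mult summable_geometric) simp
    define U where "U z = (\<Sum>n. H n z)" for z
    have ul: "uniform_limit (ball \<theta>c \<rho>) (\<lambda>N z. \<Sum>n<N. H n z) U sequentially"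
      unfolding U_def by (rule Weierstrass_m_test[OF Hb sm])
    have holH: "H n holomorphic_on ball \<theta>c \<rho>" for n
      unfolding H_def[abs_def]
      by (intro holomorphic_intros holomorphic_on_subset[OF X.functional_holomorphic[OF l X.FB_calF[OF fB]] ball_rho])
    have holU: "U holomorphic_on ball \<theta>c \<rho>"
    proof (rule holomorphic_uniform_sequence[of _ "\<lambda>N z. \<Sum>n<N. H n z"])
      show "(\<lambda>z. \<Sum>n<N. H n z) holomorphic_on ball \<theta>c \<rho>" for N
        by (intro holomorphic_on_sum holH)
      fix z assume "z \<in> ball \<theta>c \<rho>"
      then obtain d where "d > 0" "cball z d \<subseteq> ball \<theta>c \<rho>"
        using open_contains_cball[of "ball \<theta>c \<rho>"] open_ball by blast
      then show "\<exists>d>0. cball z d \<subseteq> ball \<theta>c \<rho> \<and> uniform_limit (cball z d) (\<lambda>N z. \<Sum>n<N. H n z) U sequentially"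
        using uniform_limit_on_subset[OF ul] by blast
    qed auto
    have Ulim: "(\<lambda>N. \<Sum>n<N. H n z) \<longlonglongrightarrow> U z" if "z \<in> ball \<theta>c \<rho>" for z
      by (rule tendsto_uniform_limitI[OF ul that])
    have line: "U z = e z * l x" if z: "z = \<theta>c + Complex 0 r" "\<bar>r\<bar> < \<rho>" for z r
    proof -
      have zs: "z \<in> strip" using z th by (auto simp: strip_def)
      have zb: "z \<in> ball \<theta>c \<rho>" using z by (simp add: dist_norm cmod_def)
      have "cmod (e z * l x - (\<Sum>n<N. H n z)) \<le> A * M * (1/2) ^ N" for N
      proof -
        define w where "w = sc X (e z) x - (\<Sum>n<N. sc X (Complex 0 r ^ n) (f n z))"
        have m: "(\<Sum>n<N. sc X (Complex 0 r ^ n) (f n z)) \<in> sumsp X"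
          by (intro X.S.mem_sum X.S.mem_scale fm zs)
        have "l (\<Sum>n<N. sc X (Complex 0 r ^ n) (f n z)) = (\<Sum>n<N. l (sc X (Complex 0 r ^ n) (f n z)))"
          by (intro X.S.cf_sum[OF l] X.S.mem_scale fm zs)
        also have "\<dots> = (\<Sum>n<N. H n z)"
        proof (rule sum.cong[OF refl])
          fix n
          have "z - \<theta>c = Complex 0 r" using z(1) by simp
          then show "l (sc X (Complex 0 r ^ n) (f n z)) = H n z"
            unfolding H_def by (simp only: X.S.cf_scale[OF l fm[OF zs]])
        qed
        finally have lw: "l w = e z * l x - (\<Sum>n<N. H n z)"
          unfolding w_def using xm m
          by (simp add: X.S.cf_diff[OF l] X.S.cf_scale[OF l] X.S.mem_scale)
        have "cmod (l w) \<le> X.K 1 w"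
          unfolding w_def by (intro X.S.cf_bound[OF l] X.S.mem_diff X.S.mem_scale xm m)
        also have "X.K 1 w \<le> A * (\<bar>r\<bar> ^ N * (R ^ N * M))"
          unfolding w_def z(1)
          by (rule line_estimate[where f = f and g = g and e = e and y = y and M = M]; (rule fB gB x | erule id))
        also have "\<dots> = A * M * (\<bar>r\<bar> ^ N * R ^ N)" by simp
        also have "\<dots> \<le> A * M * (1/2) ^ N"
          using A M z(2) by (intro mult_left_mono rho_R) auto
        finally show ?thesis unfolding lw .
      qed
      then have "\<forall>\<^sub>F N in sequentially. cmod (e z * l x - (\<Sum>n<N. H n z)) \<le> A * M * (1/2) ^ N"
        by (intro always_eventually allI)
      moreover have "(\<lambda>N. A * M * (1/2::real) ^ N) \<longlonglongrightarrow> 0"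
        by (rule tendsto_mult_right_zero[OF LIMSEQ_power_zero]) simp
      ultimately have "(\<lambda>N. e z * l x - (\<Sum>n<N. H n z)) \<longlonglongrightarrow> 0"
        by (rule Lim_null_comparison)
      moreover have "(\<lambda>N. e z * l x - (\<Sum>n<N. H n z)) \<longlonglongrightarrow> e z * l x - U z"
        by (rule tendsto_diff[OF tendsto_const Ulim[OF zb]])
      ultimately have "0 = e z * l x - U z" by (rule LIMSEQ_unique)
      then show ?thesis by simp
    qed
    let ?w = "complex_of_real \<theta>'"
    have wb: "?w \<in> ball \<theta>c \<rho>"
      using th' by (simp add: dist_norm abs_minus_commute flip: of_real_diff)
    have ws: "?w \<in> strip" using wb ball_rho ostrip_subset by blast
    \<comment> \<open>U z and e z l x are holomorphic on the disc and agree on a vertical segment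
      through \<theta>, which accumulates at \<theta>.\<close>
    have "U ?w - e ?w * l x = 0"
    proof (rule analytic_continuation[of "\<lambda>z. U z - e z * l x" "ball \<theta>c \<rho>" "(\<lambda>r. \<theta>c + Complex 0 r) ` {- \<rho><..<\<rho>}" \<theta>c])
      show "(\<lambda>z. U z - e z * l x) holomorphic_on ball \<theta>c \<rho>"
        unfolding e_def by (intro holomorphic_intros holU)
      show "(\<lambda>r. \<theta>c + Complex 0 r) ` {- \<rho><..<\<rho>} \<subseteq> ball \<theta>c \<rho>"
        by (auto simp: dist_norm cmod_def)
      show "\<theta>c islimpt (\<lambda>r. \<theta>c + Complex 0 r) ` {- \<rho><..<\<rho>}"
        unfolding islimpt_approachable
      proof (intro allI impI)
        fix d :: real assume d: "d > 0"
        define r where "r = min d \<rho> / 2"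
        have r: "0 < r" "r < d" "r < \<rho>" using d rho_pos by (auto simp: r_def)
        show "\<exists>z\<in>(\<lambda>r. \<theta>c + Complex 0 r) ` {- \<rho><..<\<rho>}. z \<noteq> \<theta>c \<and> dist z \<theta>c < d"
        proof (rule bexI[of _ "\<theta>c + Complex 0 r"])
          have "cmod (Complex 0 r) = r" using r by (simp add: cmod_def)
          moreover have "Complex 0 r \<noteq> 0" using r by (simp add: complex_eq_iff)
          ultimately show "\<theta>c + Complex 0 r \<noteq> \<theta>c \<and> dist (\<theta>c + Complex 0 r) \<theta>c < d"
            using r by (simp add: dist_norm)
        qed (use r in simp)
      qed
      show "U z - e z * l x = 0" if "z \<in> (\<lambda>r. \<theta>c + Complex 0 r) ` {- \<rho><..<\<rho>}" for z
      proof -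
        from that obtain r where "z = \<theta>c + Complex 0 r" "\<bar>r\<bar> < \<rho>" by (auto simp: abs_less_iff)
        then show ?thesis using line by simp
      qed
    qed (use wb rho_pos in auto)
    then have Ue: "U ?w = e ?w * l x" by simp
    have bnd: "cmod (max 1 t * H n ?w) \<le> (A + 1) * M * t powr \<theta>' * (1/2) ^ n" for n
    proof -
      have "cmod (l0 (f n ?w)) \<le> t powr \<theta>' * ((A + 1) * R ^ n * M)"
        using Kt.cf_bound[OF l0 fm[OF ws], of n] X.K_calF_le[OF fB[of n] ws t] by simp
      then have "cmod (?w - \<theta>c) ^ n * cmod (l0 (f n ?w)) \<le> cmod (?w - \<theta>c) ^ n * (t powr \<theta>' * ((A + 1) * R ^ n * M))"
        by (intro mult_left_mono) auto
      also have "\<dots> = (A + 1) * M * t powr \<theta>' * (cmod (?w - \<theta>c) ^ n * R ^ n)"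
        by (simp add: algebra_simps)
      also have "\<dots> \<le> (A + 1) * M * t powr \<theta>' * (1/2) ^ n"
        using wb A M by (intro mult_left_mono rho_R) (auto simp: dist_norm norm_minus_commute)
      finally show ?thesis
        by (simp add: H_def ll0 norm_mult norm_power mult_ac)
    qed
    have "cmod (max 1 t * (\<Sum>n<N. H n ?w)) \<le> 2 * (A + 1) * M * t powr \<theta>'" for N
    proof -
      have "cmod (max 1 t * (\<Sum>n<N. H n ?w)) \<le> (\<Sum>n<N. cmod (max 1 t * H n ?w))"
        unfolding sum_distrib_left by (rule norm_sum)
      also have "\<dots> \<le> (\<Sum>n<N. (A + 1) * M * t powr \<theta>' * (1/2) ^ n)"
        by (intro sum_mono bnd)
      also have "\<dots> = (A + 1) * M * t powr \<theta>' * (\<Sum>n<N. (1/2) ^ n)"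
        by (simp add: sum_distrib_left)
      also have "\<dots> \<le> (A + 1) * M * t powr \<theta>' * 2"
        using A M by (intro mult_left_mono) (auto simp: sum_gp_strict)
      also have "\<dots> = 2 * (A + 1) * M * t powr \<theta>'" by (simp only: mult_ac)
      finally show ?thesis .
    qed
    moreover have "(\<lambda>N. cmod (max 1 t * (\<Sum>n<N. H n ?w))) \<longlonglongrightarrow> cmod (max 1 t * U ?w)"
      by (rule tendsto_norm[OF tendsto_mult_left[OF Ulim[OF wb]]])
    ultimately have "cmod (max 1 t * U ?w) \<le> 2 * (A + 1) * M * t powr \<theta>'"
      by (intro LIMSEQ_le_const2[of "\<lambda>N. cmod (max 1 t * (\<Sum>n<N. H n ?w))"]) auto
    also have "max 1 t * U ?w = e ?w * l0 x" by (simp add: Ue ll0)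
    finally have "s powr (\<theta>' - \<theta>) * cmod (l0 x) \<le> 2 * (A + 1) * M * t powr \<theta>'"
      by (simp add: norm_mult ne)
    \<comment> \<open>The modulus of e at \<theta>' is s^(\<theta>' - \<theta>); its reciprocal
      becomes the last factor of the claim.\<close>
    then have "s powr (\<theta> - \<theta>') * (s powr (\<theta>' - \<theta>) * cmod (l0 x)) \<le> s powr (\<theta> - \<theta>') * (2 * (A + 1) * M * t powr \<theta>')"
      by (intro mult_left_mono) auto
    moreover have "s powr (\<theta> - \<theta>') * (s powr (\<theta>' - \<theta>) * cmod (l0 x)) = cmod (l0 x)"
      using s by (simp flip: mult.assoc powr_add)
    ultimately show "cmod (l0 x) \<le> 2 * (A + 1) * M * t powr \<theta>' * s powr (\<theta> - \<theta>')"
      by (simp only: mult_ac)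
  qed
qed

end

section \<open>Transfer to the real method\<close>

context bcpl
begin

lemma cinterp_space_diff:
  assumes "x \<in> cinterp_space X c" "y \<in> cinterp_space X c"
  shows "x - y \<in> cinterp_space X c"
proof -
  obtain f g where fg: "FB f (cinterp_norm X c x + 1)" "f (complex_of_real c) = x"
      "FB g (cinterp_norm X c y + 1)" "g (complex_of_real c) = y"
    using cinterp_norm_less[OF assms(1), of "cinterp_norm X c x + 1"]
      cinterp_norm_less[OF assms(2), of "cinterp_norm X c y + 1"] by (metis less_add_one)
  from cinterp_norm_le(1)[OF FB_add[OF fg(1) FB_scale_const[OF fg(3), of "-1"]], of c] fg
  show ?thesis by simp
qed

lemma cinterp_space_inter: "x \<in> sp0 X \<Longrightarrow> x \<in> sp1 X \<Longrightarrow> x \<in> cinterp_space X c"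
  using calF_const[of x] unfolding cinterp_space_def by force

lemma cinterp_space_sumsp:
  assumes "x \<in> cinterp_space X c" "0 < c" "c < 1"
  shows "x \<in> sumsp X"
  using assms calF_mem by (fastforce simp: cinterp_space_def strip_def)

lemma decomp_fun:
  assumes x: "x \<in> sumsp X"
  obtains a b where "\<And>s. 0 < s \<Longrightarrow> a s \<in> sp0 X" "\<And>s. 0 < s \<Longrightarrow> b s \<in> sp1 X"
    "\<And>s. 0 < s \<Longrightarrow> x = a s + b s" "\<And>s. 0 < s \<Longrightarrow> nm0 X (a s) \<le> 2 * K s x"
    "\<And>s. 0 < s \<Longrightarrow> s * nm1 X (b s) \<le> 2 * K s x"
proof -
  have "\<forall>s. \<exists>p. 0 < s \<longrightarrow> fst p \<in> sp0 X \<and> snd p \<in> sp1 X \<and> x = fst p + snd p \<and>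
      nm0 X (fst p) \<le> 2 * K s x \<and> s * nm1 X (snd p) \<le> 2 * K s x"
    using near_optimal_decomp[OF x] by (metis fst_conv snd_conv)
  then obtain p where "\<And>s. 0 < s \<Longrightarrow> fst (p s) \<in> sp0 X \<and> snd (p s) \<in> sp1 X \<and> x = fst (p s) + snd (p s) \<and>
      nm0 X (fst (p s)) \<le> 2 * K s x \<and> s * nm1 X (snd (p s)) \<le> 2 * K s x" by metis
  then show ?thesis using that[of "\<lambda>s. fst (p s)" "\<lambda>s. snd (p s)"] by blast
qed

end

lemma power_powr_swap: "((2::real) ^ n) powr a = (2 powr a) ^ n"
  by (simp add: powr_powr mult.commute flip: powr_realpow)

context binv
begin

text \<open>All preimages are taken in the complex space at \<theta>. Estimates with different
  \<theta>' therefore concern one and the same element.\<close>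

definition Sinv :: "'w \<Rightarrow> 'v" where
  "Sinv y = inv_into (cinterp_space X \<theta>) T y"

lemma Sinv_mem: "y \<in> cinterp_space Y \<theta> \<Longrightarrow> Sinv y \<in> cinterp_space X \<theta>"
  and T_Sinv: "y \<in> cinterp_space Y \<theta> \<Longrightarrow> T (Sinv y) = y"
  and Sinv_T: "x \<in> cinterp_space X \<theta> \<Longrightarrow> Sinv (T x) = x"
  using bij by (auto simp: Sinv_def bij_betw_def inv_into_into f_inv_into_f)

lemma Sinv_sumsp: "y \<in> cinterp_space Y \<theta> \<Longrightarrow> Sinv y \<in> sumsp X"
  using X.cinterp_space_sumsp Sinv_mem th by blast

lemma Sinv_diff:
  assumes "y \<in> cinterp_space Y \<theta>" "y' \<in> cinterp_space Y \<theta>"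
  shows "Sinv (y - y') = Sinv y - Sinv y'"
proof -
  have "T (Sinv y - Sinv y') = y - y'"
    using assms by (simp add: T_diff Sinv_sumsp T_Sinv)
  then show ?thesis
    using Sinv_T[OF X.cinterp_space_diff[OF Sinv_mem Sinv_mem], OF assms] by simp
qed

lemma Sinv_zero: "Sinv 0 = 0"
  using Sinv_diff[of 0 0] Y.cinterp_space_inter[OF Y.Z0.mem_zero Y.Z1.mem_zero] by simp

text \<open>J bounds the J-functional of y at s, so M = s^(-\<theta>) J is admissible in
  \<open>inverse_K_estimate\<close>, and the powers of s combine to s^(-\<theta>'). The case y = 0
  is separate because that estimate asks for M > 0.\<close>

lemma Sinv_K:
  assumes y: "y \<in> sp0 Y" "y \<in> sp1 Y" and s: "0 < s" and t: "0 < t"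
    and J: "nm0 Y y \<le> J" "s * nm1 Y y \<le> J" and th': "\<bar>\<theta>' - \<theta>\<bar> < \<rho>"
  shows "X.K t (Sinv y) \<le> 2 * (A + 1) * J * (t / s) powr \<theta>'"
proof (cases "y = 0")
  case True
  then have "X.K t (Sinv y) = 0" by (simp add: Sinv_zero cnspace.N_zero[OF X.K_cnspace[OF t]])
  moreover have "0 \<le> J" using True J by simp
  ultimately show ?thesis using A by simp
next
  case False
  then have "0 < nm0 Y y" using Y.Z0.N_nonneg[OF y(1)] Y.Z0.N_eq_0[OF y(1)] by linarith
  then have Jp: "0 < J" using J by simp
  have "s powr (1 - \<theta>) * nm1 Y y = s powr (- \<theta>) * (s * nm1 Y y)"
    using s by (simp add: powr_diff powr_minus_divide)
  then have 1: "s powr (1 - \<theta>) * nm1 Y y \<le> s powr (- \<theta>) * J"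
    using mult_left_mono[OF J(2) powr_ge_zero, of s "- \<theta>"] by linarith
  have yc: "y \<in> cinterp_space Y \<theta>" using y Y.cinterp_space_inter by blast
  have "X.K t (Sinv y) \<le> 2 * (A + 1) * (s powr (- \<theta>) * J) * t powr \<theta>' * s powr (\<theta> - \<theta>')"
    by (rule inverse_K_estimate[OF y s _ _ 1 Sinv_mem[OF yc] T_Sinv[OF yc] th' t])
      (use Jp s J(1) in \<open>auto intro: mult_left_mono\<close>)
  also have "\<dots> = 2 * (A + 1) * J * (t powr \<theta>' * (s powr (- \<theta>) * s powr (\<theta> - \<theta>')))"
    by simp
  also have "s powr (- \<theta>) * s powr (\<theta> - \<theta>') = s powr (- \<theta>')"
    by (simp flip: powr_add)
  also have "t powr \<theta>' * s powr (- \<theta>') = (t / s) powr \<theta>'"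
    using s t by (simp add: powr_divide powr_minus_divide)
  finally show ?thesis .
qed

section \<open>Injectivity under a weak type bound\<close>

definition \<epsilon> :: real where "\<epsilon> = \<rho> / 2"

lemma eps: "0 < \<epsilon>" "\<bar>(\<theta> + \<epsilon>) - \<theta>\<bar> < \<rho>" "\<bar>(\<theta> - \<epsilon>) - \<theta>\<bar> < \<rho>"
  using rho_pos by (auto simp: \<epsilon>_def)

text \<open>For x = a s + b s in the kernel, T (a s) = - T (b s) lies in the intersection and has a
  second preimage u s in the complex space. The defect a s - u s does not depend on s: it tends to 0
  as s tends to 0, while x minus it, which is b s + u s, tends to 0 as s tends to infinity. Hence x
  = 0.\<close>

theorem injective_weak_type:
  assumes x: "x \<in> sumsp X" and B: "\<And>s. 0 < s \<Longrightarrow> X.K s x \<le> B * s powr \<theta>" and Tx: "T x = 0"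
  shows "x = 0"
proof -
  obtain a b where a: "\<And>s. 0 < s \<Longrightarrow> a s \<in> sp0 X" and b: "\<And>s. 0 < s \<Longrightarrow> b s \<in> sp1 X"
    and ab: "\<And>s. 0 < s \<Longrightarrow> x = a s + b s"
    and na: "\<And>s. 0 < s \<Longrightarrow> nm0 X (a s) \<le> 2 * X.K s x"
    and nb: "\<And>s. 0 < s \<Longrightarrow> s * nm1 X (b s) \<le> 2 * X.K s x"
    using X.decomp_fun[OF x] by metis
  have Tab: "T (a s) = - T (b s)" if "0 < s" for s
  proof -
    have "T (a s) + T (b s) = 0"
      using ab[OF that] Tx T_add[OF X.sumsp0[OF a[OF that]] X.sumsp1[OF b[OF that]]] by simp
    then show ?thesis by (simp add: eq_neg_iff_add_eq_0)
  qed
  have Ta: "T (a s) \<in> sp0 Y" "T (a s) \<in> sp1 Y" if "0 < s" for s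
    using T_mem0[OF a[OF that]] Y.Z1.mem_neg[OF T_mem1[OF b[OF that]]] Tab[OF that] by simp_all
  then have Tac: "T (a s) \<in> cinterp_space Y \<theta>" if "0 < s" for s
    using Y.cinterp_space_inter that by blast
  define u where "u s = Sinv (T (a s))" for s
  have um: "u s \<in> sumsp X" if "0 < s" for s
    unfolding u_def by (rule Sinv_sumsp[OF Tac[OF that]])
  define c where "c = 2 * (A + 1) * (2 * C * B)"
  have u_le: "X.K 1 (u s) \<le> c * (s powr \<theta> * (1 / s) powr \<theta>')" if s: "0 < s" and th': "\<bar>\<theta>' - \<theta>\<bar> < \<rho>" for s \<theta>'
  proof -
    have "nm0 Y (T (a s)) \<le> C * (2 * X.K s x)"
      using T0[OF a[OF s]] mult_left_mono[OF na[OF s], of C] C by linarith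
    moreover have "s * nm1 Y (T (a s)) \<le> C * (2 * X.K s x)"
    proof -
      have "s * nm1 Y (T (a s)) = s * nm1 Y (T (b s))"
        by (simp add: Tab[OF s] Y.Z1.N_minus T_mem1 b s)
      also have "\<dots> \<le> s * (C * nm1 X (b s))" using s T1[OF b[OF s]] by (intro mult_left_mono) auto
      also have "\<dots> = C * (s * nm1 X (b s))" by simp
      also have "\<dots> \<le> C * (2 * X.K s x)" using nb[OF s] C by (intro mult_left_mono) auto
      finally show ?thesis .
    qed
    ultimately have "X.K 1 (u s) \<le> 2 * (A + 1) * (C * (2 * X.K s x)) * (1 / s) powr \<theta>'"
      unfolding u_def by (intro Sinv_K Ta s th') auto
    also have "\<dots> \<le> 2 * (A + 1) * (C * (2 * (B * s powr \<theta>))) * (1 / s) powr \<theta>'"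
      using A C B[OF s] by (intro mult_right_mono mult_left_mono) auto
    finally show ?thesis unfolding c_def by (simp only: mult_ac)
  qed
  \<comment> \<open>The difference a s - a s' lies in both spaces of the couple, hence in the
    complex space, where \<open>Sinv\<close> undoes T.\<close>
  have const: "a s - u s = a s' - u s'" if s: "0 < s" "0 < s'" for s s'
  proof -
    have "a s - a s' = b s' - b s" using ab[OF s(1)] ab[OF s(2)] by (simp add: algebra_simps)
    then have "a s - a s' \<in> sp0 X" "a s - a s' \<in> sp1 X"
      using X.Z0.mem_diff[OF a[OF s(1)] a[OF s(2)]] X.Z1.mem_diff[OF b[OF s(2)] b[OF s(1)]] by auto
    then have "a s - a s' = Sinv (T (a s - a s'))"
      using Sinv_T X.cinterp_space_inter by simp
    also have "\<dots> = u s - u s'"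
      unfolding u_def using s by (simp add: T_diff X.sumsp0 a Sinv_diff Tac)
    finally show ?thesis by (simp add: algebra_simps)
  qed
  \<comment> \<open>The constant defect is read off at 1/s, the complementary part b s + u s at s,
    so that one limit s to infinity covers both ends. The exponent \<theta> + \<epsilon> makes u s
    small, and \<theta> - \<epsilon> makes u (1/s) small.\<close>
  have "X.K 1 x \<le> 2 * B * s powr (\<theta> - 1) + c * s powr (- \<epsilon>) + 2 * B * s powr (- \<theta>) + c * s powr (- \<epsilon>)"
    if s: "0 < s" for s
  proof -
    have s': "0 < 1 / s" using s by simp
    have ms: "b s \<in> sumsp X" "u s \<in> sumsp X" "a (1/s) \<in> sumsp X" "u (1/s) \<in> sumsp X"
      by (rule X.sumsp1[OF b[OF s]] um[OF s] X.sumsp0[OF a[OF s']] um[OF s'])+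
    have "x = (b s + u s) + (a (1/s) - u (1/s))"
      using ab[OF s] const[OF s s'] by (simp add: algebra_simps)
    then have "X.K 1 x \<le> X.K 1 (b s + u s) + X.K 1 (a (1/s) - u (1/s))"
      using X.S.N_triangle[OF X.S.mem_add[OF ms(1,2)] X.S.mem_diff[OF ms(3,4)]] by simp
    also have "\<dots> \<le> (X.K 1 (b s) + X.K 1 (u s)) + (X.K 1 (a (1/s)) + X.K 1 (u (1/s)))"
      by (intro add_mono X.S.N_triangle X.S.N_diff ms)
    also have "X.K 1 (b s) \<le> 2 * B * s powr (\<theta> - 1)"
    proof -
      have "X.K 1 (b s) \<le> nm1 X (b s)" using X.K_le1[OF b[OF s], of 1] by simp
      moreover have "s * nm1 X (b s) \<le> 2 * (B * s powr \<theta>)" using nb[OF s] B[OF s] by linarith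
      then have "nm1 X (b s) \<le> 2 * (B * s powr \<theta>) / s" using s by (simp add: pos_le_divide_eq mult.commute)
      moreover have "2 * (B * s powr \<theta>) / s = 2 * B * s powr (\<theta> - 1)" using s by (simp add: powr_diff)
      ultimately show ?thesis by linarith
    qed
    also have "X.K 1 (a (1/s)) \<le> 2 * B * s powr (- \<theta>)"
    proof -
      have "(1 / s) powr \<theta> = s powr (- \<theta>)" using s by (simp add: powr_divide powr_minus_divide)
      then show ?thesis
        using X.K_le0[OF a[OF s'], of 1] na[OF s'] B[OF s'] by (simp add: mult.assoc)
    qed
    also have "X.K 1 (u s) \<le> c * s powr (- \<epsilon>)"
    proof -
      have "s powr \<theta> * (1 / s) powr (\<theta> + \<epsilon>) = s powr (- \<epsilon>)"
        using s by (simp add: powr_divide powr_add powr_minus_divide)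
      then show ?thesis using u_le[OF s eps(2)] by simp
    qed
    also have "X.K 1 (u (1/s)) \<le> c * s powr (- \<epsilon>)"
    proof -
      have "(1 / s) powr \<theta> * (1 / (1 / s)) powr (\<theta> - \<epsilon>) = s powr (- \<epsilon>)"
        using s by (simp add: powr_divide powr_diff powr_minus_divide)
      then show ?thesis using u_le[OF s' eps(3)] by simp
    qed
    finally show ?thesis by simp
  qed
  moreover have "((\<lambda>s. 2 * B * s powr (\<theta> - 1) + c * s powr (- \<epsilon>) + 2 * B * s powr (- \<theta>) + c * s powr (- \<epsilon>))
      \<longlongrightarrow> 2 * B * 0 + c * 0 + 2 * B * 0 + c * 0) at_top"
    using th eps(1) by (intro tendsto_intros tendsto_neg_powr filterlim_ident) auto
  ultimately have "X.K 1 x \<le> 2 * B * 0 + c * 0 + 2 * B * 0 + c * 0"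
    by (intro tendsto_lowerbound[where F = at_top]) (auto intro: eventually_mono[OF eventually_gt_at_top[of 0]])
  then have "X.K 1 x = 0" using X.S.N_nonneg[OF x] by simp
  then show ?thesis using X.S.N_eq_0[OF x] by simp
qed

section \<open>Surjectivity: a preimage from dyadic truncations\<close>

definition p :: real where "p = 2 powr (- \<epsilon> / 2)"

lemma p: "0 < p" "p < 1"
  using eps(1) by (auto simp: p_def powr_less_one)

text \<open>The decay 2^(-\<epsilon> n) is split into two equal factors: one makes the series in
  \<open>dominant_index\<close> converge, the other survives in its conclusion.\<close>

lemma p2: "(2 ^ n) powr (- \<epsilon>) = p ^ n * p ^ n"
proof -
  have "p * p = 2 powr (- \<epsilon>)" by (simp add: p_def flip: powr_add)
  then show ?thesis by (simp add: power_powr_swap flip: power_mult_distrib)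
qed

text \<open>16 = 2 times 4 times 2: the factor of \<open>Sinv_K\<close>, the norm of a difference of
  two nearly optimal pieces, and 2^\<theta> <= 2.\<close>

definition c\<^sub>1 :: real where "c\<^sub>1 = 16 * (A + 1)"

lemma c1: "0 < c\<^sub>1" using A by (simp add: c\<^sub>1_def)

text \<open>If all p^n \<beta> n stayed below \<open>\<kappa> (1 - p) / (2 c\<^sub>1)\<close>, the
  remaining factors p^n would sum to at most 1 / (1 - p) and the limit could not exceed \<kappa> /
  2. Trading the series for one dominating index lets q-th powers be estimated termwise later,
  without a triangle inequality in L^q.\<close>

lemma dominant_index:
  fixes \<beta> :: "nat \<Rightarrow> real"
  assumes \<beta>: "\<And>n. 0 \<le> \<beta> n" and \<kappa>: "\<kappa> \<le> L" and lim: "f \<longlonglongrightarrow> L"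
    and f: "\<And>N. f N \<le> c\<^sub>1 * (\<Sum>n<N. p ^ n * p ^ n * \<beta> n)"
  shows "\<exists>n. \<kappa> \<le> 2 * c\<^sub>1 / (1 - p) * p ^ n * \<beta> n"
proof (rule ccontr)
  assume "\<not> ?thesis"
  then have less: "2 * c\<^sub>1 / (1 - p) * p ^ n * \<beta> n < \<kappa>" for n by (simp add: not_le)
  have "0 \<le> 2 * c\<^sub>1 / (1 - p) * p ^ 0 * \<beta> 0" using c1 p \<beta>[of 0] by simp
  then have \<kappa>0: "0 < \<kappa>" using less[of 0] by linarith
  have le: "p ^ n * \<beta> n \<le> \<kappa> * (1 - p) / (2 * c\<^sub>1)" for n
    using less[of n] c1 p by (simp add: field_simps)
  have "f N \<le> \<kappa> / 2" for N
  proof -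
    have "(\<Sum>n<N. p ^ n * p ^ n * \<beta> n) \<le> (\<Sum>n<N. p ^ n * (\<kappa> * (1 - p) / (2 * c\<^sub>1)))"
      unfolding mult.assoc[of "p ^ _" "p ^ _"] using p le by (intro sum_mono mult_left_mono) auto
    also have "\<dots> = (\<Sum>n<N. p ^ n) * (\<kappa> * (1 - p) / (2 * c\<^sub>1))" by (rule sum_distrib_right[symmetric])
    also have "\<dots> \<le> 1 / (1 - p) * (\<kappa> * (1 - p) / (2 * c\<^sub>1))"
      using p \<kappa>0 c1 by (intro mult_right_mono) (auto simp: sum_gp_strict divide_right_mono)
    also have "\<dots> = \<kappa> / (2 * c\<^sub>1)" using p by simp
    finally have "c\<^sub>1 * (\<Sum>n<N. p ^ n * p ^ n * \<beta> n) \<le> c\<^sub>1 * (\<kappa> / (2 * c\<^sub>1))"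
      using c1 by (intro mult_left_mono) auto
    then show ?thesis using f[of N] c1 by simp
  qed
  then have "L \<le> \<kappa> / 2" by (intro LIMSEQ_le_const2[OF lim]) auto
  then show False using \<kappa> \<kappa>0 by simp
qed

text \<open>The truncations a (2^n t) - a (t / 2^n) of y lie in the intersection, so
  \<open>Sinv\<close> applies to them, and the preimages converge to x. Centring the lattice at t
  makes K(t, .) of the increments decay at both ends. The conclusion is pointwise in t and free of
  q, ready for comparison in any of the real norms.\<close>

theorem surjective_weak_type:
  assumes y: "y \<in> sumsp Y" and B: "\<And>s. 0 < s \<Longrightarrow> Y.K s y \<le> B * s powr \<theta>"
  shows "\<exists>x\<in>sumsp X. T x = y \<and> (\<forall>t>0. \<exists>n.
     t powr (- \<theta>) * X.K t x \<le> 2 * c\<^sub>1 / (1 - p) * p ^ n *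
       ((2 * 2 ^ n * t) powr (- \<theta>) * Y.K (2 * 2 ^ n * t) y + (t / 2 ^ n) powr (- \<theta>) * Y.K (t / 2 ^ n) y))"
proof -
  obtain a b where a: "\<And>s. 0 < s \<Longrightarrow> a s \<in> sp0 Y" and b: "\<And>s. 0 < s \<Longrightarrow> b s \<in> sp1 Y"
    and ab: "\<And>s. 0 < s \<Longrightarrow> y = a s + b s"
    and na: "\<And>s. 0 < s \<Longrightarrow> nm0 Y (a s) \<le> 2 * Y.K s y"
    and nb: "\<And>s. 0 < s \<Longrightarrow> s * nm1 Y (b s) \<le> 2 * Y.K s y"
    using Y.decomp_fun[OF y] by metis
  have B0: "0 \<le> B" using B[of 1] Y.K_nonneg[OF y, of 1] by simp
  have dI: "a s' - a s \<in> sp0 Y" "a s' - a s \<in> sp1 Y" "a s' - a s \<in> cinterp_space Y \<theta>"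
    if s: "0 < s" "0 < s'" for s s'
  proof -
    have "a s' - a s = b s - b s'" using ab[OF s(1)] ab[OF s(2)] by (simp add: algebra_simps)
    then show "a s' - a s \<in> sp0 Y" "a s' - a s \<in> sp1 Y"
      using Y.Z0.mem_diff[OF a[OF s(2)] a[OF s(1)]] Y.Z1.mem_diff[OF b[OF s(1)] b[OF s(2)]] by auto
    then show "a s' - a s \<in> cinterp_space Y \<theta>" by (rule Y.cinterp_space_inter)
  qed
  \<comment> \<open>The difference is taken between the a in the first norm and between the b in the
    second. Each side contributes 2 + 2, whence J = 4 K(s', y); both bounds use s <= s'.\<close>
  have dK: "X.K t (Sinv (a s' - a s)) \<le> 8 * (A + 1) * (Y.K s' y * (t / s) powr \<theta>')"
    if s: "0 < s" "s \<le> s'" and t: "0 < t" and th': "\<bar>\<theta>' - \<theta>\<bar> < \<rho>" for s s' t \<theta>'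
  proof -
    have s': "0 < s'" using s by simp
    have m: "Y.K s y \<le> Y.K s' y" by (rule Y.K_mono[OF y s])
    have "nm0 Y (a s' - a s) \<le> 4 * Y.K s' y"
      using Y.Z0.N_diff[OF a[OF s'] a[OF s(1)]] na[OF s'] na[OF s(1)] m by linarith
    moreover have "s * nm1 Y (a s' - a s) \<le> 4 * Y.K s' y"
    proof -
      have "a s' - a s = b s - b s'" using ab[OF s(1)] ab[OF s'] by (simp add: algebra_simps)
      then have "s * nm1 Y (a s' - a s) \<le> s * (nm1 Y (b s) + nm1 Y (b s'))"
        using Y.Z1.N_diff[OF b[OF s(1)] b[OF s']] s by (simp add: mult_left_mono)
      also have "\<dots> \<le> s * nm1 Y (b s) + s' * nm1 Y (b s')"
        using s Y.Z1.N_nonneg[OF b[OF s']] by (simp add: distrib_left mult_right_mono)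
      finally show ?thesis using nb[OF s'] nb[OF s(1)] m by linarith
    qed
    ultimately have "X.K t (Sinv (a s' - a s)) \<le> 2 * (A + 1) * (4 * Y.K s' y) * (t / s) powr \<theta>'"
      by (intro Sinv_K dI s s' t th')
    then show ?thesis by (simp add: algebra_simps)
  qed
  define k where "k s = s powr (- \<theta>) * Y.K s y" for s
  have Kk: "Y.K s y = s powr \<theta> * k s" if "0 < s" for s
    using that by (simp add: k_def powr_minus)
  have k0: "0 \<le> k s" "k s \<le> B" if "0 < s" for s
  proof -
    show "0 \<le> k s" using Y.K_nonneg[OF y, of s] that by (simp add: k_def)
    have "k s \<le> s powr (- \<theta>) * (B * s powr \<theta>)"
      unfolding k_def using B[OF that] by (intro mult_left_mono) auto
    also have "\<dots> = B" using that by (simp add: powr_minus)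
    finally show "k s \<le> B" .
  qed
  define P where "P t n = Sinv (a (2 ^ n * t) - a (t / 2 ^ n))" for t and n :: nat
  have Pm: "P t n \<in> sumsp X" if "0 < t" for t n
    unfolding P_def using that by (intro Sinv_sumsp dI) auto
  have TP: "T (P t n) = a (2 ^ n * t) - a (t / 2 ^ n)" if "0 < t" for t n
    unfolding P_def using that by (intro T_Sinv dI) auto
  define \<beta> where "\<beta> t n = k (2 * 2 ^ n * t) + k (t / 2 ^ n)" for t and n :: nat
  have \<beta>0: "0 \<le> \<beta> t n" "\<beta> t n \<le> 2 * B" if "0 < t" for t n
    using k0[of "2 * 2 ^ n * t"] k0[of "t / 2 ^ n"] that by (auto simp: \<beta>_def)
  have v: "X.K t (P t (Suc n) - P t n) \<le> t powr \<theta> * (c\<^sub>1 * (p ^ n * p ^ n * \<beta> t n))" if t: "0 < t" for t n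
  proof -
    define m where "m = (2::real) ^ n"
    have m: "0 < m" by (simp add: m_def)
    have mp: "m powr (- \<epsilon>) = p ^ n * p ^ n" unfolding m_def by (rule p2)
    have pos: "0 < 2 * m * t" "0 < m * t" "0 < t / m" "0 < t / (2 * m)" using m t by auto
    \<comment> \<open>Passing from n to n + 1 adds one dyadic block at the top, between m t and 2 m
      t, and one at the bottom, between t / (2 m) and t / m.\<close>
    have "P t (Suc n) - P t n = Sinv ((a (2 * m * t) - a (t / (2 * m))) - (a (m * t) - a (t / m)))"
      unfolding P_def m_def power_Suc using t by (intro Sinv_diff[symmetric] dI) auto
    also have "(a (2 * m * t) - a (t / (2 * m))) - (a (m * t) - a (t / m))
        = (a (2 * m * t) - a (m * t)) - (a (t / (2 * m)) - a (t / m))" by (simp add: algebra_simps)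
    also have "Sinv \<dots> = Sinv (a (2 * m * t) - a (m * t)) - Sinv (a (t / (2 * m)) - a (t / m))"
      using pos by (intro Sinv_diff dI) auto
    also have "Sinv (a (t / (2 * m)) - a (t / m)) = - Sinv (a (t / m) - a (t / (2 * m)))"
      using Sinv_diff[OF dI(3)[OF pos(4,4)] dI(3)[OF pos(4,3)]] by (simp add: Sinv_zero)
    finally have e: "P t (Suc n) - P t n = Sinv (a (2 * m * t) - a (m * t)) + Sinv (a (t / m) - a (t / (2 * m)))"
      by simp
    have "X.K t (P t (Suc n) - P t n) \<le> X.K t (Sinv (a (2 * m * t) - a (m * t))) + X.K t (Sinv (a (t / m) - a (t / (2 * m))))"
      unfolding e using pos by (intro X.K_triangle[OF t] Sinv_sumsp dI) auto
    \<comment> \<open>In the top block, with s = m t, the exponent \<theta> + \<epsilon> gains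
      m^(-\<epsilon>); in the bottom block, with s = t / (2 m), the exponent \<theta> - \<epsilon>
      does.\<close>
    also have "X.K t (Sinv (a (2 * m * t) - a (m * t))) \<le> 8 * (A + 1) * (Y.K (2 * m * t) y * (t / (m * t)) powr (\<theta> + \<epsilon>))"
      using pos t by (intro dK eps) auto
    also have "Y.K (2 * m * t) y * (t / (m * t)) powr (\<theta> + \<epsilon>) = 2 powr \<theta> * (t powr \<theta> * (p ^ n * p ^ n * k (2 * m * t)))"
    proof -
      have "(2 * m * t) powr \<theta> * (t / (m * t)) powr (\<theta> + \<epsilon>) = 2 powr \<theta> * (t powr \<theta> * m powr (- \<epsilon>))"
        using t m by (simp add: powr_mult powr_divide powr_add powr_minus field_simps)
      then show ?thesis unfolding Kk[OF pos(1)] mp by (simp add: mult_ac)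
    qed
    also have "\<dots> \<le> 2 * (t powr \<theta> * (p ^ n * p ^ n * k (2 * m * t)))"
      using th powr_mono[of \<theta> 1 2] p k0(1)[OF pos(1)] by (intro mult_right_mono) auto
    also have "X.K t (Sinv (a (t / m) - a (t / (2 * m)))) \<le> 8 * (A + 1) * (Y.K (t / m) y * (t / (t / (2 * m))) powr (\<theta> - \<epsilon>))"
      using pos t m by (intro dK eps) (auto intro: divide_left_mono)
    also have "Y.K (t / m) y * (t / (t / (2 * m))) powr (\<theta> - \<epsilon>) = 2 powr (\<theta> - \<epsilon>) * (t powr \<theta> * (p ^ n * p ^ n * k (t / m)))"
    proof -
      have "(t / m) powr \<theta> * (t / (t / (2 * m))) powr (\<theta> - \<epsilon>) = 2 powr (\<theta> - \<epsilon>) * (t powr \<theta> * m powr (- \<epsilon>))"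
        using t m by (simp add: powr_mult powr_divide powr_diff powr_minus field_simps)
      then show ?thesis unfolding Kk[OF pos(3)] mp by (simp add: mult_ac)
    qed
    also have "\<dots> \<le> 2 * (t powr \<theta> * (p ^ n * p ^ n * k (t / m)))"
      using th eps(1) powr_mono[of "\<theta> - \<epsilon>" 1 2] p k0(1)[OF pos(3)] by (intro mult_right_mono) auto
    finally have "X.K t (P t (Suc n) - P t n) \<le> 8 * (A + 1) * (2 * (t powr \<theta> * (p ^ n * p ^ n * k (2 * m * t))))
       + 8 * (A + 1) * (2 * (t powr \<theta> * (p ^ n * p ^ n * k (t / m))))"
      using A by (simp add: mult_left_mono)
    also have "\<dots> = t powr \<theta> * (c\<^sub>1 * (p ^ n * p ^ n * \<beta> t n))"
      by (simp add: c\<^sub>1_def \<beta>_def m_def algebra_simps)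
    finally show ?thesis .
  qed
  have P0: "P t 0 = 0" for t by (simp add: P_def Sinv_zero)
  have sumP: "(\<Sum>i<n. P t (Suc i) - P t i) = P t n" for t n
    using sum_lessThan_telescope[of "P t" n] P0 by simp
  \<comment> \<open>The element x is obtained on the lattice through 1 in the norm K(1, .), where
    \<beta> <= 2 B leaves a geometric series.\<close>
  have "summable (\<lambda>n. X.K 1 (P 1 (Suc n) - P 1 n))"
  proof (rule summable_comparison_test'[of "\<lambda>n. c\<^sub>1 * (2 * B) * (p * p) ^ n" 0])
    have "p * p < 1" using p mult_strict_mono[of p 1 p 1] by simp
    then show "summable (\<lambda>n. c\<^sub>1 * (2 * B) * (p * p) ^ n)"
      using p by (intro summable_mult summable_geometric) auto
    fix n
    have "p ^ n * p ^ n * \<beta> 1 n \<le> p ^ n * p ^ n * (2 * B)"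
      using p \<beta>0[of 1 n] by (intro mult_left_mono) auto
    then have "c\<^sub>1 * (p ^ n * p ^ n * \<beta> 1 n) \<le> c\<^sub>1 * (p ^ n * p ^ n * (2 * B))"
      by (rule mult_left_mono) (use c1 in simp)
    then show "norm (X.K 1 (P 1 (Suc n) - P 1 n)) \<le> c\<^sub>1 * (2 * B) * (p * p) ^ n"
      using v[of 1 n] X.S.N_nonneg[OF X.S.mem_diff[OF Pm Pm], of 1 1 "Suc n" n]
      by (simp add: power_mult_distrib mult_ac)
  qed
  then obtain x where x: "x \<in> sumsp X" and lim: "X.S.vlim (P 1) x sequentially"
    using X.sumsp_summable_converges[of "\<lambda>n. P 1 (Suc n) - P 1 n"] X.S.mem_diff[OF Pm Pm]
    unfolding sumP by (metis zero_less_one)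
  have pow_neg: "(\<lambda>n. ((2::real) ^ n) powr r) \<longlonglongrightarrow> 0" if "r < 0" for r
    unfolding power_powr_swap using that by (intro LIMSEQ_power_zero) (simp add: powr_less_one)
  \<comment> \<open>The limit is the same for every lattice \<open>2\<^sup>n t\<close>, so \<open>K(t, x)\<close> may be estimated on the lattice through \<open>t\<close>.\<close>
  have limt: "X.S.vlim (P t) x sequentially" if t: "0 < t" for t
  proof -
    \<comment> \<open>Ordering 1 and t meets the condition s <= s' of \<open>dK\<close> in both
      cases. The difference of the two truncations again consists of a top and a bottom block, each
      of size 2^(-\<epsilon> n).\<close>
    define M where "M = max 1 t"
    define m where "m = min 1 t"
    have Mm: "0 < m" "m \<le> M" "m \<le> 1" "1 \<le> M" "(m = 1 \<and> M = t) \<or> (m = t \<and> M = 1)"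
      using t by (auto simp: M_def m_def)
    define D where "D = 8 * (A + 1) * B * M powr \<theta> * (1 / m powr (\<theta> + \<epsilon>) + 1 / m powr (\<theta> - \<epsilon>))"
    have bnd: "X.K 1 (P M n - P m n) \<le> D * (2 ^ n) powr (- \<epsilon>)" for n
    proof -
      define w where "w = (2::real) ^ n"
      have w: "0 < w" by (simp add: w_def)
      have pos: "0 < w * M" "0 < w * m" "0 < M / w" "0 < m / w" using w Mm by auto
      have "P M n - P m n = Sinv ((a (w * M) - a (M / w)) - (a (w * m) - a (m / w)))"
        unfolding P_def w_def using Mm by (intro Sinv_diff[symmetric] dI) auto
      also have "(a (w * M) - a (M / w)) - (a (w * m) - a (m / w))
          = (a (w * M) - a (w * m)) - (a (M / w) - a (m / w))" by (simp add: algebra_simps)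
      also have "Sinv \<dots> = Sinv (a (w * M) - a (w * m)) - Sinv (a (M / w) - a (m / w))"
        using pos by (intro Sinv_diff dI) auto
      finally have "X.K 1 (P M n - P m n) \<le> X.K 1 (Sinv (a (w * M) - a (w * m))) + X.K 1 (Sinv (a (M / w) - a (m / w)))"
        using pos by (simp add: X.S.N_diff Sinv_sumsp dI)
      also have "X.K 1 (Sinv (a (w * M) - a (w * m))) \<le> 8 * (A + 1) * (Y.K (w * M) y * (1 / (w * m)) powr (\<theta> + \<epsilon>))"
        using pos Mm w by (intro dK eps) auto
      also have "Y.K (w * M) y * (1 / (w * m)) powr (\<theta> + \<epsilon>) \<le> B * (w * M) powr \<theta> * (1 / (w * m)) powr (\<theta> + \<epsilon>)"
        using B[OF pos(1)] by (intro mult_right_mono) auto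
      also have "\<dots> = B * M powr \<theta> * (1 / m powr (\<theta> + \<epsilon>)) * w powr (- \<epsilon>)"
        using w Mm by (simp add: powr_mult powr_divide powr_add powr_minus field_simps)
      also have "X.K 1 (Sinv (a (M / w) - a (m / w))) \<le> 8 * (A + 1) * (Y.K (M / w) y * (1 / (m / w)) powr (\<theta> - \<epsilon>))"
        using pos Mm w by (intro dK eps) (auto intro: divide_right_mono)
      also have "Y.K (M / w) y * (1 / (m / w)) powr (\<theta> - \<epsilon>) \<le> B * (M / w) powr \<theta> * (1 / (m / w)) powr (\<theta> - \<epsilon>)"
        using B[OF pos(3)] by (intro mult_right_mono) auto
      also have "\<dots> = B * M powr \<theta> * (1 / m powr (\<theta> - \<epsilon>)) * w powr (- \<epsilon>)"
        using w Mm by (simp add: powr_divide powr_diff powr_minus field_simps)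
      finally have "X.K 1 (P M n - P m n) \<le> 8 * (A + 1) * (B * M powr \<theta> * (1 / m powr (\<theta> + \<epsilon>)) * w powr (- \<epsilon>))
          + 8 * (A + 1) * (B * M powr \<theta> * (1 / m powr (\<theta> - \<epsilon>)) * w powr (- \<epsilon>))"
        using A by (simp add: mult_left_mono)
      also have "\<dots> = D * w powr (- \<epsilon>)" by (simp add: D_def algebra_simps add_divide_distrib)
      finally show ?thesis by (simp add: w_def)
    qed
    have "X.K 1 (P t n - P 1 n) \<le> D * (2 ^ n) powr (- \<epsilon>)" for n
      using bnd[of n] Mm(5) X.S.N_commute[OF Pm Pm, of t 1 n n] t by auto
    moreover have "(\<lambda>n. D * (2 ^ n) powr (- \<epsilon>)) \<longlonglongrightarrow> D * 0"
      using eps(1) by (intro tendsto_intros pow_neg) auto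
    moreover have Pd: "P t n - P 1 n \<in> sumsp X" for n
      by (intro X.S.mem_diff Pm t) simp
    ultimately have "X.S.vlim (\<lambda>n. P t n - P 1 n) 0 sequentially"
      by (intro X.S.vlimI[where g = "\<lambda>n. D * (2 ^ n) powr (- \<epsilon>)"] always_eventually allI X.S.mem_zero) auto
    then have "X.S.vlim (\<lambda>n. (P t n - P 1 n) + P 1 n) (0 + x) sequentially"
      by (intro X.S.vlim_add always_eventually allI Pd Pm X.S.mem_zero x lim) auto
    then show ?thesis by simp
  qed
  have "T x = y"
  proof -
    have "Y.S.vlim (\<lambda>n. T (P 1 n)) (T x) sequentially"
      by (rule T_vlim[OF lim _ x]) (intro always_eventually allI Pm, simp)
    \<comment> \<open>The error y - T (P 1 n) is a (2^(-n)) + b (2^n), which the weak type bound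
      sends to 0 because 0 < \<theta> < 1.\<close>
    moreover have "Y.S.vlim (\<lambda>n. T (P 1 n)) y sequentially"
    proof (rule Y.S.vlimI[where g = "\<lambda>n. 2 * B * (2 ^ n) powr (\<theta> - 1) + 2 * B * (2 ^ n) powr (- \<theta>)"])
      show "\<forall>\<^sub>F n in sequentially. T (P 1 n) \<in> sumsp Y"
        by (intro always_eventually allI T_mem Pm) simp
      have "Y.K 1 (T (P 1 n) - y) \<le> 2 * B * (2 ^ n) powr (\<theta> - 1) + 2 * B * (2 ^ n) powr (- \<theta>)" for n
      proof -
        define w where "w = (2::real) ^ n"
        have w: "0 < w" "0 < 1 / w" by (auto simp: w_def)
        have "T (P 1 n) - y = - (a (1 / w) + b w)"
          using TP[of 1 n] ab[OF w(1)] by (simp add: w_def algebra_simps)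
        then have "Y.K 1 (T (P 1 n) - y) = Y.K 1 (a (1 / w) + b w)"
          using Y.S.N_minus[OF Y.sumspI[OF a[OF w(2)] b[OF w(1)]]] by simp
        also have "\<dots> \<le> nm0 Y (a (1 / w)) + nm1 Y (b w)"
          using Y.K_le[OF a[OF w(2)] b[OF w(1)], of 1] by simp
        also have "nm0 Y (a (1 / w)) \<le> 2 * B * w powr (- \<theta>)"
          using na[OF w(2)] B[OF w(2)] w by (simp add: powr_divide powr_minus_divide)
        also have "nm1 Y (b w) \<le> 2 * B * w powr (\<theta> - 1)"
        proof -
          have "w * nm1 Y (b w) \<le> 2 * (B * w powr \<theta>)" using nb[OF w(1)] B[OF w(1)] by linarith
          then have "nm1 Y (b w) \<le> 2 * (B * w powr \<theta>) / w" using w by (simp add: pos_le_divide_eq mult.commute)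
          then show ?thesis using w by (simp add: powr_diff)
        qed
        finally show ?thesis by (simp add: w_def)
      qed
      then show "\<forall>\<^sub>F n in sequentially. Y.K 1 (T (P 1 n) - y) \<le> 2 * B * (2 ^ n) powr (\<theta> - 1) + 2 * B * (2 ^ n) powr (- \<theta>)"
        by simp
      have "(\<lambda>n. 2 * B * (2 ^ n) powr (\<theta> - 1) + 2 * B * (2 ^ n) powr (- \<theta>)) \<longlonglongrightarrow> 2 * B * 0 + 2 * B * 0"
        using th by (intro tendsto_intros pow_neg) auto
      then show "(\<lambda>n. 2 * B * (2 ^ n) powr (\<theta> - 1) + 2 * B * (2 ^ n) powr (- \<theta>)) \<longlonglongrightarrow> 0" by simp
    qed (rule y)
    moreover have mem: "T (P 1 n) \<in> sumsp Y" for n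
      by (intro T_mem Pm) simp
    ultimately have "Y.S.vlim (\<lambda>n. y - T (P 1 n)) 0 sequentially" "Y.S.vlim (\<lambda>n. T (P 1 n)) (T x) sequentially"
      using Y.S.N_commute[OF mem y] by (auto simp: Y.S.vlim_def)
    from Y.S.vlim_add[OF _ _ this(1) _ _ this(2)] have "Y.S.vlim (\<lambda>n. y) (T x) sequentially"
      using mem y T_mem[OF x] by (auto simp: Y.S.mem_zero intro!: always_eventually Y.S.mem_diff)
    then have "Y.K 1 (y - T x) = 0" unfolding Y.S.vlim_def by (simp add: tendsto_const_iff)
    then show ?thesis using Y.S.N_eq_0[OF Y.S.mem_diff[OF y T_mem[OF x]]] by simp
  qed
  \<comment> \<open>On the lattice through t, K(t, x) is the limit of K(t, P t N), and the triangle
    inequality bounds the latter by the increments up to N.\<close>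
  moreover have "\<exists>n. t powr (- \<theta>) * X.K t x \<le> 2 * c\<^sub>1 / (1 - p) * p ^ n * \<beta> t n" if t: "0 < t" for t
  proof (rule dominant_index)
    interpret Kt: cnspace "sc X" "sumsp X" "X.K t" by (rule X.K_cnspace[OF t])
    show "0 \<le> \<beta> t n" for n using \<beta>0 t by blast
    have "Kt.vlim (P t) x sequentially"
    proof (rule Kt.vlimI[where g = "\<lambda>n. max 1 (t / 1) * X.K 1 (P t n - x)"])
      show "\<forall>\<^sub>F n in sequentially. X.K t (P t n - x) \<le> max 1 (t / 1) * X.K 1 (P t n - x)"
        using t x by (intro always_eventually allI X.K_dilate X.S.mem_diff Pm) auto
      have "(\<lambda>n. max 1 (t / 1) * X.K 1 (P t n - x)) \<longlonglongrightarrow> max 1 (t / 1) * 0"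
        by (intro tendsto_intros limt[OF t, unfolded X.S.vlim_def])
      then show "(\<lambda>n. max 1 (t / 1) * X.K 1 (P t n - x)) \<longlonglongrightarrow> 0" by simp
    qed (auto intro!: always_eventually Pm t x)
    from Kt.vlim_imp_norm[OF this _ x] have "(\<lambda>n. X.K t (P t n)) \<longlonglongrightarrow> X.K t x"
      by (auto intro!: always_eventually Pm t)
    then show "(\<lambda>n. t powr (- \<theta>) * X.K t (P t n)) \<longlonglongrightarrow> t powr (- \<theta>) * X.K t x"
      by (intro tendsto_intros)
    show "t powr (- \<theta>) * X.K t (P t N) \<le> c\<^sub>1 * (\<Sum>n<N. p ^ n * p ^ n * \<beta> t n)" for N
    proof -
      have "X.K t (P t N) \<le> (\<Sum>n<N. X.K t (P t (Suc n) - P t n))"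
        using Kt.N_sum[of "{..<N}" "\<lambda>n. P t (Suc n) - P t n"] X.S.mem_diff[OF Pm[OF t] Pm[OF t]]
        by (simp add: sumP)
      also have "\<dots> \<le> (\<Sum>n<N. t powr \<theta> * (c\<^sub>1 * (p ^ n * p ^ n * \<beta> t n)))"
        by (intro sum_mono v t)
      also have "\<dots> = t powr \<theta> * (c\<^sub>1 * (\<Sum>n<N. p ^ n * p ^ n * \<beta> t n))" by (simp add: sum_distrib_left)
      finally have "t powr (- \<theta>) * X.K t (P t N) \<le> t powr (- \<theta>) * (t powr \<theta> * (c\<^sub>1 * (\<Sum>n<N. p ^ n * p ^ n * \<beta> t n)))"
        by (intro mult_left_mono) auto
      also have "\<dots> = c\<^sub>1 * (\<Sum>n<N. p ^ n * p ^ n * \<beta> t n)" using t by (simp add: powr_minus)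
      finally show ?thesis .
    qed
  qed simp
  ultimately show ?thesis using x unfolding \<beta>_def k_def by blast
qed

end

section \<open>Norms of the real method\<close>

lemma bcplI: "banach_couple X \<Longrightarrow> bcpl X"
  by (simp add: bcpl.intro bcpl_axioms.intro banach_couple_def)

context bcpl
begin

definition rint :: "real \<Rightarrow> real \<Rightarrow> 'v \<Rightarrow> real \<Rightarrow> ennreal" where
  "rint c r x t = indicator {0<..} t * ennreal ((t powr (- c) * K t x) powr r / t)"

text \<open>K(t, x) increases with t; extended by 0 to t <= 0 it is monotone on the whole line and
  therefore Borel.\<close>

lemma rint_measurable:
  assumes x: "x \<in> sumsp X"
  shows "rint c r x \<in> borel_measurable borel"
proof -
  define m where "m t = (if 0 < t then K t x else 0)" for t
  have "mono m"
    unfolding mono_def m_def using K_mono[OF x] K_nonneg[OF x] by (auto simp: less_imp_le)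
  then have [measurable]: "m \<in> borel_measurable borel" by (rule borel_measurable_mono)
  have "rint c r x = (\<lambda>t. indicator {0<..} t * ennreal ((t powr (- c) * m t) powr r / t))"
    by (auto simp: rint_def m_def indicator_def)
  then show ?thesis by simp
qed

lemma rinterp_fun_finite_q:
  "rinterp_fun X c (ennreal r) x = (\<integral>\<^sup>+ t. rint c r x t \<partial>lborel)" if "0 \<le> r"
  using that by (simp add: rinterp_fun_def rint_def)

text \<open>Invariance of dt/t under dilation, with l as the Jacobian; the indicator of the half
  line is preserved since l > 0.\<close>

lemma rint_dilate:
  assumes x: "x \<in> sumsp X" and l: "0 < l"
  shows "(\<integral>\<^sup>+ t. ennreal l * rint c r x (l * t) \<partial>lborel) = (\<integral>\<^sup>+ t. rint c r x t \<partial>lborel)"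
proof -
  have [measurable]: "rint c r x \<in> borel_measurable borel" by (rule rint_measurable[OF x])
  have "(\<integral>\<^sup>+ t. rint c r x t \<partial>lborel) = ennreal \<bar>l\<bar> * (\<integral>\<^sup>+ t. rint c r x (0 + l * t) \<partial>lborel)"
    using l by (intro nn_integral_real_affine) auto
  then show ?thesis using l by (simp add: nn_integral_cmult)
qed

text \<open>The space with exponent q embeds in the one with q = \<infinity>. For finite q it
  suffices to integrate over [t, 2t], where K(s, x) >= K(t, x) and the weights s^(-c) and 1/s are at
  least their values at 2t; length t against 1 / (2t) leaves the factor 2.\<close>

lemma rinterp_weak_type:
  assumes x: "x \<in> sumsp X" and c: "0 < c" and q: "1 \<le> q" and fin: "rinterp_fun X c q x < \<infinity>"
  shows "\<exists>B. \<forall>s>0. K s x \<le> B * s powr c"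
proof (cases q)
  case (real r)
  then have r: "1 \<le> r" using q by simp
  define I where "I = enn2real (rinterp_fun X c q x)"
  have I: "rinterp_fun X c q x = ennreal I" using fin by (simp add: I_def)
  have I0: "0 \<le> I" by (simp add: I_def)
  have "K t x \<le> ((2 * I) powr (1 / r) * 2 powr c) * t powr c" if t: "0 < t" for t
  proof -
    define g where "g = (2 * t) powr (- c) * K t x"
    have g0: "0 \<le> g" using K_nonneg[OF x, of t] t by (simp add: g_def)
    have "emeasure lborel {t..2 * t} = ennreal t" using t by simp
    moreover have "ennreal (g powr r / (2 * t) * t) = ennreal (g powr r / (2 * t)) * ennreal t"
      using t by (intro ennreal_mult) auto
    ultimately have "ennreal (g powr r / (2 * t) * t) = ennreal (g powr r / (2 * t)) * emeasure lborel {t..2 * t}"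
      by simp
    also have "\<dots> = (\<integral>\<^sup>+ s. ennreal (g powr r / (2 * t)) * indicator {t..2 * t} s \<partial>lborel)"
      by (simp add: nn_integral_cmult_indicator)
    also have "\<dots> \<le> (\<integral>\<^sup>+ s. rint c r x s \<partial>lborel)"
    proof (rule nn_integral_mono)
      fix s
      show "ennreal (g powr r / (2 * t)) * indicator {t..2 * t} s \<le> rint c r x s"
      proof (cases "s \<in> {t..2 * t}")
        case True
        then have s: "0 < s" "t \<le> s" "s \<le> 2 * t" using t by auto
        have "(2 * t) powr (- c) \<le> s powr (- c)" using s c by (intro powr_mono2') auto
        then have "g \<le> s powr (- c) * K s x"
          unfolding g_def using K_mono[OF x t s(2)] K_nonneg[OF x, of t] t by (intro mult_mono) auto
        then have "g powr r / (2 * t) \<le> (s powr (- c) * K s x) powr r / s"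
          using g0 r s by (intro frac_le powr_mono2) auto
        then show ?thesis using True s by (simp add: rint_def ennreal_leI)
      qed simp
    qed
    also have "\<dots> = ennreal I" using I r by (simp add: real flip: rinterp_fun_finite_q)
    finally have "g powr r \<le> 2 * I" using t I0 by (simp add: field_simps)
    then have "(g powr r) powr (1 / r) \<le> (2 * I) powr (1 / r)" using r by (intro powr_mono2) auto
    then have "g \<le> (2 * I) powr (1 / r)" using g0 r by (simp add: powr_powr)
    moreover have "K t x = g * (2 * t) powr c" using t by (simp add: g_def powr_minus)
    ultimately show ?thesis using t by (simp add: powr_mult mult_right_mono mult.assoc[symmetric])
  qed
  then show ?thesis by blast
next
  case top
  define I where "I = enn2real (rinterp_fun X c q x)"
  have I: "rinterp_fun X c q x = ennreal I" using fin by (simp add: I_def)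
  have "K t x \<le> I * t powr c" if t: "0 < t" for t
  proof -
    have "ennreal (t powr (- c) * K t x) \<le> rinterp_fun X c q x"
      unfolding rinterp_fun_def using top t by (auto intro: SUP_upper)
    then have "t powr (- c) * K t x \<le> I" unfolding I by (simp add: I_def)
    then have "t powr c * (t powr (- c) * K t x) \<le> t powr c * I" by (intro mult_left_mono) auto
    moreover have "t powr c * (t powr (- c) * K t x) = K t x" using t by (simp add: powr_minus)
    ultimately show ?thesis by (metis mult.commute)
  qed
  then show ?thesis by blast
qed

end

text \<open>For finite q, \<open>rinterp_fun\<close> is the q-th power of the norm. There (2 c)^q
  arises from bounding a sum of two values by twice their maximum, and 2 / (1 - p) from two dilated
  integrals times the geometric series.\<close>

definition hardy_const :: "ennreal \<Rightarrow> real \<Rightarrow> real \<Rightarrow> real" where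
  "hardy_const q c p = (if q = \<infinity> then 2 * c else (2 * c) powr enn2real q * (2 / (1 - p)))"

text \<open>A Hardy-type inequality: since \<open>dt/t\<close> is dilation invariant, every term of the lattice
  contributes the same integral, and the factors \<open>p\<^sup>n\<close> make the series converge.\<close>

lemma rinterp_compare:
  assumes X: "banach_couple X" and Y: "banach_couple Y" and x: "x \<in> sumsp X" and y: "y \<in> sumsp Y"
    and c: "0 \<le> c" and p: "0 < p" "p < 1" and q: "1 \<le> q"
    and le: "\<And>t. 0 < t \<Longrightarrow> \<exists>n. t powr (- \<theta>) * Kfun X t x \<le> c * p ^ n *
       ((2 * 2 ^ n * t) powr (- \<theta>) * Kfun Y (2 * 2 ^ n * t) y + (t / 2 ^ n) powr (- \<theta>) * Kfun Y (t / 2 ^ n) y)"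
  shows "rinterp_fun X \<theta> q x \<le> ennreal (hardy_const q c p) * rinterp_fun Y \<theta> q y"
proof -
  interpret X: bcpl X by (rule bcplI[OF X])
  interpret Y: bcpl Y by (rule bcplI[OF Y])
  define k where "k t = t powr (- \<theta>) * Kfun Y t y" for t
  have k0: "0 \<le> k t" if "0 < t" for t using that Y.K_nonneg[OF y, of t] by (simp add: k_def)
  have kx0: "0 \<le> t powr (- \<theta>) * Kfun X t x" if "0 < t" for t using that X.K_nonneg[OF x, of t] by simp
  \<comment> \<open>The maximum suits powers better than the sum, since (max u v)^r <= u^r + v^r;
    the price is the factor 2 in 2 c.\<close>
  have le': "\<exists>n. t powr (- \<theta>) * Kfun X t x \<le> 2 * c * p ^ n * max (k (2 * 2 ^ n * t)) (k (t / 2 ^ n))"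
    if t: "0 < t" for t
  proof -
    obtain n where "t powr (- \<theta>) * Kfun X t x \<le> c * p ^ n * (k (2 * 2 ^ n * t) + k (t / 2 ^ n))"
      using le[OF t] unfolding k_def by blast
    also have "\<dots> \<le> c * p ^ n * (2 * max (k (2 * 2 ^ n * t)) (k (t / 2 ^ n)))"
      using c p by (intro mult_left_mono) auto
    finally show ?thesis by (auto simp: mult_ac)
  qed
  show ?thesis
  proof (cases q)
    case (real r)
    then have r: "1 \<le> r" using q by simp
    define d where "d = (2 * c) powr r"
    have d: "0 \<le> d" by (simp add: d_def)
    define l where "l n i = (if i then 2 * 2 ^ n else 1 / 2 ^ n :: real)" for n :: nat and i
    have l: "0 < l n i" for n i by (simp add: l_def)
    define G where "G n t = ennreal (d * p ^ n) *
      (ennreal (l n True) * Y.rint \<theta> r y (l n True * t) + ennreal (l n False) * Y.rint \<theta> r y (l n False * t))" for n t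
    have [measurable]: "Y.rint \<theta> r y \<in> borel_measurable borel" by (rule Y.rint_measurable[OF y])
    have dil: "ennreal (l n i) * Y.rint \<theta> r y (l n i * t) = ennreal (k (l n i * t) powr r / t)" if t: "0 < t" for n i t
    proof -
      have "Y.rint \<theta> r y (l n i * t) = ennreal (k (l n i * t) powr r / (l n i * t))"
        using t l[of n i] by (simp add: Y.rint_def k_def)
      then have "ennreal (l n i) * Y.rint \<theta> r y (l n i * t) = ennreal (l n i) * ennreal (k (l n i * t) powr r / (l n i * t))"
        by (rule arg_cong)
      also have "\<dots> = ennreal (l n i * (k (l n i * t) powr r / (l n i * t)))"
        using t l[of n i] by (intro ennreal_mult[symmetric]) auto
      also have "l n i * (k (l n i * t) powr r / (l n i * t)) = k (l n i * t) powr r / t"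
        using l[of n i] by simp
      finally show ?thesis .
    qed
    \<comment> \<open>The index n depends on t. Summing over all n removes the choice, so no
      measurable selection is needed, and each G n is measurable by itself.\<close>
    have "X.rint \<theta> r x t \<le> (\<Sum>n. G n t)" for t
    proof (cases "0 < t")
      case t: True
      obtain n where n: "t powr (- \<theta>) * Kfun X t x \<le> 2 * c * p ^ n * max (k (2 * 2 ^ n * t)) (k (t / 2 ^ n))"
        using le'[OF t] by blast
      define u v where "u = k (l n True * t)" and "v = k (l n False * t)"
      have uv: "0 \<le> u" "0 \<le> v" using k0 l t by (auto simp: u_def v_def)
      have "(t powr (- \<theta>) * Kfun X t x) powr r \<le> (2 * c * p ^ n * max u v) powr r"
        using n kx0[OF t] r by (intro powr_mono2) (auto simp: u_def v_def l_def)
      also have "\<dots> = d * (p ^ n) powr r * max u v powr r"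
        using c p uv by (simp add: powr_mult d_def)
      also have "\<dots> \<le> d * p ^ n * (u powr r + v powr r)"
      proof (intro mult_mono)
        have "p ^ n \<le> 1" using p by (simp add: power_le_one)
        then show "(p ^ n) powr r \<le> p ^ n"
          using p r powr_mono'[of 1 r "p ^ n"] by simp
        show "max u v powr r \<le> u powr r + v powr r" by (simp add: max_def)
      qed (use d p in auto)
      finally have "(t powr (- \<theta>) * Kfun X t x) powr r / t \<le> d * p ^ n * (u powr r + v powr r) / t"
        using t by (intro divide_right_mono) auto
      then have "X.rint \<theta> r x t \<le> ennreal (d * p ^ n * (u powr r / t + v powr r / t))"
        using t by (simp add: X.rint_def ennreal_leI add_divide_distrib distrib_left)
      also have "\<dots> = G n t"
        using t d p by (simp add: G_def dil u_def v_def ennreal_mult)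
      also have "\<dots> \<le> (\<Sum>n. G n t)"
        using sum_le_suminf[of "\<lambda>n. G n t" "{n}"] by simp
      finally show ?thesis .
    qed (simp add: X.rint_def)
    then have "rinterp_fun X \<theta> q x \<le> (\<integral>\<^sup>+ t. (\<Sum>n. G n t) \<partial>lborel)"
      using r by (simp add: real X.rinterp_fun_finite_q nn_integral_mono)
    also have "\<dots> = (\<Sum>n. \<integral>\<^sup>+ t. G n t \<partial>lborel)"
      by (intro nn_integral_suminf) (simp add: G_def)
    also have "(\<lambda>n. \<integral>\<^sup>+ t. G n t \<partial>lborel) = (\<lambda>n. ennreal (2 * d * p ^ n) * rinterp_fun Y \<theta> q y)"
    proof
      fix n
      have "(\<integral>\<^sup>+ t. G n t \<partial>lborel) = ennreal (d * p ^ n) *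
          (\<integral>\<^sup>+ t. ennreal (l n True) * Y.rint \<theta> r y (l n True * t) + ennreal (l n False) * Y.rint \<theta> r y (l n False * t) \<partial>lborel)"
        unfolding G_def by (rule nn_integral_cmult) measurable
      also have "(\<integral>\<^sup>+ t. ennreal (l n True) * Y.rint \<theta> r y (l n True * t) + ennreal (l n False) * Y.rint \<theta> r y (l n False * t) \<partial>lborel)
          = (\<integral>\<^sup>+ t. ennreal (l n True) * Y.rint \<theta> r y (l n True * t) \<partial>lborel) + (\<integral>\<^sup>+ t. ennreal (l n False) * Y.rint \<theta> r y (l n False * t) \<partial>lborel)"
        by (rule nn_integral_add) measurable
      also have "\<dots> = rinterp_fun Y \<theta> q y + rinterp_fun Y \<theta> q y"
        using r by (simp only: Y.rint_dilate[OF y l] real Y.rinterp_fun_finite_q)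
      finally have "(\<integral>\<^sup>+ t. G n t \<partial>lborel) = ennreal (d * p ^ n) * (rinterp_fun Y \<theta> q y + rinterp_fun Y \<theta> q y)" .
      also have "\<dots> = ennreal (2 * d * p ^ n) * rinterp_fun Y \<theta> q y"
        using d p by (simp add: mult_2[symmetric] ennreal_mult mult_ac)
      finally show "(\<integral>\<^sup>+ t. G n t \<partial>lborel) = ennreal (2 * d * p ^ n) * rinterp_fun Y \<theta> q y" .
    qed
    also have "(\<Sum>n. ennreal (2 * d * p ^ n) * rinterp_fun Y \<theta> q y) = (\<Sum>n. ennreal (2 * d * p ^ n)) * rinterp_fun Y \<theta> q y"
      by (rule ennreal_suminf_multc)
    also have "(\<Sum>n. ennreal (2 * d * p ^ n)) = ennreal (2 * d * (1 / (1 - p)))"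
      using p d by (intro suminf_ennreal_eq sums_mult geometric_sums) auto
    also have "2 * d * (1 / (1 - p)) = hardy_const q c p"
      using r by (simp add: hardy_const_def real d_def)
    finally show ?thesis .
  next
    case top
    have "ennreal (t powr (- \<theta>) * Kfun X t x) \<le> ennreal (hardy_const q c p) * rinterp_fun Y \<theta> q y" if t: "0 < t" for t
    proof -
      obtain n where n: "t powr (- \<theta>) * Kfun X t x \<le> 2 * c * p ^ n * max (k (2 * 2 ^ n * t)) (k (t / 2 ^ n))"
        using le'[OF t] by blast
      then obtain s where s: "0 < s" "t powr (- \<theta>) * Kfun X t x \<le> 2 * c * p ^ n * k s"
        using t by (metis divide_pos_pos max_def mult_pos_pos zero_less_numeral zero_less_power)
      have "p ^ n \<le> 1" using p by (simp add: power_le_one)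
      then have "2 * c * p ^ n * k s \<le> 2 * c * 1 * k s"
        using c k0[OF s(1)] by (intro mult_right_mono mult_left_mono) auto
      then have "ennreal (t powr (- \<theta>) * Kfun X t x) \<le> ennreal (2 * c * k s)"
        using s by (intro ennreal_leI) simp
      also have "\<dots> = ennreal (2 * c) * ennreal (k s)" using c k0[OF s(1)] by (simp add: ennreal_mult)
      also have "\<dots> \<le> ennreal (2 * c) * rinterp_fun Y \<theta> q y"
        unfolding rinterp_fun_def k_def using top s by (auto intro!: mult_left_mono SUP_upper)
      finally show ?thesis using top by (simp add: hardy_const_def)
    qed
    then show ?thesis
      unfolding rinterp_fun_def[of X] using top by (auto intro!: SUP_least)
  qed
qed

lemma rinterp_norm_mono:
  assumes "rinterp_fun X \<theta> q x \<le> ennreal d * rinterp_fun Y \<theta> q y" "rinterp_fun Y \<theta> q y < \<infinity>" "0 \<le> d" "1 \<le> q"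
  shows "rinterp_fun X \<theta> q x < \<infinity>"
    and "rinterp_norm X \<theta> q x \<le> (if q = \<infinity> then d else d powr (1 / enn2real q)) * rinterp_norm Y \<theta> q y"
proof -
  define I where "I = enn2real (rinterp_fun Y \<theta> q y)"
  have I: "rinterp_fun Y \<theta> q y = ennreal I" "0 \<le> I" using assms(2) by (auto simp: I_def)
  have le: "rinterp_fun X \<theta> q x \<le> ennreal (d * I)" using assms(1,3) I by (simp add: ennreal_mult)
  then show "rinterp_fun X \<theta> q x < \<infinity>" using le_less_trans[OF le ennreal_less_top] by simp
  have le': "enn2real (rinterp_fun X \<theta> q x) \<le> d * I"
    using le I assms(3) by (intro enn2real_leI) auto
  then have "enn2real (rinterp_fun X \<theta> q x) powr (1 / enn2real q) \<le> (d * I) powr (1 / enn2real q)"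
    by (intro powr_mono2) auto
  then show "rinterp_norm X \<theta> q x \<le> (if q = \<infinity> then d else d powr (1 / enn2real q)) * rinterp_norm Y \<theta> q y"
    using le' I(2) assms(3) unfolding rinterp_norm_def I_def[symmetric] by (auto simp: powr_mult)
qed

text \<open>Finiteness of the q-norm enters the construction of preimages and the injectivity
  through the weak type bound alone, so these arguments are the same for all q; the exponent returns
  in the comparison of norms.\<close>

theorem theorem4p11:
  fixes X :: "('v::ab_group_add) bcouple" and Y :: "('w::ab_group_add) bcouple"
    and T :: "'v \<Rightarrow> 'w" and \<theta> :: real
  assumes "banach_couple X" and "banach_couple Y"
    and "couple_operator X Y T"
    and "0 < \<theta>" and "\<theta> < 1"
    and "invertible_between (cinterp_space X \<theta>) (cinterp_norm X \<theta>)
           (cinterp_space Y \<theta>) (cinterp_norm Y \<theta>) T"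
  shows "\<forall>q::ennreal. 1 \<le> q \<longrightarrow>
           invertible_between (rinterp_space X \<theta> q) (rinterp_norm X \<theta> q)
             (rinterp_space Y \<theta> q) (rinterp_norm Y \<theta> q) T"
proof (intro allI impI)
  fix q :: ennreal assume q: "1 \<le> q"
  interpret X: bcpl X by (rule bcplI[OF assms(1)])
  interpret Y: bcpl Y by (rule bcplI[OF assms(2)])
  obtain C0 C1 where C01: "\<And>x. x \<in> sp0 X \<Longrightarrow> nm0 Y (T x) \<le> C0 * nm0 X x"
    "\<And>x. x \<in> sp1 X \<Longrightarrow> nm1 Y (T x) \<le> C1 * nm1 X x"
    using assms(3) unfolding couple_operator_def by blast
  \<comment> \<open>Taking the maximum with 1 makes the common constant positive, as the locale
    asks; enlarging the two given constants preserves the bounds.\<close>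
  define C where "C = max 1 (max C0 C1)"
  obtain A where A: "A > 0" "\<And>x. x \<in> cinterp_space X \<theta> \<Longrightarrow> cinterp_norm X \<theta> x \<le> A * cinterp_norm Y \<theta> (T x)"
    and bij: "bij_betw T (cinterp_space X \<theta>) (cinterp_space Y \<theta>)"
    using assms(6) unfolding invertible_between_def by blast
  interpret binv X Y T C \<theta> A
  proof unfold_locales
    have C_ge: "C0 \<le> C" "C1 \<le> C" by (auto simp: C_def)
    show "nm0 Y (T x) \<le> C * nm0 X x" if "x \<in> sp0 X" for x
      using C01(1)[OF that] mult_right_mono[OF C_ge(1) X.Z0.N_nonneg[OF that]] by linarith
    show "nm1 Y (T x) \<le> C * nm1 X x" if "x \<in> sp1 X" for x
      using C01(2)[OF that] mult_right_mono[OF C_ge(2) X.Z1.N_nonneg[OF that]] by linarith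
  qed (use assms A bij in \<open>auto simp: C_def\<close>)
  define h where "h d = (if q = \<infinity> then d else d powr (1 / enn2real q))" for d :: real
  define d1 where "d1 = hardy_const q C (1/2)"
  define d2 where "d2 = hardy_const q (2 * c\<^sub>1 / (1 - p)) p"
  have d: "0 \<le> d1" "0 \<le> d2"
    using C c1 p by (auto simp: d1_def d2_def hardy_const_def)
  have fwd: "T x \<in> rinterp_space Y \<theta> q" "rinterp_norm Y \<theta> q (T x) \<le> h d1 * rinterp_norm X \<theta> q x"
    if "x \<in> rinterp_space X \<theta> q" for x
  proof -
    have x: "x \<in> sumsp X" "rinterp_fun X \<theta> q x < \<infinity>" using that by (auto simp: rinterp_space_def)
    have "rinterp_fun Y \<theta> q (T x) \<le> ennreal d1 * rinterp_fun X \<theta> q x"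
      unfolding d1_def
    proof (rule rinterp_compare[OF assms(2,1) T_mem[OF x(1)] x(1) _ _ _ q])
      fix t :: real assume t: "0 < t"
      have "t powr (- \<theta>) * Kfun Y t (T x) \<le> t powr (- \<theta>) * (C * Kfun X t x)"
        using T_K[OF x(1) t] by (intro mult_left_mono) auto
      moreover have "0 \<le> C * ((2 * t) powr (- \<theta>) * Kfun X (2 * t) x)"
        using C X.K_nonneg[OF x(1), of "2 * t"] t by simp
      \<comment> \<open>Boundedness of T is the comparison at index 0: the value at t / 2^0 = t
        already dominates, and the one at 2 t is nonnegative. The ratio 1/2 is an arbitrary choice
        in (0, 1).\<close>
      ultimately show "\<exists>n. t powr (- \<theta>) * Kfun Y t (T x) \<le> C * (1/2) ^ n *
         ((2 * 2 ^ n * t) powr (- \<theta>) * Kfun X (2 * 2 ^ n * t) x + (t / 2 ^ n) powr (- \<theta>) * Kfun X (t / 2 ^ n) x)"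
        by (intro exI[of _ 0]) (simp add: algebra_simps)
    qed (use C in auto)
    from rinterp_norm_mono[OF this x(2) d(1) q] show "T x \<in> rinterp_space Y \<theta> q"
      "rinterp_norm Y \<theta> q (T x) \<le> h d1 * rinterp_norm X \<theta> q x"
      using T_mem[OF x(1)] by (auto simp: rinterp_space_def h_def)
  qed
  have inj: "x = x'" if x: "x \<in> rinterp_space X \<theta> q" and x': "x' \<in> rinterp_space X \<theta> q" and T: "T x = T x'" for x x'
  proof -
    have m: "x \<in> sumsp X" "x' \<in> sumsp X" using x x' by (auto simp: rinterp_space_def)
    obtain B B' where B: "\<And>s. 0 < s \<Longrightarrow> Kfun X s x \<le> B * s powr \<theta>" "\<And>s. 0 < s \<Longrightarrow> Kfun X s x' \<le> B' * s powr \<theta>"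
      using X.rinterp_weak_type[OF m(1) th(1) q] X.rinterp_weak_type[OF m(2) th(1) q] x x'
      unfolding rinterp_space_def by blast
    have "x - x' = 0"
    proof (rule injective_weak_type)
      show "Kfun X s (x - x') \<le> (B + B') * s powr \<theta>" if s: "0 < s" for s
        using cnspace.N_diff[OF X.K_cnspace[OF s] m] B(1)[OF s] B(2)[OF s] by (simp add: algebra_simps)
    qed (use m T in \<open>auto simp: X.S.mem_diff T_diff\<close>)
    then show ?thesis by simp
  qed
  have bwd: "\<exists>x\<in>rinterp_space X \<theta> q. T x = y \<and> rinterp_norm X \<theta> q x \<le> h d2 * rinterp_norm Y \<theta> q y"
    if "y \<in> rinterp_space Y \<theta> q" for y
  proof -
    have y: "y \<in> sumsp Y" "rinterp_fun Y \<theta> q y < \<infinity>" using that by (auto simp: rinterp_space_def)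
    obtain B where B: "\<And>s. 0 < s \<Longrightarrow> Kfun Y s y \<le> B * s powr \<theta>"
      using Y.rinterp_weak_type[OF y(1) th(1) q y(2)] by blast
    from surjective_weak_type[OF y(1) B] obtain x where x: "x \<in> sumsp X" "T x = y"
      and le: "\<And>t. 0 < t \<Longrightarrow> \<exists>n. t powr (- \<theta>) * Kfun X t x \<le> 2 * c\<^sub>1 / (1 - p) * p ^ n *
       ((2 * 2 ^ n * t) powr (- \<theta>) * Kfun Y (2 * 2 ^ n * t) y + (t / 2 ^ n) powr (- \<theta>) * Kfun Y (t / 2 ^ n) y)"
      by blast
    have "rinterp_fun X \<theta> q x \<le> ennreal d2 * rinterp_fun Y \<theta> q y"
      unfolding d2_def by (rule rinterp_compare[OF assms(1,2) x(1) y(1) _ p q le]) (use c1 p in auto)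
    from rinterp_norm_mono[OF this y(2) d(2) q] show ?thesis
      using x by (auto simp: rinterp_space_def h_def)
  qed
  have nn: "0 \<le> rinterp_norm X \<theta> q x" "0 \<le> rinterp_norm Y \<theta> q y" for x y
    by (auto simp: rinterp_norm_def)
  define E where "E = max 1 (max (h d1) (h d2))"
  have "rinterp_norm Y \<theta> q (T x) \<le> E * rinterp_norm X \<theta> q x \<and> rinterp_norm X \<theta> q x \<le> E * rinterp_norm Y \<theta> q (T x)"
    if x: "x \<in> rinterp_space X \<theta> q" for x
  proof
    have "h d1 * rinterp_norm X \<theta> q x \<le> E * rinterp_norm X \<theta> q x"
      by (intro mult_right_mono nn) (simp add: E_def)
    then show "rinterp_norm Y \<theta> q (T x) \<le> E * rinterp_norm X \<theta> q x" using fwd(2)[OF x] by linarith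
    \<comment> \<open>The preimage constructed from T x carries the norm bound, and injectivity
      identifies it with x.\<close>
    obtain x' where x': "x' \<in> rinterp_space X \<theta> q" "T x' = T x" "rinterp_norm X \<theta> q x' \<le> h d2 * rinterp_norm Y \<theta> q (T x)"
      using bwd[OF fwd(1)[OF x]] by blast
    have "x' = x" by (rule inj[OF x'(1) x x'(2)])
    moreover have "h d2 * rinterp_norm Y \<theta> q (T x) \<le> E * rinterp_norm Y \<theta> q (T x)"
      by (intro mult_right_mono nn) (simp add: E_def)
    ultimately show "rinterp_norm X \<theta> q x \<le> E * rinterp_norm Y \<theta> q (T x)" using x'(3) by simp
  qed
  moreover have "bij_betw T (rinterp_space X \<theta> q) (rinterp_space Y \<theta> q)"
    unfolding bij_betw_def inj_on_def using inj fwd(1) bwd by blast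
  moreover have "0 < E" by (simp add: E_def)
  ultimately show "invertible_between (rinterp_space X \<theta> q) (rinterp_norm X \<theta> q)
      (rinterp_space Y \<theta> q) (rinterp_norm Y \<theta> q) T"
    unfolding invertible_between_def by blast
qed

end
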